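(* Let $H$ be a separable real Hilbert space and let $K\subset H$ be a GB-set. Let $\rho(K)$ denote the order of the Steiner entire function $f_K$, and, when $\rho(K)=1$, let $\sigma(K)$ denote its type. Then $\rho(K)\le 1$. If $\rho(K)=1$, then $\sigma(K)\le V_1(K)$. Moreover, for every $\rho\in[0,1]$ there exists a GB-set $K$ in some separable real Hilbert space with $\rho(K)=\rho$.
   Context: Intrinsic volumes: for a nonempty compact convex $K\subset\mathbb{R}^d$, the numbers $V_0(K)=1,V_1(K),\dots,V_d(K)$ are defined by $\mathrm{Vol}_d(K+\lambda B^d)=\sum_{k=0}^d \kappa_{d-k}V_k(K)\lambda^{d-k}$ for all $\lambda\ge 0$, where $B^d$ is the Euclidean unit ball and $\kappa_j=\mathrm{Vol}_j(B^j)=\pi^{j/2}/\Gamma(j/2+1)$; set $V_k(K)=0$ for $k>\dim K$. They do not depend on the ambient dimension, so they are defined for every finite-dimensional nonempty compact convex set in a Hilbert space. For a nonempty compact convex $K$ in a separable real Hilbert space $H$, $V_k(K):=\sup V_k(K')\in[0,\infty]$, the supremum being over all finite-dimensional compact convex $K'\subset K$. A GB-set (Gaussian bounded set) is a nonempty compact convex set $K\subset H$ with $V_1(K)<\infty$; it is known that then $V_k(K)\le V_1(K)^k/k!<\infty$ for all $k\ge0$. The Steiner entire function of a GB-set $K$ is $f_K(z)=\sum_{k=0}^\infty V_k(K)z^k$, $z\in\mathbb{C}$; it is entire. For an entire function $f$ let $M_f(r)=\max_{|z|=r}|f(z)|$. The order of $f$ is the infimum of all real $\mu$ such that $f(z)=O(e^{|z|^\mu})$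 as $|z|\to\infty$. If $f$ has order $\rho$ with $0<\rho<\infty$, its type is the infimum of all $A>0$ such that $M_f(r)<e^{Ar^\rho}$ for all sufficiently large $r$; equivalently the type is $\limsup_{r\to\infty} r^{-\rho}\ln M_f(r)$. *)

theory Defs
  imports "HOL-Analysis.Analysis" "HOL-Library.Landau_Symbols"
begin

text \<open>
  HOL cannot quantify existentially over types, so existence in some separable real Hilbert space
  is stated in the space of square-summable real sequences, into which every separable real
  Hilbert space embeds isometrically.
\<close>

typedef ell2 = "{x :: nat \<Rightarrow> real. summable (\<lambda>i. (x i)\<^sup>2)}"
  morphisms ell2_nth Abs_ell2
  by (rule exI[of _ "\<lambda>_. 0"]) simp

setup_lifting type_definition_ell2

lemma summable_ell2_nth: "summable (\<lambda>i. (ell2_nth x i)\<^sup>2)"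
  using ell2_nth[of x] by simp

lemma summable_mult_square:
  fixes x y :: "nat \<Rightarrow> real"
  assumes "summable (\<lambda>i. (x i)\<^sup>2)" "summable (\<lambda>i. (y i)\<^sup>2)"
  shows "summable (\<lambda>i. x i * y i)"
proof (rule summable_comparison_test'[of "\<lambda>i. (x i)\<^sup>2 + (y i)\<^sup>2" 0])
  show "summable (\<lambda>i. (x i)\<^sup>2 + (y i)\<^sup>2)" using assms by (rule summable_add)
  fix i
  have "0 \<le> (\<bar>x i\<bar> - \<bar>y i\<bar>)\<^sup>2" by simp
  then have "2 * (\<bar>x i\<bar> * \<bar>y i\<bar>) \<le> (x i)\<^sup>2 + (y i)\<^sup>2" by (simp add: power2_diff)
  moreover have "0 \<le> \<bar>x i\<bar> * \<bar>y i\<bar>" by simp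
  ultimately show "norm (x i * y i) \<le> (x i)\<^sup>2 + (y i)\<^sup>2" unfolding real_norm_def abs_mult by linarith
qed

lemma summable_add_square:
  fixes x y :: "nat \<Rightarrow> real"
  assumes "summable (\<lambda>i. (x i)\<^sup>2)" "summable (\<lambda>i. (y i)\<^sup>2)"
  shows "summable (\<lambda>i. (x i + y i)\<^sup>2)"
  using summable_add[OF summable_add[OF assms] summable_mult[OF summable_mult_square[OF assms], of 2]]
  by (simp add: power2_sum algebra_simps)

instantiation ell2 :: real_vector
begin

lift_definition zero_ell2 :: ell2 is "\<lambda>_. 0" by simp
lift_definition plus_ell2 :: "ell2 \<Rightarrow> ell2 \<Rightarrow> ell2" is "\<lambda>x y i. x i + y i"
  by (rule summable_add_square)
lift_definition uminus_ell2 :: "ell2 \<Rightarrow> ell2" is "\<lambda>x i. - x i" by simp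
lift_definition minus_ell2 :: "ell2 \<Rightarrow> ell2 \<Rightarrow> ell2" is "\<lambda>x y i. x i - y i"
  subgoal for x y using summable_add_square[of x "\<lambda>i. - y i"] by simp
  done
lift_definition scaleR_ell2 :: "real \<Rightarrow> ell2 \<Rightarrow> ell2" is "\<lambda>c x i. c * x i"
  by (simp add: power_mult_distrib summable_mult)

instance by standard (transfer; simp add: algebra_simps fun_eq_iff)+

end

instantiation ell2 :: real_inner
begin

lift_definition inner_ell2 :: "ell2 \<Rightarrow> ell2 \<Rightarrow> real" is "\<lambda>x y. \<Sum>i. x i * y i" .

definition norm_ell2 :: "ell2 \<Rightarrow> real" where "norm_ell2 x = sqrt (inner x x)"
definition dist_ell2 :: "ell2 \<Rightarrow> ell2 \<Rightarrow> real" where "dist_ell2 x y = norm (x - y)"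
definition sgn_ell2 :: "ell2 \<Rightarrow> ell2" where "sgn_ell2 x = x /\<^sub>R norm x"
definition uniformity_ell2 :: "(ell2 \<times> ell2) filter"
  where "uniformity_ell2 = (INF e\<in>{0 <..}. principal {(x, y). dist x y < e})"
definition open_ell2 :: "ell2 set \<Rightarrow> bool"
  where "open_ell2 U \<longleftrightarrow> (\<forall>x\<in>U. eventually (\<lambda>(x', y). x' = x \<longrightarrow> y \<in> U) uniformity)"

instance
proof
  fix x y z :: ell2 and r :: real and U :: "ell2 set"
  show "inner x y = inner y x" by transfer (simp add: mult.commute)
  show "inner (x + y) z = inner x z + inner y z"
    by transfer (simp add: distrib_right suminf_add summable_mult_square)
  show "inner (r *\<^sub>R x) y = r * inner x y"
    by transfer (simp add: mult.assoc suminf_mult summable_mult_square)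
  show "0 \<le> inner x x"
    by transfer (simp add: suminf_nonneg summable_mult_square)
  show "inner x x = 0 \<longleftrightarrow> x = 0"
    by transfer (subst suminf_eq_zero_iff; simp add: summable_mult_square fun_eq_iff)
qed (fact norm_ell2_def dist_ell2_def sgn_ell2_def uniformity_ell2_def open_ell2_def)+

end

lemma norm_ell2_square: "(norm x)\<^sup>2 = (\<Sum>i. (ell2_nth x i)\<^sup>2)" for x :: ell2
proof -
  have "(norm x)\<^sup>2 = inner x x" by (simp add: power2_norm_eq_inner)
  then show ?thesis by (simp add: inner_ell2.rep_eq power2_eq_square)
qed

lemma sum_square_le_norm_ell2:
  "finite A \<Longrightarrow> (\<Sum>i\<in>A. (ell2_nth x i)\<^sup>2) \<le> (norm x)\<^sup>2"
  unfolding norm_ell2_square by (rule sum_le_suminf) (auto simp: summable_ell2_nth)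

lemma abs_nth_le_norm_ell2: "\<bar>ell2_nth x i\<bar> \<le> norm x"
  using sum_square_le_norm_ell2[of "{i}" x] by (simp add: abs_le_square_iff[symmetric])

instance ell2 :: complete_space
proof
  fix X :: "nat \<Rightarrow> ell2"
  assume X: "Cauchy X"
  have "Cauchy (\<lambda>n. ell2_nth (X n) i)" for i
  proof (rule metric_CauchyI)
    fix e :: real assume "0 < e"
    then obtain M where M: "\<And>m n. m \<ge> M \<Longrightarrow> n \<ge> M \<Longrightarrow> dist (X m) (X n) < e"
      using metric_CauchyD[OF X] by blast
    have "dist (ell2_nth (X m) i) (ell2_nth (X n) i) < e" if "m \<ge> M" "n \<ge> M" for m n
      using abs_nth_le_norm_ell2[of "X m - X n" i] M[OF that]
      by (simp add: dist_norm minus_ell2.rep_eq)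
    then show "\<exists>M. \<forall>m\<ge>M. \<forall>n\<ge>M. dist (ell2_nth (X m) i) (ell2_nth (X n) i) < e" by blast
  qed
  then have "\<forall>i. \<exists>l. (\<lambda>n. ell2_nth (X n) i) \<longlonglongrightarrow> l"
    by (simp add: Cauchy_convergent_iff convergent_def)
  then obtain l where l: "\<And>i. (\<lambda>n. ell2_nth (X n) i) \<longlonglongrightarrow> l i" by metis
  have bound: "\<exists>M. \<forall>m\<ge>M. \<forall>k. (\<Sum>i<k. (ell2_nth (X m) i - l i)\<^sup>2) \<le> e\<^sup>2" if "0 < e" for e :: real
  proof -
    obtain M where M: "\<And>m n. m \<ge> M \<Longrightarrow> n \<ge> M \<Longrightarrow> dist (X m) (X n) < e"
      using metric_CauchyD[OF X \<open>0 < e\<close>] by blast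
    have "(\<Sum>i<k. (ell2_nth (X m) i - l i)\<^sup>2) \<le> e\<^sup>2" if m: "m \<ge> M" for m k
    proof (rule tendsto_upperbound)
      show "(\<lambda>n. \<Sum>i<k. (ell2_nth (X m) i - ell2_nth (X n) i)\<^sup>2)
              \<longlonglongrightarrow> (\<Sum>i<k. (ell2_nth (X m) i - l i)\<^sup>2)"
        by (intro tendsto_intros l)
      show "\<forall>\<^sub>F n in sequentially. (\<Sum>i<k. (ell2_nth (X m) i - ell2_nth (X n) i)\<^sup>2) \<le> e\<^sup>2"
      proof (rule eventually_sequentiallyI[of M])
        fix n assume n: "M \<le> n"
        have "(\<Sum>i<k. (ell2_nth (X m) i - ell2_nth (X n) i)\<^sup>2) \<le> (norm (X m - X n))\<^sup>2"
          using sum_square_le_norm_ell2[of "{..<k}" "X m - X n"] by (simp add: minus_ell2.rep_eq)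
        also have "\<dots> \<le> e\<^sup>2"
          using M[OF m n] by (intro power_mono) (auto simp: dist_norm)
        finally show "(\<Sum>i<k. (ell2_nth (X m) i - ell2_nth (X n) i)\<^sup>2) \<le> e\<^sup>2" .
      qed
    qed simp
    then show ?thesis by blast
  qed
  have diff: "summable (\<lambda>i. (ell2_nth (X m) i - l i)\<^sup>2)"
    if "\<forall>k. (\<Sum>i<k. (ell2_nth (X m) i - l i)\<^sup>2) \<le> e\<^sup>2" for m and e :: real
    using that by (intro summableI_nonneg_bounded[of _ "e\<^sup>2"]) auto
  obtain m0 where "\<forall>k. (\<Sum>i<k. (ell2_nth (X m0) i - l i)\<^sup>2) \<le> 1\<^sup>2"
    using bound[of 1] by auto
  from summable_add_square[OF summable_ell2_nth[of "- X m0"] diff[OF this]]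
  have "summable (\<lambda>i. (l i)\<^sup>2)"
    by (simp add: uminus_ell2.rep_eq)
  then have L: "ell2_nth (Abs_ell2 l) = l" by (simp add: Abs_ell2_inverse)
  have "X \<longlonglongrightarrow> Abs_ell2 l"
  proof (rule metric_LIMSEQ_I)
    fix r :: real assume "0 < r"
    then obtain M where M: "\<And>m k. m \<ge> M \<Longrightarrow> (\<Sum>i<k. (ell2_nth (X m) i - l i)\<^sup>2) \<le> (r/2)\<^sup>2"
      using bound[of "r/2"] by auto
    have "dist (X m) (Abs_ell2 l) < r" if m: "m \<ge> M" for m
    proof -
      have "(norm (X m - Abs_ell2 l))\<^sup>2 = (\<Sum>i. (ell2_nth (X m) i - l i)\<^sup>2)"
        by (simp add: norm_ell2_square minus_ell2.rep_eq L)
      also have "\<dots> \<le> (r/2)\<^sup>2"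
        using M[OF m] by (intro suminf_le_const diff[of m "r/2"]) auto
      finally have "norm (X m - Abs_ell2 l) \<le> r/2"
        using \<open>0 < r\<close> by (simp add: power2_le_iff_abs_le)
      then show ?thesis using \<open>0 < r\<close> by (simp add: dist_norm)
    qed
    then show "\<exists>M. \<forall>m\<ge>M. dist (X m) (Abs_ell2 l) < r" by blast
  qed
  then show "convergent X" by (auto simp: convergent_def)
qed

lemma ell2_dense_rat_lists:
  fixes x :: ell2
  assumes "0 < e"
  shows "\<exists>qs :: rat list. dist x (Abs_ell2 (\<lambda>i. if i < length qs then of_rat (qs ! i) else 0)) < e"
proof -
  define d where "d = e\<^sup>2 / 2"
  have d: "0 < d" using assms by (simp add: d_def)
  obtain n where n: "\<bar>\<Sum>i. (ell2_nth x (i + n))\<^sup>2\<bar> < d"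
    using suminf_exist_split[OF d summable_ell2_nth[of x]] by auto
  define c where "c = sqrt (d / (n + 1))"
  have c: "0 < c" using d by (simp add: c_def)
  have "\<exists>q. \<bar>ell2_nth x i - of_rat q\<bar> < c" for i
  proof -
    obtain q where "ell2_nth x i - c < of_rat q" "of_rat q < ell2_nth x i + c"
      using of_rat_dense[of "ell2_nth x i - c" "ell2_nth x i + c"] c by auto
    then show ?thesis by (intro exI[of _ q]) linarith
  qed
  then obtain q where q: "\<And>i. \<bar>ell2_nth x i - of_rat (q i)\<bar> < c" by metis
  define qs where "qs = map q [0..<n]"
  define f :: "nat \<Rightarrow> real" where "f = (\<lambda>i. if i < length qs then of_rat (qs ! i) else 0)"
  have f: "f i = (if i < n then of_rat (q i) else 0)" for i by (simp add: f_def qs_def)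
  have "summable (\<lambda>i. (f i)\<^sup>2)" by (rule summable_finite[of "{..<n}"]) (auto simp: f)
  then have F: "ell2_nth (Abs_ell2 f) = f" by (simp add: Abs_ell2_inverse)
  have "summable (\<lambda>i. (ell2_nth x i - f i)\<^sup>2)"
    using summable_ell2_nth[of "x - Abs_ell2 f"] by (simp add: minus_ell2.rep_eq F)
  note split = suminf_split_initial_segment[OF this, of n]
  have "(norm (x - Abs_ell2 f))\<^sup>2 = (\<Sum>i. (ell2_nth x i - f i)\<^sup>2)"
    by (simp add: norm_ell2_square minus_ell2.rep_eq F)
  also have "\<dots> = (\<Sum>i. (ell2_nth x (i + n))\<^sup>2) + (\<Sum>i<n. (ell2_nth x i - of_rat (q i))\<^sup>2)"
    unfolding split by (simp add: f)
  also have "(\<Sum>i<n. (ell2_nth x i - of_rat (q i))\<^sup>2) \<le> (\<Sum>i<n. d / (n + 1))"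
  proof (rule sum_mono)
    fix i
    have "(ell2_nth x i - of_rat (q i))\<^sup>2 \<le> c\<^sup>2"
      using q[of i] c by (intro abs_le_square_iff[THEN iffD1]) simp
    then show "(ell2_nth x i - of_rat (q i))\<^sup>2 \<le> d / (n + 1)" using d by (simp add: c_def)
  qed
  also have "(\<Sum>i<n. d / (n + 1)) \<le> d" using d by (simp add: field_simps)
  finally have "(norm (x - Abs_ell2 f))\<^sup>2 < e\<^sup>2" using n by (simp add: d_def)
  then have "norm (x - Abs_ell2 f) < e" using assms by (simp add: power_less_imp_less_base)
  then show ?thesis unfolding f_def dist_norm by blast
qed

instance ell2 :: second_countable_topology
proof
  define p where "p qs = Abs_ell2 (\<lambda>i. if i < length qs then of_rat (qs ! i) else 0)" for qs :: "rat list"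
  define B where "B = (\<lambda>(qs, n :: nat). ball (p qs) (inverse (Suc n))) ` UNIV"
  have "topological_basis B"
  proof (rule topological_basisI)
    show "open b" if "b \<in> B" for b using that by (auto simp: B_def)
    fix U :: "ell2 set" and x assume "open U" "x \<in> U"
    then obtain e where e: "0 < e" "ball x e \<subseteq> U" by (meson open_contains_ball)
    obtain n where n: "inverse (of_nat (Suc n)) < e / 2"
      using reals_Archimedean[of "e/2"] e by auto
    obtain qs where qs: "dist x (p qs) < inverse (of_nat (Suc n))"
      using ell2_dense_rat_lists[of "inverse (of_nat (Suc n))" x] by (auto simp: p_def)
    have "ball (p qs) (inverse (Suc n)) \<subseteq> ball x e"
    proof
      fix y assume "y \<in> ball (p qs) (inverse (Suc n))"
      then have "dist (p qs) y < e / 2" using n by simp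
      moreover have "dist x (p qs) < e / 2" using qs n by simp
      ultimately show "y \<in> ball x e" using dist_triangle[of x y "p qs"] by simp
    qed
    moreover have "x \<in> ball (p qs) (inverse (Suc n))" using qs by (simp add: dist_commute)
    ultimately show "\<exists>b\<in>B. x \<in> b \<and> b \<subseteq> U" using e by (auto simp: B_def)
  qed
  moreover have "countable B" unfolding B_def by (intro countable_image) simp
  ultimately show "\<exists>B :: ell2 set set. countable B \<and> open = generate_topology B"
    using topological_basis_imp_subbasis by blast
qed

definition orthonormal_frame :: "nat \<Rightarrow> (nat \<Rightarrow> 'a::real_inner) \<Rightarrow> bool" where
  "orthonormal_frame d e \<longleftrightarrow> (\<forall>i<d. \<forall>j<d. inner (e i) (e j) = (if i = j then 1 else 0))"

text \<open>
  An orthonormal frame \<open>e 0, \<dots>, e (d - 1)\<close> identifies its span with \<open>\<real>\<^sup>d\<close>. The Lebesgue measure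
  of \<open>\<real>\<^sup>d\<close> is the \<open>d\<close>-fold product of the Lebesgue measure on the line, which lives on the
  extensional functions on \<open>{..<d}\<close>; so \<open>frame_volume d e A\<close> is \<open>Vol\<^sub>d (A \<inter> span (e ` {..<d}))\<close>.
\<close>

definition frame_volume :: "nat \<Rightarrow> (nat \<Rightarrow> 'a::real_inner) \<Rightarrow> 'a set \<Rightarrow> real" where
  "frame_volume d e A =
     measure (Pi\<^sub>M {..<d} (\<lambda>_. lborel))
       {x \<in> space (Pi\<^sub>M {..<d} (\<lambda>_. lborel)). (\<Sum>i<d. x i *\<^sub>R e i) \<in> A}"

definition frame_parallel_body :: "nat \<Rightarrow> (nat \<Rightarrow> 'a::real_inner) \<Rightarrow> 'a set \<Rightarrow> real \<Rightarrow> 'a set" where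
  "frame_parallel_body d e K r = {x + r *\<^sub>R b | x b. x \<in> K \<and> b \<in> span (e ` {..<d}) \<and> norm b \<le> 1}"

text \<open>
  \<open>V\<close> is the sequence of intrinsic volumes of \<open>K\<close>, computed in the \<open>d\<close>-dimensional ambient space
  spanned by the frame \<open>e\<close>. For \<open>dim K < k \<le> d\<close> the equation \<open>V k = 0\<close> is forced by the Steiner
  formula itself.
\<close>

definition steiner_formula ::
    "nat \<Rightarrow> (nat \<Rightarrow> 'a::real_inner) \<Rightarrow> 'a set \<Rightarrow> (nat \<Rightarrow> real) \<Rightarrow> bool" where
  "steiner_formula d e K V \<longleftrightarrow>
     (\<forall>r\<ge>0. frame_volume d e (frame_parallel_body d e K r) =
        (\<Sum>k\<le>d. unit_ball_vol (real (d - k)) * V k * r ^ (d - k))) \<and>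
     (\<forall>k>d. V k = 0)"

text \<open>
  For finite-dimensional nonempty compact convex \<open>K\<close>. The sequence depends neither on the ambient
  space nor on the frame, so the definite description denotes.
\<close>

definition fin_intrinsic_volume :: "nat \<Rightarrow> 'a::real_inner set \<Rightarrow> real" where
  "fin_intrinsic_volume k K =
     (THE V. \<exists>d e. orthonormal_frame d e \<and> K \<subseteq> span (e ` {..<d}) \<and> steiner_formula d e K V) k"

definition fin_dim_convex_body :: "'a::real_inner set \<Rightarrow> bool" where
  "fin_dim_convex_body K \<longleftrightarrow>
     K \<noteq> {} \<and> compact K \<and> convex K \<and> (\<exists>B. finite B \<and> K \<subseteq> span B)"

definition intrinsic_volume :: "nat \<Rightarrow> 'a::real_inner set \<Rightarrow> ereal" where
  "intrinsic_volume k K =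
     (SUP K' \<in> {K'. fin_dim_convex_body K' \<and> K' \<subseteq> K}. ereal (fin_intrinsic_volume k K'))"

definition GB_set :: "'a::real_inner set \<Rightarrow> bool" where
  "GB_set K \<longleftrightarrow> K \<noteq> {} \<and> compact K \<and> convex K \<and> intrinsic_volume 1 K < \<infinity>"

definition steiner_function :: "'a::real_inner set \<Rightarrow> complex \<Rightarrow> complex" where
  "steiner_function K z = (\<Sum>k. of_real (real_of_ereal (intrinsic_volume k K)) * z ^ k)"

definition max_modulus :: "(complex \<Rightarrow> complex) \<Rightarrow> real \<Rightarrow> real" where
  "max_modulus f r = (SUP z \<in> sphere 0 r. norm (f z))"

text \<open>
  The infimum ranges over all real \<open>\<mu>\<close>, so a constant function has order \<open>- \<infinity>\<close>.
\<close>

definition entire_order :: "(complex \<Rightarrow> complex) \<Rightarrow> ereal" where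
  "entire_order f =
     Inf {ereal \<mu> | \<mu>. (\<lambda>z. norm (f z)) \<in> O[at_infinity](\<lambda>z. exp (norm z powr \<mu>))}"

text \<open>Meaningful only if the order of \<open>f\<close> is a positive real number.\<close>

definition entire_type :: "(complex \<Rightarrow> complex) \<Rightarrow> ereal" where
  "entire_type f =
     Inf {ereal A | A. A > 0 \<and>
       (\<forall>\<^sub>F r in at_top. max_modulus f r < exp (A * r powr real_of_ereal (entire_order f)))}"

end

theory Submission
  imports Defs "HOL-Probability.Distributions" "HOL-Real_Asymp.Real_Asymp"
begin

text \<open>
  For a convex body \<open>K\<close> in a \<open>d\<close>-dimensional space \<open>E\<close>, adding a segment to a body increases its volume
  by the length of the segment times the volume of a projection. Hence \<open>Vol (K + t Z)\<close> is, for every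
  zonotope \<open>Z\<close>, a polynomial in \<open>t\<close> of degree at most \<open>d\<close> with nonnegative coefficients. The ball is a
  limit of zonotopes, which yields the Steiner formula with nonnegative intrinsic volumes.

  Integrating the Steiner formula against a Gaussian shows that the Wills functional
  \<open>W K = \<integral> exp (- \<pi> dist (x, K)\<^sup>2)\<close> satisfies \<open>W (r K) = \<Sum> V\<^sub>k K r\<^sup>k\<close>. It does not change when \<open>E\<close> is
  enlarged, so the intrinsic volumes do not depend on the ambient space. By the Prekopa-Leindler
  inequality \<open>r \<mapsto> log (W (r K))\<close> is concave; its slope at \<open>0\<close> is \<open>V\<^sub>1 K\<close>, so \<open>W (r K) \<le> exp (r V\<^sub>1 K)\<close>.
  This bounds the order by \<open>1\<close> and the type by \<open>V\<^sub>1\<close>.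

  A box with summable side lengths \<open>a\<^sub>i\<close> in the sequence space has the Steiner function
  \<open>\<Prod> (1 + a\<^sub>i z)\<close> up to estimates that do not affect the order, and the order of this product is
  prescribed by the decay of \<open>a\<^sub>i\<close>.
\<close>

subsection \<open>Lebesgue measure in an orthonormal frame\<close>

text \<open>The volumes of an infinite-dimensional \<open>K\<close> are suprema taken separately for
  each \<open>k\<close>, and the bodies that approach them may vary with \<open>k\<close>. An
  identity between polynomials does not survive this, so everything is reduced to bounds on single
  terms \<open>V k * r ^ k\<close>, uniform over the finite-dimensional bodies inside
  \<open>K\<close>. The series is recovered from such bounds at a slightly larger radius; letting
  the radii approach each other keeps the type sharp.

  The ambient space may be infinite-dimensional. Volumes live on spans of frames, and the definite
  description behind \<open>fin_intrinsic_volume\<close> forces a comparison of frames of different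
  dimensions. The weight exp (- pi t^2) has integral 1 on the line, which is why orthogonal
  directions added to a frame leave the Wills functional alone.

  In place of monotonicity of intrinsic volumes stands a perturbation estimate: a body close to
  \<open>K\<close> has a Wills functional at most that of \<open>c K\<close> with c < 1, up to an
  explicit factor. It yields the bound 1 for \<open>V 0\<close> and the bound for all bodies inside
  a box.\<close>

definition frame_map :: "nat \<Rightarrow> (nat \<Rightarrow> 'a::real_inner) \<Rightarrow> (nat \<Rightarrow> real) \<Rightarrow> 'a" where
  "frame_map d e x = (\<Sum>i<d. x i *\<^sub>R e i)"

text \<open>A push-forward to the whole space, carried by the span. Frames of different dimensions
  then give measures on one sigma-algebra, and bodies and integrands need not be rewritten in
  coordinates.\<close>

definition frame_measure ::
    "nat \<Rightarrow> (nat \<Rightarrow> 'a::{real_inner, second_countable_topology}) \<Rightarrow> 'a measure" where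
  "frame_measure d e = distr (Pi\<^sub>M {..<d} (\<lambda>_. lborel)) borel (frame_map d e)"

lemma measurable_frame_map [measurable]:
  fixes e :: "nat \<Rightarrow> 'a::{real_inner, second_countable_topology}"
  shows "frame_map d e \<in> borel_measurable (Pi\<^sub>M {..<d} (\<lambda>_. lborel))"
  unfolding frame_map_def by measurable

lemma sets_frame_measure [simp, measurable_cong]: "sets (frame_measure d e) = sets borel"
  by (simp add: frame_measure_def)

lemma space_frame_measure [simp]: "space (frame_measure d e) = UNIV"
  by (simp add: frame_measure_def)

lemma nn_integral_frame:
  assumes [measurable]: "f \<in> borel_measurable borel"
  shows "(\<integral>\<^sup>+x. f x \<partial>frame_measure d e) = (\<integral>\<^sup>+x. f (frame_map d e x) \<partial>Pi\<^sub>M {..<d} (\<lambda>_. lborel))"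
  unfolding frame_measure_def by (subst nn_integral_distr) auto

lemma frame_map_in_span: "frame_map d e x \<in> span (e ` {..<d})"
  unfolding frame_map_def by (intro span_sum span_scale span_base) auto

text \<open>The measure is carried by the span, so facts that hold only there, such as orthogonality
  to the next frame vector, may be used under the integral.\<close>

lemma nn_integral_frame_cong:
  assumes [measurable]: "f \<in> borel_measurable borel" "g \<in> borel_measurable borel"
    and "\<And>x. x \<in> span (e ` {..<d}) \<Longrightarrow> f x = g x"
  shows "(\<integral>\<^sup>+x. f x \<partial>frame_measure d e) = (\<integral>\<^sup>+x. g x \<partial>frame_measure d e)"
  by (simp add: nn_integral_frame assms(3) frame_map_in_span)

lemma nn_integral_frame_0:
  assumes [measurable]: "f \<in> borel_measurable borel"
  shows "(\<integral>\<^sup>+x. f x \<partial>frame_measure 0 e) = f 0"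
  by (simp add: nn_integral_frame frame_map_def PiM_empty nn_integral_count_space_finite)

text \<open>Fubini in the last coordinate. Inductions on the dimension of an integral peel off this
  inner integral.\<close>

lemma nn_integral_frame_Suc:
  assumes [measurable]: "f \<in> borel_measurable borel"
  shows "(\<integral>\<^sup>+x. f x \<partial>frame_measure (Suc d) e) =
    (\<integral>\<^sup>+x. (\<integral>\<^sup>+t. f (x + t *\<^sub>R e d) \<partial>lborel) \<partial>frame_measure d e)"
proof -
  interpret product_sigma_finite "\<lambda>_::nat. lborel :: real measure" by standard
  have *: "frame_map (Suc d) e (x(d := t)) = frame_map d e x + t *\<^sub>R e d" for x t
    by (simp add: frame_map_def lessThan_Suc)
  have "(\<integral>\<^sup>+x. f x \<partial>frame_measure (Suc d) e) =
      (\<integral>\<^sup>+x. f (frame_map (Suc d) e x) \<partial>Pi\<^sub>M (insert d {..<d}) (\<lambda>_. lborel))"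
    by (simp add: nn_integral_frame lessThan_Suc)
  also have "\<dots> = (\<integral>\<^sup>+x. (\<integral>\<^sup>+t. f (frame_map (Suc d) e (x(d := t))) \<partial>lborel) \<partial>Pi\<^sub>M {..<d} (\<lambda>_. lborel))"
    by (rule product_nn_integral_insert) (auto simp: lessThan_Suc[symmetric])
  also have "\<dots> = (\<integral>\<^sup>+x. (\<integral>\<^sup>+t. f (x + t *\<^sub>R e d) \<partial>lborel) \<partial>frame_measure d e)"
    unfolding * by (subst nn_integral_frame) auto
  finally show ?thesis .
qed

lemma emeasure_frame_Suc:
  assumes [measurable]: "A \<in> sets borel"
  shows "emeasure (frame_measure (Suc d) e) A =
    (\<integral>\<^sup>+x. emeasure lborel {t. x + t *\<^sub>R e d \<in> A} \<partial>frame_measure d e)"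
proof -
  have "emeasure (frame_measure (Suc d) e) A = (\<integral>\<^sup>+x. indicator A x \<partial>frame_measure (Suc d) e)"
    by simp
  also have "\<dots> = (\<integral>\<^sup>+x. (\<integral>\<^sup>+t. indicator A (x + t *\<^sub>R e d) \<partial>lborel) \<partial>frame_measure d e)"
    by (rule nn_integral_frame_Suc) simp
  also have "\<dots> = (\<integral>\<^sup>+x. emeasure lborel {t. x + t *\<^sub>R e d \<in> A} \<partial>frame_measure d e)"
  proof (rule nn_integral_cong)
    fix x
    have "(\<integral>\<^sup>+t. indicator A (x + t *\<^sub>R e d) \<partial>lborel) =
        (\<integral>\<^sup>+t. indicator {t. x + t *\<^sub>R e d \<in> A} t \<partial>lborel)"
      by (rule nn_integral_cong) (auto simp: indicator_def)
    also have "\<dots> = emeasure lborel {t. x + t *\<^sub>R e d \<in> A}"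
      by (rule nn_integral_indicator) measurable
    finally show "(\<integral>\<^sup>+t. indicator A (x + t *\<^sub>R e d) \<partial>lborel) = emeasure lborel {t. x + t *\<^sub>R e d \<in> A}" .
  qed
  finally show ?thesis .
qed

lemma frame_volume_eq_measure:
  assumes "A \<in> sets borel"
  shows "frame_volume d e A = measure (frame_measure d e) A"
  unfolding frame_volume_def frame_measure_def frame_map_def[symmetric]
  by (subst measure_distr) (auto simp: assms intro!: arg_cong[where f = "measure _"])

section \<open>Invariance of the frame measure and Fubini\<close>

lemma nn_integral_frame_translate_map:
  assumes "f \<in> borel_measurable borel"
  shows "(\<integral>\<^sup>+x. f (x + frame_map d e c) \<partial>frame_measure d e) = (\<integral>\<^sup>+x. f x \<partial>frame_measure d e)"
  using assms
proof (induction d arbitrary: f)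
  case 0
  then show ?case by (simp add: frame_map_def)
next
  case (Suc d)
  note [measurable] = Suc.prems
  let ?g = "\<lambda>x. \<integral>\<^sup>+t. f (x + t *\<^sub>R e d) \<partial>lborel"
  have "(\<integral>\<^sup>+x. f (x + frame_map (Suc d) e c) \<partial>frame_measure (Suc d) e) =
      (\<integral>\<^sup>+x. (\<integral>\<^sup>+t. f ((x + frame_map d e c) + (c d + 1 * t) *\<^sub>R e d) \<partial>lborel) \<partial>frame_measure d e)"
    by (subst nn_integral_frame_Suc) (auto simp: frame_map_def lessThan_Suc algebra_simps)
  also have "\<dots> = (\<integral>\<^sup>+x. ?g (x + frame_map d e c) \<partial>frame_measure d e)"
    by (subst nn_integral_real_affine[where c = 1 and t = "c d"]) auto
  also have "\<dots> = (\<integral>\<^sup>+x. ?g x \<partial>frame_measure d e)"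
    by (rule Suc.IH) simp
  also have "\<dots> = (\<integral>\<^sup>+x. f x \<partial>frame_measure (Suc d) e)"
    by (rule nn_integral_frame_Suc[symmetric]) simp
  finally show ?case .
qed

lemma orthonormal_frame_Suc: "orthonormal_frame (Suc d) e \<Longrightarrow> orthonormal_frame d e"
  by (simp add: orthonormal_frame_def)

lemma span_frame_expansion:
  assumes "orthonormal_frame d e" "v \<in> span (e ` {..<d})"
  shows "v = frame_map d e (\<lambda>i. inner v (e i))"
  using assms(2)
proof (induction rule: span_induct_alt)
  case base
  then show ?case by (simp add: frame_map_def)
next
  case (step c x y)
  then obtain j where j: "j < d" "x = e j" by auto
  have "frame_map d e (\<lambda>i. inner x (e i)) = (\<Sum>i<d. if i = j then e i else 0)"
    unfolding frame_map_def using assms(1) j by (intro sum.cong) (auto simp: orthonormal_frame_def)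
  also have "\<dots> = x" using j by simp
  finally have "c *\<^sub>R x + y = c *\<^sub>R frame_map d e (\<lambda>i. inner x (e i)) + frame_map d e (\<lambda>i. inner y (e i))"
    using step.IH by simp
  also have "\<dots> = frame_map d e (\<lambda>i. inner (c *\<^sub>R x + y) (e i))"
    by (simp add: frame_map_def inner_add_left scaleR_add_left sum.distrib scaleR_sum_right)
  finally show ?case .
qed

lemma in_span_frame_iff:
  assumes "orthonormal_frame d e"
  shows "v \<in> span (e ` {..<d}) \<longleftrightarrow> v = frame_map d e (\<lambda>i. inner v (e i))"
  using span_frame_expansion[OF assms] frame_map_in_span by metis

lemma nn_integral_frame_translate:
  assumes "orthonormal_frame d e" "v \<in> span (e ` {..<d})" "f \<in> borel_measurable borel"
  shows "(\<integral>\<^sup>+x. f (x + v) \<partial>frame_measure d e) = (\<integral>\<^sup>+x. f x \<partial>frame_measure d e)"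
  using nn_integral_frame_translate_map[OF assms(3)] span_frame_expansion[OF assms(1,2)] by metis

lemma nn_integral_frame_scale:
  assumes "f \<in> borel_measurable borel" "c \<noteq> 0"
  shows "ennreal (\<bar>c\<bar> ^ d) * (\<integral>\<^sup>+x. f (c *\<^sub>R x) \<partial>frame_measure d e) = (\<integral>\<^sup>+x. f x \<partial>frame_measure d e)"
  using assms(1)
proof (induction d arbitrary: f)
  case 0
  then show ?case by (simp add: nn_integral_frame_0)
next
  case (Suc d)
  note [measurable] = Suc.prems
  let ?g = "\<lambda>x. \<integral>\<^sup>+t. f (x + t *\<^sub>R e d) \<partial>lborel"
  have "ennreal \<bar>c\<bar> * (\<integral>\<^sup>+x. f (c *\<^sub>R x) \<partial>frame_measure (Suc d) e) =
      ennreal \<bar>c\<bar> * (\<integral>\<^sup>+x. (\<integral>\<^sup>+t. f (c *\<^sub>R x + (0 + c * t) *\<^sub>R e d) \<partial>lborel) \<partial>frame_measure d e)"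
    by (subst nn_integral_frame_Suc) (auto simp: scaleR_add_right)
  also have "\<dots> = (\<integral>\<^sup>+x. ennreal \<bar>c\<bar> * (\<integral>\<^sup>+t. f (c *\<^sub>R x + (0 + c * t) *\<^sub>R e d) \<partial>lborel) \<partial>frame_measure d e)"
    by (subst nn_integral_cmult) auto
  also have "\<dots> = (\<integral>\<^sup>+x. ?g (c *\<^sub>R x) \<partial>frame_measure d e)"
  proof (rule nn_integral_cong)
    fix x
    show "ennreal \<bar>c\<bar> * (\<integral>\<^sup>+t. f (c *\<^sub>R x + (0 + c * t) *\<^sub>R e d) \<partial>lborel) = ?g (c *\<^sub>R x)"
      by (rule nn_integral_real_affine[OF _ assms(2), where t = 0, symmetric]) simp
  qed
  finally have "ennreal (\<bar>c\<bar> ^ d) * (ennreal \<bar>c\<bar> * (\<integral>\<^sup>+x. f (c *\<^sub>R x) \<partial>frame_measure (Suc d) e)) =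
      (\<integral>\<^sup>+x. ?g x \<partial>frame_measure d e)"
    using Suc.IH[of ?g] by simp
  also have "\<dots> = (\<integral>\<^sup>+x. f x \<partial>frame_measure (Suc d) e)"
    by (rule nn_integral_frame_Suc[symmetric]) simp
  finally show ?case by (simp add: ennreal_mult mult_ac)
qed

lemma nn_integral_frame_uminus:
  assumes "f \<in> borel_measurable borel"
  shows "(\<integral>\<^sup>+x. f (- x) \<partial>frame_measure d e) = (\<integral>\<^sup>+x. f x \<partial>frame_measure d e)"
  using nn_integral_frame_scale[OF assms, of "-1" d e] by simp

text \<open>The push-forward along a degenerate frame can fail to be sigma-finite, so the order of
  integration is exchanged on the coordinate spaces.\<close>

lemma nn_integral_frame_swap:
  assumes [measurable]: "case_prod f \<in> borel_measurable (borel \<Otimes>\<^sub>M borel)"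
  shows "(\<integral>\<^sup>+x. (\<integral>\<^sup>+y. f x y \<partial>frame_measure d' e') \<partial>frame_measure d e) =
    (\<integral>\<^sup>+y. (\<integral>\<^sup>+x. f x y \<partial>frame_measure d e) \<partial>frame_measure d' e')"
proof -
  interpret P: product_sigma_finite "\<lambda>_::nat. lborel :: real measure" by standard
  interpret A: sigma_finite_measure "Pi\<^sub>M {..<d} (\<lambda>_. lborel :: real measure)"
    by (rule P.sigma_finite) simp
  interpret B: sigma_finite_measure "Pi\<^sub>M {..<d'} (\<lambda>_. lborel :: real measure)"
    by (rule P.sigma_finite) simp
  interpret AB: pair_sigma_finite "Pi\<^sub>M {..<d'} (\<lambda>_. lborel :: real measure)"
    "Pi\<^sub>M {..<d} (\<lambda>_. lborel :: real measure)" ..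
  have "(\<integral>\<^sup>+x. (\<integral>\<^sup>+y. f x y \<partial>frame_measure d' e') \<partial>frame_measure d e) =
      (\<integral>\<^sup>+x. (\<integral>\<^sup>+y. f x (frame_map d' e' y) \<partial>Pi\<^sub>M {..<d'} (\<lambda>_. lborel)) \<partial>frame_measure d e)"
    by (simp add: nn_integral_frame)
  also have "\<dots> = (\<integral>\<^sup>+x. (\<integral>\<^sup>+y. f (frame_map d e x) (frame_map d' e' y)
      \<partial>Pi\<^sub>M {..<d'} (\<lambda>_. lborel)) \<partial>Pi\<^sub>M {..<d} (\<lambda>_. lborel))"
    by (subst nn_integral_frame) (auto intro!: B.borel_measurable_nn_integral)
  also have "\<dots> = (\<integral>\<^sup>+y. (\<integral>\<^sup>+x. f (frame_map d e x) (frame_map d' e' y)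
      \<partial>Pi\<^sub>M {..<d} (\<lambda>_. lborel)) \<partial>Pi\<^sub>M {..<d'} (\<lambda>_. lborel))"
    by (rule AB.Fubini') measurable
  also have "\<dots> = (\<integral>\<^sup>+y. (\<integral>\<^sup>+x. f (frame_map d e x) y \<partial>Pi\<^sub>M {..<d} (\<lambda>_. lborel)) \<partial>frame_measure d' e')"
    by (subst nn_integral_frame) (auto intro!: A.borel_measurable_nn_integral)
  also have "\<dots> = (\<integral>\<^sup>+y. (\<integral>\<^sup>+x. f x y \<partial>frame_measure d e) \<partial>frame_measure d' e')"
    by (simp add: nn_integral_frame)
  finally show ?thesis .
qed

lemma borel_measurable_nn_integral_frame [measurable (raw)]:
  assumes [measurable]: "case_prod f \<in> borel_measurable (M \<Otimes>\<^sub>M borel)"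
  shows "(\<lambda>x. \<integral>\<^sup>+y. f x y \<partial>frame_measure d e) \<in> borel_measurable M"
proof -
  interpret P: product_sigma_finite "\<lambda>_::nat. lborel :: real measure" by standard
  interpret A: sigma_finite_measure "Pi\<^sub>M {..<d} (\<lambda>_. lborel :: real measure)"
    by (rule P.sigma_finite) simp
  have "(\<lambda>x. \<integral>\<^sup>+y. f x (frame_map d e y) \<partial>Pi\<^sub>M {..<d} (\<lambda>_. lborel)) \<in> borel_measurable M"
    by (rule A.borel_measurable_nn_integral) measurable
  then show ?thesis
    by (rule measurable_cong[THEN iffD1, rotated]) (auto intro!: nn_integral_frame[symmetric])
qed

lemma nn_integral_gaussian: "(\<integral>\<^sup>+t. ennreal (exp (- pi * t\<^sup>2)) \<partial>lborel) = 1"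
proof -
  \<comment> \<open>The standard deviation 1 / sqrt (2 pi) is the one for which the normal density
    has leading factor 1 and exponent - pi t^2.\<close>
  have "(\<integral>\<^sup>+t. ennreal (normal_density 0 (1 / sqrt (2 * pi)) t) \<partial>lborel) = 1"
    using prob_space.emeasure_space_1[OF prob_space_normal_density[of "1 / sqrt (2 * pi)" 0]]
    by (simp add: emeasure_density)
  moreover have "normal_density 0 (1 / sqrt (2 * pi)) t = exp (- pi * t\<^sup>2)" for t
    by (simp add: normal_density_def power_divide)
  ultimately show ?thesis by simp
qed

lemma frame_orthogonal_next:
  assumes "orthonormal_frame (Suc d) e" "x \<in> span (e ` {..<d})"
  shows "inner x (e d) = 0"
  using assms(2)
proof (induction rule: span_induct_alt)
  case (step c x y)
  then show ?case using assms(1) by (auto simp: orthonormal_frame_def inner_add_left)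
qed simp

lemma norm_add_frame_next:
  assumes "orthonormal_frame (Suc d) e" "x \<in> span (e ` {..<d})"
  shows "(norm (x + t *\<^sub>R e d))\<^sup>2 = (norm x)\<^sup>2 + t\<^sup>2"
proof -
  have "inner (e d) (e d) = 1" using assms(1) by (simp add: orthonormal_frame_def)
  then show ?thesis
    unfolding power2_norm_eq_inner using frame_orthogonal_next[OF assms]
    by (simp add: inner_add_left inner_add_right inner_commute power2_eq_square)
qed

lemma nn_integral_frame_gaussian:
  assumes "orthonormal_frame d e"
  shows "(\<integral>\<^sup>+x. ennreal (exp (- pi * (norm x)\<^sup>2)) \<partial>frame_measure d e) = 1"
  using assms
proof (induction d)
  case 0
  then show ?case by (simp add: nn_integral_frame_0)
next
  case (Suc d)
  have "(\<integral>\<^sup>+x. ennreal (exp (- pi * (norm x)\<^sup>2)) \<partial>frame_measure (Suc d) e) =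
      (\<integral>\<^sup>+x. (\<integral>\<^sup>+t. ennreal (exp (- pi * (norm (x + t *\<^sub>R e d))\<^sup>2)) \<partial>lborel) \<partial>frame_measure d e)"
    by (rule nn_integral_frame_Suc) simp
  also have "\<dots> = (\<integral>\<^sup>+x. (\<integral>\<^sup>+t. ennreal (exp (- pi * (norm x)\<^sup>2)) * ennreal (exp (- pi * t\<^sup>2)) \<partial>lborel)
      \<partial>frame_measure d e)"
    by (rule nn_integral_frame_cong)
      (auto simp: norm_add_frame_next[OF Suc.prems] ennreal_mult'[symmetric] exp_add[symmetric] algebra_simps)
  also have "\<dots> = (\<integral>\<^sup>+x. ennreal (exp (- pi * (norm x)\<^sup>2)) \<partial>frame_measure d e)"
    using nn_integral_gaussian by (simp add: nn_integral_cmult)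
  also have "\<dots> = 1" using Suc orthonormal_frame_Suc by blast
  finally show ?case .
qed

text \<open>
  Uniqueness of Haar measure: for a Gaussian \<open>G\<close> the double integral of \<open>F x * G (x + y)\<close> evaluates
  to \<open>\<integral> F\<close> in one frame or in the other, depending on the order of integration.
\<close>

lemma nn_integral_frame_change:
  fixes e e' :: "nat \<Rightarrow> 'a::{real_inner, second_countable_topology}"
  assumes e: "orthonormal_frame d e" and e': "orthonormal_frame d' e'"
    and span: "span (e ` {..<d}) = span (e' ` {..<d'})"
    and [measurable]: "F \<in> borel_measurable borel"
  shows "(\<integral>\<^sup>+x. F x \<partial>frame_measure d e) = (\<integral>\<^sup>+x. F x \<partial>frame_measure d' e')"
proof -
  define G where "G x = ennreal (exp (- pi * (norm x)\<^sup>2))" for x :: 'a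
  have [measurable]: "G \<in> borel_measurable borel" unfolding G_def by simp
  have G: "(\<integral>\<^sup>+x. G x \<partial>frame_measure d e) = 1" "(\<integral>\<^sup>+x. G x \<partial>frame_measure d' e') = 1"
    unfolding G_def using nn_integral_frame_gaussian e e' by blast+
  have meas: "(\<lambda>x. \<integral>\<^sup>+y. F (x - y) \<partial>frame_measure d' e') \<in> borel_measurable borel"
    "(\<lambda>y. \<integral>\<^sup>+x. F x * G (x + y) \<partial>frame_measure d e) \<in> borel_measurable borel"
    "(\<lambda>y. \<integral>\<^sup>+x. F (x - y) * G x \<partial>frame_measure d e) \<in> borel_measurable borel"
    "(\<lambda>x. F x * (\<integral>\<^sup>+y. G (x + y) \<partial>frame_measure d' e')) \<in> borel_measurable borel"
    "(\<lambda>x. G x * (\<integral>\<^sup>+y. F (x - y) \<partial>frame_measure d' e')) \<in> borel_measurable borel"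
    by measurable
  have "(\<integral>\<^sup>+x. F x \<partial>frame_measure d e) = (\<integral>\<^sup>+x. F x * (\<integral>\<^sup>+y. G (x + y) \<partial>frame_measure d' e') \<partial>frame_measure d e)"
  proof (rule nn_integral_frame_cong)
    fix x assume "x \<in> span (e ` {..<d})"
    then have "(\<integral>\<^sup>+y. G (y + x) \<partial>frame_measure d' e') = 1"
      using nn_integral_frame_translate[OF e', of x G] span G by simp
    then show "F x = F x * (\<integral>\<^sup>+y. G (x + y) \<partial>frame_measure d' e')" by (simp add: add.commute)
  qed (use meas in auto)
  also have "\<dots> = (\<integral>\<^sup>+x. (\<integral>\<^sup>+y. F x * G (x + y) \<partial>frame_measure d' e') \<partial>frame_measure d e)"
    by (simp add: nn_integral_cmult)
  also have "\<dots> = (\<integral>\<^sup>+y. (\<integral>\<^sup>+x. F x * G (x + y) \<partial>frame_measure d e) \<partial>frame_measure d' e')"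
    by (rule nn_integral_frame_swap) measurable
  also have "\<dots> = (\<integral>\<^sup>+y. (\<integral>\<^sup>+x. F (x - y) * G x \<partial>frame_measure d e) \<partial>frame_measure d' e')"
  proof (rule nn_integral_frame_cong)
    fix y assume "y \<in> span (e' ` {..<d'})"
    then have "- y \<in> span (e ` {..<d})" by (simp add: span span_neg)
    from nn_integral_frame_translate[OF e this, of "\<lambda>x. F x * G (x + y)"]
    show "(\<integral>\<^sup>+x. F x * G (x + y) \<partial>frame_measure d e) = (\<integral>\<^sup>+x. F (x - y) * G x \<partial>frame_measure d e)"
      by simp
  qed (use meas in auto)
  also have "\<dots> = (\<integral>\<^sup>+x. (\<integral>\<^sup>+y. F (x - y) * G x \<partial>frame_measure d' e') \<partial>frame_measure d e)"
    by (rule nn_integral_frame_swap[symmetric]) measurable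
  also have "\<dots> = (\<integral>\<^sup>+x. G x * (\<integral>\<^sup>+y. F (x - y) \<partial>frame_measure d' e') \<partial>frame_measure d e)"
    by (simp add: nn_integral_cmult mult.commute)
  \<comment> \<open>The inner integral does not depend on \<open>x\<close>: translation by
    \<open>- x\<close> and reflection at the origin both preserve the measure.\<close>
  also have "\<dots> = (\<integral>\<^sup>+x. G x * (\<integral>\<^sup>+y. F y \<partial>frame_measure d' e') \<partial>frame_measure d e)"
  proof (rule nn_integral_frame_cong)
    fix x assume "x \<in> span (e ` {..<d})"
    then have "- x \<in> span (e' ` {..<d'})" by (simp add: span span_neg)
    from nn_integral_frame_translate[OF e' this, of "\<lambda>y. F (- y)"]
    have "(\<integral>\<^sup>+y. F (x - y) \<partial>frame_measure d' e') = (\<integral>\<^sup>+y. F (- y) \<partial>frame_measure d' e')" by simp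
    then show "G x * (\<integral>\<^sup>+y. F (x - y) \<partial>frame_measure d' e') = G x * (\<integral>\<^sup>+y. F y \<partial>frame_measure d' e')"
      by (simp add: nn_integral_frame_uminus)
  qed (use meas in auto)
  also have "\<dots> = (\<integral>\<^sup>+y. F y \<partial>frame_measure d' e')"
    by (simp add: nn_integral_multc G)
  finally show ?thesis .
qed

subsection \<open>Orthonormal frames\<close>

text \<open>One Gram-Schmidt step. If \<open>v\<close> already lies in the span, the frame is kept,
  so the dimension may stay the same.\<close>

lemma extend_frame_one:
  fixes e :: "nat \<Rightarrow> 'a::real_inner"
  assumes e: "orthonormal_frame d e"
  obtains d' e' where "d \<le> d'" "d' \<le> Suc d" "orthonormal_frame d' e'" "\<And>i. i < d \<Longrightarrow> e' i = e i"
    "span (e' ` {..<d'}) = span (insert v (e ` {..<d}))"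
proof (cases "v \<in> span (e ` {..<d})")
  case True
  then show ?thesis using that[of d e] e by (auto simp: span_redundant)
next
  case False
  define p where "p = frame_map d e (\<lambda>i. inner v (e i))"
  have p: "p \<in> span (e ` {..<d})" unfolding p_def by (rule frame_map_in_span)
  have "v \<noteq> p" using False p by auto
  define u where "u = (v - p) /\<^sub>R norm (v - p)"
  have "inner p (e j) = inner v (e j)" if "j < d" for j
  proof -
    have "inner p (e j) = (\<Sum>i<d. if i = j then inner v (e j) else 0)"
      unfolding p_def frame_map_def inner_sum_left
      using e that by (intro sum.cong) (auto simp: orthonormal_frame_def)
    then show ?thesis using that by simp
  qed
  then have ue: "inner u (e j) = 0" if "j < d" for j
    using that by (simp add: u_def inner_diff_left)
  have uu: "inner u u = 1"
    using \<open>v \<noteq> p\<close> by (simp add: u_def power2_norm_eq_inner[symmetric] power2_eq_square)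
  define e' where "e' = e(d := u)"
  have o: "orthonormal_frame (Suc d) e'"
    using e ue uu by (auto simp: orthonormal_frame_def e'_def less_Suc_eq inner_commute)
  have im: "e' ` {..<Suc d} = insert u (e ` {..<d})"
    by (auto simp: e'_def lessThan_Suc)
  have "v = norm (v - p) *\<^sub>R u + p" using \<open>v \<noteq> p\<close> by (simp add: u_def)
  moreover have "norm (v - p) *\<^sub>R u + p \<in> span (insert u (e ` {..<d}))"
    using span_mono[THEN subsetD, OF _ p, of "insert u (e ` {..<d})"]
    by (intro span_add span_scale) (auto intro: span_base)
  ultimately have "v \<in> span (insert u (e ` {..<d}))" by simp
  moreover have "u \<in> span (insert v (e ` {..<d}))"
    unfolding u_def
    using span_mono[THEN subsetD, OF _ p, of "insert v (e ` {..<d})"]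
    by (intro span_scale span_diff) (auto intro: span_base)
  ultimately have "span (insert u (e ` {..<d})) = span (insert v (e ` {..<d}))"
    by (intro span_eq[THEN iffD2] conjI subsetI) (auto intro: span_base)
  then show ?thesis using that[of "Suc d" e'] o im by (auto simp: e'_def)
qed

text \<open>The bound on \<open>d'\<close> matters in the estimate for boxes, where the dimension is
  the exponent of a number below 1 in a denominator.\<close>

lemma extend_frame:
  fixes e :: "nat \<Rightarrow> 'a::real_inner"
  assumes "finite B" "orthonormal_frame d e"
  obtains d' e' where "d \<le> d'" "d' \<le> d + card B" "orthonormal_frame d' e'"
    "\<And>i. i < d \<Longrightarrow> e' i = e i" "span (e' ` {..<d'}) = span (B \<union> e ` {..<d})"
  using assms(1) that
proof (induction B arbitrary: thesis rule: finite_induct)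
  case empty
  show ?case by (rule empty(1)[of d e]) (use assms in auto)
next
  case (insert v B)
  obtain d' e' where 1: "d \<le> d'" "d' \<le> d + card B" "orthonormal_frame d' e'"
    "\<And>i. i < d \<Longrightarrow> e' i = e i" "span (e' ` {..<d'}) = span (B \<union> e ` {..<d})"
    using insert.IH by blast
  obtain d'' e'' where 2: "d' \<le> d''" "d'' \<le> Suc d'" "orthonormal_frame d'' e''"
    "\<And>i. i < d' \<Longrightarrow> e'' i = e' i" "span (e'' ` {..<d''}) = span (insert v (e' ` {..<d'}))"
    using extend_frame_one[OF 1(3), of v] by blast
  have "span (insert v (e' ` {..<d'})) = span (insert v B \<union> e ` {..<d})"
    unfolding span_insert 1(5) Un_insert_left ..
  then show ?case
    using 1 2 insert.hyps by (intro insert.prems[of d'' e'']) auto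
qed

lemma extend_frame_span_mono:
  fixes e e' :: "nat \<Rightarrow> 'a::real_vector"
  assumes "d \<le> d'" "\<And>i. i < d \<Longrightarrow> e' i = e i"
  shows "span (e ` {..<d}) \<subseteq> span (e' ` {..<d'})"
proof (rule span_mono)
  show "e ` {..<d} \<subseteq> e' ` {..<d'}"
  proof
    fix x assume "x \<in> e ` {..<d}"
    then obtain i where i: "i < d" "x = e i" by auto
    then show "x \<in> e' ` {..<d'}" using assms(1) assms(2)[OF i(1)] by (intro image_eqI[of _ e' i]) auto
  qed
qed

text \<open>The reflection in the hyperplane orthogonal to \<open>w\<close>. For
  \<open>w = 0\<close> the quotient is 0 and the map is the identity, which is what exchanging two
  equal vectors calls for.\<close>

definition householder :: "'a::real_inner \<Rightarrow> 'a \<Rightarrow> 'a" where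
  "householder w x = x - (2 * inner x w / inner w w) *\<^sub>R w"

lemma linear_householder: "linear (householder w)"
  by (rule linearI) (auto simp: householder_def inner_add_left algebra_simps add_divide_distrib)

lemma inner_householder: "inner (householder w x) y = inner x (householder w y)"
  by (simp add: householder_def inner_diff_left inner_diff_right inner_commute)

lemma householder_householder [simp]: "householder w (householder w x) = x"
  by (cases "w = 0") (simp_all add: householder_def inner_diff_left)

lemma norm_householder [simp]: "norm (householder w x) = norm x"
  by (simp add: norm_eq_sqrt_inner inner_householder)

text \<open>The hyperplane orthogonal to \<open>a - b\<close> bisects two vectors of equal length.
  Carrying one unit vector to another is all the rotational symmetry that the proof uses, and one
  reflection does it.\<close>

lemma householder_maps:
  assumes "norm a = norm b"
  shows "householder (a - b) a = b"
proof (cases "a = b")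
  case False
  have "inner a a = inner b b" using assms by (simp add: norm_eq_sqrt_inner)
  then have "inner (a - b) (a - b) = 2 * inner a (a - b)"
    by (simp add: inner_diff_left inner_diff_right inner_commute)
  moreover have "inner (a - b) (a - b) \<noteq> 0" using False by simp
  ultimately show ?thesis by (simp add: householder_def)
qed (simp add: householder_def)

lemma householder_frame:
  assumes e: "orthonormal_frame d e" and w: "w \<in> span (e ` {..<d})"
  shows "orthonormal_frame d (\<lambda>i. householder w (e i))"
    and "span ((\<lambda>i. householder w (e i)) ` {..<d}) = span (e ` {..<d})"
proof -
  show "orthonormal_frame d (\<lambda>i. householder w (e i))"
    using e by (simp add: orthonormal_frame_def inner_householder)
  have "householder w x \<in> span (e ` {..<d})" if "x \<in> span (e ` {..<d})" for x
    unfolding householder_def using that w by (intro span_diff span_scale) auto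
  then have "householder w ` span (e ` {..<d}) = span (e ` {..<d})"
    by (auto intro!: image_eqI[of _ _ "householder w _"])
  then show "span ((\<lambda>i. householder w (e i)) ` {..<d}) = span (e ` {..<d})"
    using linear_span_image[OF linear_householder, of w "e ` {..<d}"] by (simp add: image_image)
qed

text \<open>Puts a prescribed direction into the last place, where Fubini slices along it.\<close>

lemma frame_with_last:
  assumes e: "orthonormal_frame (Suc d) e" and u: "u \<in> span (e ` {..<Suc d})" "norm u = 1"
  obtains f where "orthonormal_frame (Suc d) f" "span (f ` {..<Suc d}) = span (e ` {..<Suc d})" "f d = u"
proof -
  have "norm (e d) = 1" using e by (simp add: orthonormal_frame_def norm_eq_sqrt_inner)
  then have "householder (e d - u) (e d) = u" using u by (intro householder_maps) simp
  moreover have "e d - u \<in> span (e ` {..<Suc d})" using u by (intro span_diff) (auto intro: span_base)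
  ultimately show ?thesis using that[of "\<lambda>i. householder (e d - u) (e i)"] householder_frame[OF e] by blast
qed

section \<open>Compactness and finite volume inside a frame\<close>

lemma norm_frame_map:
  assumes "orthonormal_frame d e"
  shows "(norm (frame_map d e x))\<^sup>2 = (\<Sum>i<d. (x i)\<^sup>2)"
  using assms
proof (induction d)
  case (Suc d)
  have "frame_map (Suc d) e x = frame_map d e x + x d *\<^sub>R e d"
    by (simp add: frame_map_def)
  then show ?case
    using Suc norm_add_frame_next[OF Suc.prems frame_map_in_span] orthonormal_frame_Suc by fastforce
qed (simp add: frame_map_def)

lemma closed_span_frame:
  assumes "orthonormal_frame d e"
  shows "closed (span (e ` {..<d}))"
proof -
  have "span (e ` {..<d}) = {v. v = frame_map d e (\<lambda>i. inner v (e i))}"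
    using in_span_frame_iff[OF assms] by auto
  also have "closed \<dots>"
    unfolding frame_map_def by (intro closed_Collect_eq continuous_intros)
  finally show ?thesis .
qed

definition frame_ball :: "nat \<Rightarrow> (nat \<Rightarrow> 'a::real_inner) \<Rightarrow> real \<Rightarrow> 'a set" where
  "frame_ball d e r = cball 0 r \<inter> span (e ` {..<d})"

lemma mem_frame_ball: "x \<in> frame_ball d e r \<longleftrightarrow> norm x \<le> r \<and> x \<in> span (e ` {..<d})"
  by (auto simp: frame_ball_def)

text \<open>Closed bounded sets need not be compact in the ambient space. By induction the ball is a
  closed subset of a continuous image of a lower-dimensional ball times an interval.\<close>

lemma compact_frame_ball:
  assumes "orthonormal_frame d e"
  shows "compact (frame_ball d e r)"
  using assms
proof (induction d)
  case 0
  have "frame_ball 0 e r \<subseteq> {0}" by (auto simp: frame_ball_def)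
  then show ?case by (rule finite_imp_compact[OF finite_subset]) simp
next
  case (Suc d)
  note o = orthonormal_frame_Suc[OF Suc.prems]
  have comp: "compact ((\<lambda>(x, t). x + t *\<^sub>R e d) ` (frame_ball d e r \<times> {- r..r}))"
    using Suc.IH[OF o]
    by (intro compact_continuous_image compact_Times) (auto intro!: continuous_intros simp: case_prod_unfold)
  have "frame_ball (Suc d) e r \<subseteq> (\<lambda>(x, t). x + t *\<^sub>R e d) ` (frame_ball d e r \<times> {- r..r})"
  proof
    fix v assume v: "v \<in> frame_ball (Suc d) e r"
    define x where "x = frame_map d e (\<lambda>i. inner v (e i))"
    define t where "t = inner v (e d)"
    have x: "x \<in> span (e ` {..<d})" unfolding x_def by (rule frame_map_in_span)
    have vx: "v = x + t *\<^sub>R e d"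
      using span_frame_expansion[OF Suc.prems, of v] v
      by (simp add: frame_map_def x_def t_def mem_frame_ball)
    have nv: "(norm x)\<^sup>2 + t\<^sup>2 = (norm v)\<^sup>2"
      using norm_add_frame_next[OF Suc.prems x, of t] vx by simp
    have "(norm v)\<^sup>2 \<le> r\<^sup>2" "0 \<le> r"
      using v order.trans[OF norm_ge_zero[of v]] by (auto simp: mem_frame_ball intro!: power_mono)
    then have "(norm x)\<^sup>2 \<le> r\<^sup>2" "t\<^sup>2 \<le> r\<^sup>2"
      using nv zero_le_power2[of t] zero_le_power2[of "norm x"] by linarith+
    then have "norm x \<le> r" "\<bar>t\<bar> \<le> r"
      using \<open>0 \<le> r\<close> by (auto simp: power2_le_iff_abs_le)
    then show "v \<in> (\<lambda>(x, t). x + t *\<^sub>R e d) ` (frame_ball d e r \<times> {- r..r})"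
      using x vx by (auto simp: mem_frame_ball intro!: image_eqI[of _ _ "(x, t)"])
  qed
  then have "frame_ball (Suc d) e r = ((\<lambda>(x, t). x + t *\<^sub>R e d) ` (frame_ball d e r \<times> {- r..r})) \<inter> frame_ball (Suc d) e r"
    by blast
  also have "compact \<dots>"
    unfolding frame_ball_def[of "Suc d"]
    by (intro compact_Int_closed comp closed_Int closed_cball closed_span_frame Suc.prems)
  finally show ?case .
qed

text \<open>On a ball of radius \<open>R\<close> the indicator is at most exp (pi R^2) times the
  Gaussian, whose integral is 1.\<close>

lemma emeasure_frame_finite:
  assumes "orthonormal_frame d e" "bounded A"
  shows "emeasure (frame_measure d e) A < \<infinity>"
proof (cases "A \<in> sets borel")
  case False
  then show ?thesis by (simp add: emeasure_notin_sets)
next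
  case True
  obtain R where R: "\<And>x. x \<in> A \<Longrightarrow> norm x \<le> R" using assms(2) by (auto simp: bounded_iff)
  have "emeasure (frame_measure d e) A = (\<integral>\<^sup>+x. indicator A x \<partial>frame_measure d e)"
    using True by simp
  also have "\<dots> \<le> (\<integral>\<^sup>+x. ennreal (exp (pi * R\<^sup>2)) * ennreal (exp (- pi * (norm x)\<^sup>2)) \<partial>frame_measure d e)"
  proof (rule nn_integral_mono)
    fix x
    have "1 \<le> exp (pi * R\<^sup>2) * exp (- pi * (norm x)\<^sup>2)" if "x \<in> A"
    proof -
      have "(norm x)\<^sup>2 \<le> R\<^sup>2" using R[OF that] by (intro power_mono) auto
      then show ?thesis by (simp add: exp_add[symmetric])
    qed
    then show "indicator A x \<le> ennreal (exp (pi * R\<^sup>2)) * ennreal (exp (- pi * (norm x)\<^sup>2))"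
      by (auto simp: indicator_def ennreal_mult'[symmetric] ennreal_1[symmetric] simp del: ennreal_1 intro!: ennreal_leI)
  qed
  also have "\<dots> = ennreal (exp (pi * R\<^sup>2))"
    using nn_integral_frame_gaussian[OF assms(1)] by (simp add: nn_integral_cmult)
  finally show ?thesis using le_less_trans by fastforce
qed

lemma emeasure_frame_change:
  assumes "orthonormal_frame d e" "orthonormal_frame d' e'" "span (e ` {..<d}) = span (e' ` {..<d'})"
    and "A \<in> sets borel"
  shows "emeasure (frame_measure d e) A = emeasure (frame_measure d' e') A"
  using nn_integral_frame_change[OF assms(1-3), of "indicator A"] assms(4) by simp

subsection \<open>Volume of a sum with a zonotope\<close>

lemma compact_set_plus:
  fixes A B :: "'a::real_normed_vector set"
  assumes "compact A" "compact B"
  shows "compact (A + B)"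
proof -
  have "A + B = {x + y | x y. x \<in> A \<and> y \<in> B}" by (auto simp: set_plus_def)
  then show ?thesis using compact_sums[OF assms] by simp
qed

text \<open>Cavalieri's principle along \<open>e m\<close>. By convexity each fibre of
  \<open>L\<close> is empty or a compact interval. The segment lengthens every nonempty fibre by
  \<open>s\<close>, and the nonempty fibres are those over the projection of
  \<open>L\<close>.\<close>

lemma emeasure_frame_plus_segment:
  fixes e :: "nat \<Rightarrow> 'a::{real_inner, second_countable_topology}"
  assumes e: "orthonormal_frame (Suc m) e" and L: "compact L" "convex L" and s: "0 \<le> s"
    and sub: "L \<subseteq> span (e ` {..<Suc m})"
  shows "emeasure (frame_measure (Suc m) e) (L + closed_segment 0 (s *\<^sub>R e m)) =
    emeasure (frame_measure (Suc m) e) L +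
    ennreal s * emeasure (frame_measure m e) ((\<lambda>x. x - inner x (e m) *\<^sub>R e m) ` L)"
proof -
  define P where "P x = x - inner x (e m) *\<^sub>R e m" for x
  have uu: "inner (e m) (e m) = 1" using e by (simp add: orthonormal_frame_def)
  have compP: "compact (P ` L)"
    unfolding P_def by (intro compact_continuous_image L continuous_intros)
  have meas: "L \<in> sets borel" "P ` L \<in> sets borel" "L + closed_segment 0 (s *\<^sub>R e m) \<in> sets borel"
    using L compP by (auto intro!: borel_compact compact_set_plus)
  let ?S = "\<lambda>x. {t. x + t *\<^sub>R e m \<in> L}"
  have sec: "emeasure lborel {t. x + t *\<^sub>R e m \<in> L + closed_segment 0 (s *\<^sub>R e m)} =
      emeasure lborel (?S x) + ennreal s * indicator (P ` L) x" if x: "x \<in> span (e ` {..<m})" for x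
  proof -
    note xu = frame_orthogonal_next[OF e x]
    have iff: "?S x \<noteq> {} \<longleftrightarrow> x \<in> P ` L"
    proof
      assume "?S x \<noteq> {}"
      then obtain t where "x + t *\<^sub>R e m \<in> L" by auto
      moreover have "P (x + t *\<^sub>R e m) = x" by (simp add: P_def inner_add_left xu uu)
      ultimately show "x \<in> P ` L" by force
    next
      assume "x \<in> P ` L"
      then obtain y where "y \<in> L" "x = P y" by auto
      then have "inner y (e m) \<in> ?S x" by (simp add: P_def)
      then show "?S x \<noteq> {}" by blast
    qed
    have eq: "{t. x + t *\<^sub>R e m \<in> L + closed_segment 0 (s *\<^sub>R e m)} = {t + r | t r. t \<in> ?S x \<and> 0 \<le> r \<and> r \<le> s}"
    proof (intro set_eqI iffI)
      fix t assume "t \<in> {t. x + t *\<^sub>R e m \<in> L + closed_segment 0 (s *\<^sub>R e m)}"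
      then obtain y q where "y \<in> L" "0 \<le> q" "q \<le> 1" "x + t *\<^sub>R e m = y + q *\<^sub>R (s *\<^sub>R e m)"
        by (auto simp: set_plus_def closed_segment_def)
      then have "x + (t - q * s) *\<^sub>R e m \<in> L" by (simp add: algebra_simps)
      moreover have "0 \<le> q * s" "q * s \<le> s"
        using \<open>0 \<le> q\<close> \<open>q \<le> 1\<close> s by (auto intro: mult_left_le_one_le)
      ultimately show "t \<in> {t + r | t r. t \<in> ?S x \<and> 0 \<le> r \<and> r \<le> s}"
        by (intro CollectI exI[of _ "t - q * s"] exI[of _ "q * s"]) auto
    next
      fix t assume "t \<in> {t + r | t r. t \<in> ?S x \<and> 0 \<le> r \<and> r \<le> s}"
      then obtain t' r where tr: "t = t' + r" "x + t' *\<^sub>R e m \<in> L" "0 \<le> r" "r \<le> s" by auto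
      have "r *\<^sub>R e m \<in> closed_segment 0 (s *\<^sub>R e m)"
        using tr s by (cases "s = 0") (auto simp: closed_segment_def intro!: exI[of _ "r / s"])
      then have "(x + t' *\<^sub>R e m) + r *\<^sub>R e m \<in> L + closed_segment 0 (s *\<^sub>R e m)"
        using tr by (intro set_plus_intro)
      then show "t \<in> {t. x + t *\<^sub>R e m \<in> L + closed_segment 0 (s *\<^sub>R e m)}"
        using tr by (simp add: algebra_simps)
    qed
    have clo: "closed (?S x)"
      using closed_vimage[OF compact_imp_closed[OF L(1)], of "\<lambda>t. x + t *\<^sub>R e m"]
      by (simp add: vimage_def continuous_intros)
    obtain R where R: "\<And>y. y \<in> L \<Longrightarrow> norm y \<le> R"
      using compact_imp_bounded[OF L(1)] by (auto simp: bounded_iff)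
    have "\<bar>t\<bar> \<le> R" if "t \<in> ?S x" for t
    proof -
      have "t = inner (x + t *\<^sub>R e m) (e m)" by (simp add: inner_add_left xu uu)
      then have "\<bar>t\<bar> \<le> norm (x + t *\<^sub>R e m) * norm (e m)"
        using Cauchy_Schwarz_ineq2[of "x + t *\<^sub>R e m" "e m"] by simp
      then show ?thesis using R[of "x + t *\<^sub>R e m"] that uu by (simp add: norm_eq_sqrt_inner)
    qed
    then have "bounded (?S x)" by (auto simp: bounded_iff)
    then have "compact (?S x)" using clo by (simp add: compact_eq_bounded_closed)
    moreover have "convex (?S x)"
    proof (rule convexI)
      fix t t' a b :: real assume h: "t \<in> ?S x" "t' \<in> ?S x" "0 \<le> a" "0 \<le> b" "a + b = 1"
      have "a *\<^sub>R (x + t *\<^sub>R e m) + b *\<^sub>R (x + t' *\<^sub>R e m) \<in> L"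
        using h L(2) by (intro convexD) auto
      moreover have "a *\<^sub>R (x + t *\<^sub>R e m) + b *\<^sub>R (x + t' *\<^sub>R e m) = (a + b) *\<^sub>R x + (a * t + b * t') *\<^sub>R e m"
        by (simp add: algebra_simps)
      ultimately show "a *\<^sub>R t + b *\<^sub>R t' \<in> ?S x" using h by simp
    qed
    ultimately obtain \<alpha> \<beta> where ab: "?S x = {\<alpha>..\<beta>}"
      using connected_compact_interval_1 convex_connected by metis
    show ?thesis
    proof (cases "?S x = {}")
      case True
      then show ?thesis using iff unfolding eq by auto
    next
      case False
      then have le: "\<alpha> \<le> \<beta>" using ab by auto
      have "{t + r | t r. t \<in> ?S x \<and> 0 \<le> r \<and> r \<le> s} = {\<alpha>..\<beta> + s}"
      proof (intro set_eqI iffI)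
        \<comment> \<open>A point of the longer interval is split at \<open>\<beta>\<close>:
          \<open>min t \<beta>\<close> lies in the fibre, the excess in the segment.\<close>
        fix t assume "t \<in> {\<alpha>..\<beta> + s}"
        then show "t \<in> {t + r | t r. t \<in> ?S x \<and> 0 \<le> r \<and> r \<le> s}"
          using le s unfolding ab
          by (intro CollectI exI[of _ "min t \<beta>"] exI[of _ "t - min t \<beta>"]) auto
      qed (auto simp: ab)
      then show ?thesis
        using iff False le s unfolding eq ab by (simp add: ennreal_plus[symmetric] del: ennreal_plus)
    qed
  qed
  have meas_sec: "(\<lambda>x. emeasure lborel {t. x + t *\<^sub>R e m \<in> A}) \<in> borel_measurable borel"
    if [measurable]: "A \<in> sets borel" for A
  proof -
    have "{t. x + t *\<^sub>R e m \<in> A} = Pair x -` {p. fst p + snd p *\<^sub>R e m \<in> A}" for x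
      by auto
    moreover have "{p \<in> space (borel \<Otimes>\<^sub>M lborel). fst p + snd p *\<^sub>R e m \<in> A} \<in> sets (borel \<Otimes>\<^sub>M lborel)"
      by measurable
    ultimately show ?thesis
      using lborel.measurable_emeasure_Pair[of _ "borel :: 'a measure"] by (simp add: space_pair_measure)
  qed
  have "emeasure (frame_measure (Suc m) e) (L + closed_segment 0 (s *\<^sub>R e m)) =
      (\<integral>\<^sup>+x. emeasure lborel {t. x + t *\<^sub>R e m \<in> L + closed_segment 0 (s *\<^sub>R e m)} \<partial>frame_measure m e)"
    using meas by (intro emeasure_frame_Suc)
  also have "\<dots> = (\<integral>\<^sup>+x. emeasure lborel (?S x) + ennreal s * indicator (P ` L) x \<partial>frame_measure m e)"
    using sec by (intro nn_integral_frame_cong borel_measurable_add borel_measurable_times meas_sec meas) (use meas in auto)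
  also have "\<dots> = (\<integral>\<^sup>+x. emeasure lborel (?S x) \<partial>frame_measure m e) + ennreal s * emeasure (frame_measure m e) (P ` L)"
    using meas meas_sec by (subst nn_integral_add) (auto simp: nn_integral_cmult)
  also have "(\<integral>\<^sup>+x. emeasure lborel (?S x) \<partial>frame_measure m e) = emeasure (frame_measure (Suc m) e) L"
    using meas by (intro emeasure_frame_Suc[symmetric])
  finally show ?thesis unfolding P_def .
qed

text \<open>The Minkowski sum of segments that start at the origin. Generators are not symmetrized;
  a centred segment arises by listing both \<open>v\<close> and \<open>- v\<close>.\<close>

definition zonotope :: "'a::real_vector list \<Rightarrow> 'a set" where
  "zonotope vs = sum_list (map (closed_segment 0) vs)"

lemma zonotope_Nil [simp]: "zonotope [] = {0}"
  by (simp add: zonotope_def)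

lemma zonotope_Cons [simp]: "zonotope (v # vs) = closed_segment 0 v + zonotope vs"
  by (simp add: zonotope_def)

lemma compact_zonotope: "compact (zonotope (vs :: 'a::real_normed_vector list))"
  by (induction vs) (auto intro: compact_set_plus)

lemma convex_zonotope: "convex (zonotope vs)"
  by (induction vs) (auto intro: convex_set_plus)

lemma set_plus_subset_subspace:
  assumes "subspace S" "A \<subseteq> S" "B \<subseteq> S"
  shows "A + B \<subseteq> S"
  using assms by (auto simp: set_plus_def intro: subspace_add)

lemma zonotope_subset_subspace:
  assumes "subspace S" "set vs \<subseteq> S"
  shows "zonotope vs \<subseteq> S"
  using assms(2)
proof (induction vs)
  case Nil
  then show ?case using subspace_0[OF assms(1)] by simp
next
  case (Cons v vs)
  have "closed_segment 0 v \<subseteq> S"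
    using assms(1) Cons.prems by (auto simp: closed_segment_def subspace_scale)
  moreover have "zonotope vs \<subseteq> S" using Cons by simp
  ultimately show ?case using set_plus_subset_subspace[OF assms(1)] by simp
qed

lemma linear_image_set_plus: "linear f \<Longrightarrow> f ` (A + B) = f ` A + f ` B"
  by (force simp: set_plus_def linear_add)

lemma linear_image_zonotope:
  assumes "linear f"
  shows "f ` zonotope vs = zonotope (map f vs)"
proof (induction vs)
  case (Cons v vs)
  have "f ` closed_segment 0 v = closed_segment 0 (f v)"
    using closed_segment_linear_image[OF assms, of 0 v] linear_0[OF assms] by simp
  then show ?case using Cons by (simp add: linear_image_set_plus[OF assms])
qed (use linear_0[OF assms] in simp)

text \<open>Removing a generator \<open>v\<close> splits the volume, by the segment formula, into
  the volume of the remaining sum and \<open>t * norm v\<close> times the volume of its projection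
  along \<open>v\<close>. Both are polynomials by induction, the second in one dimension less. The
  induction is on the length of the list because the second use has projected generators and a
  smaller frame.\<close>

lemma volume_plus_zonotope_polynomial:
  assumes "orthonormal_frame d e" "compact L" "convex L" "L \<subseteq> span (e ` {..<d})"
    and "set vs \<subseteq> span (e ` {..<d})"
  shows "\<exists>c. (\<forall>k. 0 \<le> c k) \<and> (\<forall>t\<ge>0. emeasure (frame_measure d e) (L + zonotope (map ((*\<^sub>R) t) vs)) =
    ennreal (\<Sum>k\<le>d. c k * t ^ k))"
  using assms
proof (induction vs arbitrary: d e L rule: measure_induct_rule[where f = length])
  case (less ws)
  note IH = less.IH and prems = less.prems
  show ?case
  proof (cases ws)
    case Nil
    have "emeasure (frame_measure d e) L \<noteq> \<infinity>"
      using emeasure_frame_finite[OF prems(1) compact_imp_bounded[OF prems(2)]] by simp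
    then have fin: "emeasure (frame_measure d e) L = ennreal (measure (frame_measure d e) L)"
      by (simp add: emeasure_eq_ennreal_measure)
    have "(\<Sum>k\<le>d. (if k = 0 then a else 0) * t ^ k) = a" for a t :: real
      by (subst sum.remove[of _ 0]) (auto intro!: sum.neutral)
    then show ?thesis
      by (intro exI[of _ "\<lambda>k. if k = 0 then measure (frame_measure d e) L else 0"]) (auto simp: Nil fin)
  next
    case (Cons v vs)
    note prems = prems[unfolded Cons]
    have "\<exists>c. (\<forall>k. 0 \<le> c k) \<and> (\<forall>t\<ge>0. emeasure (frame_measure d e)
        (L + zonotope (map ((*\<^sub>R) t) (v # vs))) = ennreal (\<Sum>k\<le>d. c k * t ^ k))"
    proof (cases "v = 0")
      case True
      then show ?thesis using IH[of vs d e L] prems Cons by auto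
    next
      case False
      have "d \<noteq> 0"
      proof
        assume "d = 0"
        then show False using prems(5) False by simp
      qed
      then obtain m where d: "d = Suc m" using not0_implies_Suc by blast
      define u where "u = v /\<^sub>R norm v"
      have u: "u \<in> span (e ` {..<Suc m})" "norm u = 1" and v: "v = norm v *\<^sub>R u"
        using False prems(5) by (auto simp: u_def d span_scale)
      obtain f where f: "orthonormal_frame (Suc m) f" "span (f ` {..<Suc m}) = span (e ` {..<Suc m})" "f m = u"
        using frame_with_last[OF prems(1)[unfolded d] u] by blast
      define P where "P x = x - inner x (f m) *\<^sub>R f m" for x
      have "linear P" unfolding P_def by (rule linearI) (auto simp: inner_add_left algebra_simps)
      have P: "P x \<in> span (f ` {..<m})" if "x \<in> span (e ` {..<d})" for x
      proof -
        have "x = frame_map m f (\<lambda>i. inner x (f i)) + inner x (f m) *\<^sub>R f m"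
          using span_frame_expansion[OF f(1), of x] that f(2) by (simp add: frame_map_def d)
        then have "P x = frame_map m f (\<lambda>i. inner x (f i))" unfolding P_def by (metis add_diff_cancel)
        then show ?thesis by (simp add: frame_map_in_span)
      qed
      obtain c1 where c1: "\<And>k. 0 \<le> c1 k" "\<And>t. 0 \<le> t \<Longrightarrow>
          emeasure (frame_measure d f) (L + zonotope (map ((*\<^sub>R) t) vs)) = ennreal (\<Sum>k\<le>d. c1 k * t ^ k)"
        using IH[of vs "Suc m" f L] f prems unfolding d Cons by auto
      have "compact (P ` L)"
        unfolding P_def by (intro compact_continuous_image prems continuous_intros)
      moreover have "convex (P ` L)" using \<open>linear P\<close> prems by (intro convex_linear_image)
      ultimately obtain c2 where c2: "\<And>k. 0 \<le> c2 k" "\<And>t. 0 \<le> t \<Longrightarrow>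
          emeasure (frame_measure m f) (P ` L + zonotope (map ((*\<^sub>R) t) (map P vs))) = ennreal (\<Sum>k\<le>m. c2 k * t ^ k)"
        using IH[of "map P vs" m f "P ` L"] orthonormal_frame_Suc[OF f(1)] P prems
        unfolding Cons by (auto simp: image_subset_iff subset_iff)
      \<comment> \<open>The factor \<open>t\<close> in front of the projected volume shifts its
        coefficients up by one, from degree \<open>m\<close> to degree \<open>d\<close>.\<close>
      define c where "c k = c1 k + norm v * (if k = 0 then 0 else c2 (k - 1))" for k
      have main: "emeasure (frame_measure d e) (L + zonotope (map ((*\<^sub>R) t) (v # vs))) = ennreal (\<Sum>k\<le>d. c k * t ^ k)"
        if t: "0 \<le> t" for t
      proof -
        let ?L = "L + zonotope (map ((*\<^sub>R) t) vs)"
        have sub: "zonotope (map ((*\<^sub>R) t) vs) \<subseteq> span (e ` {..<d})"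
          using prems by (intro zonotope_subset_subspace subspace_span) (auto simp: span_scale)
        then have subL: "?L \<subseteq> span (f ` {..<Suc m})"
          using prems f(2) by (intro set_plus_subset_subspace subspace_span) (auto simp: d)
        have comp: "compact ?L" "convex ?L"
          using prems by (auto intro: compact_set_plus convex_set_plus compact_zonotope convex_zonotope)
        have eq: "L + zonotope (map ((*\<^sub>R) t) (v # vs)) = ?L + closed_segment 0 ((t * norm v) *\<^sub>R f m)"
        proof -
          have "t *\<^sub>R v = (t * norm v) *\<^sub>R f m" using v f(3) by (metis scaleR_scaleR)
          then show ?thesis by (simp add: add_ac)
        qed
        have im: "P ` ?L = P ` L + zonotope (map ((*\<^sub>R) t) (map P vs))"
          by (simp add: linear_image_set_plus[OF \<open>linear P\<close>] linear_image_zonotope[OF \<open>linear P\<close>] o_def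
              linear_cmul[OF \<open>linear P\<close>])
        have "emeasure (frame_measure d e) (L + zonotope (map ((*\<^sub>R) t) (v # vs))) =
            emeasure (frame_measure (Suc m) f) (?L + closed_segment 0 ((t * norm v) *\<^sub>R f m))"
          unfolding eq using f comp prems
          by (intro emeasure_frame_change) (auto simp: d intro!: borel_compact compact_set_plus)
        also have "\<dots> = emeasure (frame_measure d f) ?L + ennreal (t * norm v) * emeasure (frame_measure m f) (P ` ?L)"
          unfolding P_def d using comp subL t by (intro emeasure_frame_plus_segment[OF f(1)]) auto
        also have "\<dots> = ennreal (\<Sum>k\<le>d. c1 k * t ^ k) + ennreal (t * norm v) * ennreal (\<Sum>k\<le>m. c2 k * t ^ k)"
          using c1 c2 t im by simp
        also have "\<dots> = ennreal ((\<Sum>k\<le>d. c1 k * t ^ k) + t * norm v * (\<Sum>k\<le>m. c2 k * t ^ k))"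
          using c1(1) c2(1) t by (simp add: ennreal_mult ennreal_plus sum_nonneg)
        also have "(\<Sum>k\<le>d. c1 k * t ^ k) + t * norm v * (\<Sum>k\<le>m. c2 k * t ^ k) = (\<Sum>k\<le>d. c k * t ^ k)"
        proof -
          have "(\<Sum>k\<le>d. norm v * (if k = 0 then 0 else c2 (k - 1)) * t ^ k) = t * norm v * (\<Sum>k\<le>m. c2 k * t ^ k)"
            unfolding d by (subst sum.atMost_Suc_shift) (simp add: sum_distrib_left mult_ac)
          then show ?thesis by (simp add: c_def distrib_right sum.distrib)
        qed
        finally show ?thesis .
      qed
      have "0 \<le> c k" for k using c1(1) c2(1) by (simp add: c_def)
      with main show ?thesis by blast
    qed
    then show ?thesis by (simp only: Cons)
  qed
qed

subsection \<open>Zonotopes approximate the ball\<close>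

text \<open>Reflecting the points amounts to reflecting the frame, and the reflected frame spans the
  same space.\<close>

lemma nn_integral_householder:
  assumes e: "orthonormal_frame d e" and w: "w \<in> span (e ` {..<d})"
    and [measurable]: "F \<in> borel_measurable borel"
  shows "(\<integral>\<^sup>+x. F (householder w x) \<partial>frame_measure d e) = (\<integral>\<^sup>+x. F x \<partial>frame_measure d e)"
proof -
  have [measurable]: "householder w \<in> borel_measurable borel"
    unfolding householder_def by measurable
  have "frame_map d (\<lambda>i. householder w (e i)) x = householder w (frame_map d e x)" for x
    unfolding frame_map_def
    by (simp add: linear_sum[OF linear_householder] linear_cmul[OF linear_householder])
  then have "(\<integral>\<^sup>+x. F (householder w x) \<partial>frame_measure d e) =
      (\<integral>\<^sup>+x. F x \<partial>frame_measure d (\<lambda>i. householder w (e i)))"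
    by (simp add: nn_integral_frame)
  also have "\<dots> = (\<integral>\<^sup>+x. F x \<partial>frame_measure d e)"
    by (rule nn_integral_frame_change) (use householder_frame[OF e w] e in auto)
  finally show ?thesis .
qed

lemma emeasure_frame_eq_span_Int:
  assumes "orthonormal_frame d e" and [measurable]: "A \<in> sets borel"
  shows "emeasure (frame_measure d e) A = emeasure (frame_measure d e) (A \<inter> span (e ` {..<d}))"
proof -
  have [measurable]: "span (e ` {..<d}) \<in> sets borel"
    using closed_span_frame[OF assms(1)] by simp
  have "(\<integral>\<^sup>+x. indicator A x \<partial>frame_measure d e) =
      (\<integral>\<^sup>+x. indicator (A \<inter> span (e ` {..<d})) x \<partial>frame_measure d e)"
    by (rule nn_integral_frame_cong) (auto simp: indicator_def)
  then show ?thesis by simp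
qed

lemma emeasure_frame_ball:
  assumes e: "orthonormal_frame d e" and r: "0 < r"
  shows "emeasure (frame_measure d e) (frame_ball d e r) = ennreal (unit_ball_vol (real d) * r ^ d)"
proof -
  have "emeasure (frame_measure d e) (frame_ball d e r) = emeasure (frame_measure d e) (cball 0 r)"
    using emeasure_frame_eq_span_Int[OF e, of "cball 0 r"] by (simp add: frame_ball_def)
  also have "\<dots> = emeasure (Pi\<^sub>M {..<d} (\<lambda>_. lborel))
      (frame_map d e -` cball 0 r \<inter> space (Pi\<^sub>M {..<d} (\<lambda>_. lborel)))"
    unfolding frame_measure_def by (rule emeasure_distr) auto
  also have "frame_map d e -` cball 0 r = {f. sqrt (\<Sum>i<d. (f i)\<^sup>2) \<le> r}"
  proof -
    have "norm (frame_map d e x) = sqrt (\<Sum>i<d. (x i)\<^sup>2)" for x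
      by (rule real_sqrt_unique[symmetric]) (simp_all add: norm_frame_map[OF e])
    then show ?thesis by auto
  qed
  also have "emeasure (Pi\<^sub>M {..<d} (\<lambda>_. lborel))
      ({f. sqrt (\<Sum>i<d. (f i)\<^sup>2) \<le> r} \<inter> space (Pi\<^sub>M {..<d} (\<lambda>_. lborel))) =
      ennreal (unit_ball_vol (real d) * r ^ d)"
    using emeasure_cball_aux[of "{..<d}" r] r by simp
  finally show ?thesis .
qed

text \<open>The integral is homogeneous in \<open>u\<close> and invariant under reflections, hence a
  multiple of the norm. It writes the support function of a ball as a superposition of support
  functions of segments, which is the source of the approximating zonotopes.\<close>

lemma mean_width_ball:
  fixes e :: "nat \<Rightarrow> 'a::{real_inner, second_countable_topology}"
  assumes e: "orthonormal_frame (Suc m) e"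
  obtains c where "0 < c"
    "\<And>u. u \<in> span (e ` {..<Suc m}) \<Longrightarrow>
      (\<integral>\<^sup>+x. indicator (cball 0 1) x * ennreal \<bar>inner u x\<bar> \<partial>frame_measure (Suc m) e) = ennreal (c * norm u)"
proof -
  let ?M = "frame_measure (Suc m) e" and ?E = "span (e ` {..<Suc m})"
  have [measurable]: "cball (0 :: 'a) 1 \<in> sets borel" by simp
  have [measurable]: "(\<lambda>x. ennreal \<bar>inner u x\<bar>) \<in> borel_measurable borel" for u :: 'a
    by (intro measurable_compose[OF _ measurable_ennreal] borel_measurable_abs borel_measurable_inner) simp_all
  define N where "N u = (\<integral>\<^sup>+x. indicator (cball 0 1) x * ennreal \<bar>inner u x\<bar> \<partial>?M)" for u
  have ne: "norm (e m) = 1" "e m \<in> ?E" using e by (auto simp: orthonormal_frame_def norm_eq_sqrt_inner intro: span_base)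
  have scale: "N (a *\<^sub>R u) = ennreal \<bar>a\<bar> * N u" for a u
    unfolding N_def by (subst nn_integral_cmult[symmetric], measurable) (auto simp: abs_mult ennreal_mult mult_ac)
  have unit: "N u = N (e m)" if u: "u \<in> ?E" "norm u = 1" for u
  proof -
    define w where "w = e m - u"
    have w: "w \<in> ?E" unfolding w_def using u ne by (intro span_diff)
    have hu: "householder w (e m) = u" unfolding w_def using u ne by (intro householder_maps) simp
    have "N (e m) = (\<integral>\<^sup>+x. indicator (cball 0 1) (householder w x) * ennreal \<bar>inner (e m) (householder w x)\<bar> \<partial>?M)"
      unfolding N_def by (rule nn_integral_householder[OF e w, symmetric]) measurable
    also have "\<dots> = N u"
      unfolding N_def by (simp add: inner_householder[symmetric] hu indicator_def)
    finally show ?thesis ..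
  qed
  have "N (e m) \<le> (\<integral>\<^sup>+x. indicator (cball 0 1) x \<partial>?M)"
    unfolding N_def
  proof (intro nn_integral_mono)
    fix x
    have "\<bar>inner (e m) x\<bar> \<le> 1" if "norm x \<le> 1"
      using Cauchy_Schwarz_ineq2[of "e m" x] that ne by simp
    then show "indicator (cball 0 1) x * ennreal \<bar>inner (e m) x\<bar> \<le> indicator (cball 0 1) x"
      by (auto simp: indicator_def)
  qed
  also have "\<dots> < \<infinity>" using emeasure_frame_finite[OF e, of "cball 0 1"] by simp
  finally have fin: "N (e m) < \<infinity>" .
  \<comment> \<open>If the constant were 0, almost every point of the ball would lie in the
    hyperplane orthogonal to \<open>e m\<close>. That hyperplane is null and the ball is
    not.\<close>
  have "N (e m) \<noteq> 0"
  proof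
    assume "N (e m) = 0"
    then have "AE x in ?M. indicator (cball 0 1) x * ennreal \<bar>inner (e m) x\<bar> = 0"
      unfolding N_def by (subst nn_integral_0_iff_AE[symmetric]) auto
    moreover have "AE x in ?M. inner (e m) x \<noteq> 0"
    proof -
      have s: "{x. inner (e m) x = 0} \<in> sets borel" by measurable
      have "{t. inner (e m) (x + t *\<^sub>R e m) = 0} = {- inner (e m) x}" for x
        using ne by (auto simp: inner_add_right power2_norm_eq_inner[symmetric])
      then have "emeasure ?M {x. inner (e m) x = 0} = 0"
        using s by (subst emeasure_frame_Suc) auto
      then show ?thesis using s by (intro AE_I[of _ _ "{x. inner (e m) x = 0}"]) auto
    qed
    ultimately have "AE x in ?M. x \<notin> cball 0 1"
      by eventually_elim (auto simp: indicator_def split: if_splits)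
    then have "emeasure ?M (cball 0 1) = 0"
      by (subst (asm) AE_iff_measurable[of "cball 0 1"]) auto
    then have "emeasure ?M (frame_ball (Suc m) e 1) = 0"
      using emeasure_frame_eq_span_Int[OF e, of "cball 0 1"] by (simp add: frame_ball_def)
    then show False using unit_ball_vol_pos[of "real (Suc m)"]
      by (simp add: emeasure_frame_ball[OF e])
  qed
  define c where "c = enn2real (N (e m))"
  have c: "0 < c" "N (e m) = ennreal c"
    using fin \<open>N (e m) \<noteq> 0\<close> unfolding c_def by (auto simp: enn2real_positive_iff zero_less_iff_neq_zero)
  have "N u = ennreal (c * norm u)" if "u \<in> ?E" for u
  proof (cases "u = 0")
    case True
    then show ?thesis by (simp add: N_def)
  next
    case False
    have "N u = N (norm u *\<^sub>R (u /\<^sub>R norm u))" using False by simp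
    also have "\<dots> = ennreal (norm u) * N (u /\<^sub>R norm u)" by (simp only: scale abs_norm_cancel)
    also have "N (u /\<^sub>R norm u) = ennreal c"
      using unit[of "u /\<^sub>R norm u"] that False c by (simp add: span_scale)
    finally show ?thesis using c by (simp add: ennreal_mult' mult.commute)
  qed
  with c(1) show ?thesis using that unfolding N_def by blast
qed

text \<open>A Riemann sum over small cells. Moving a point by less than \<open>\<delta>\<close>
  changes \<open>inner u x\<close> by at most \<open>\<delta> * norm u\<close>, so one choice of
  nodes and weights works for all directions \<open>u\<close>, as the comparison of two bodies
  demands.\<close>

lemma riemann_sum_width:
  fixes M :: "'a::{real_inner, second_countable_topology} measure"
  assumes M [measurable_cong]: "sets M = sets borel" and D: "compact D" and fin: "emeasure M D < \<infinity>" and "0 < \<delta>"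
  shows "\<exists>(n :: nat) q w. (\<forall>i<n. q i \<in> D) \<and> (\<forall>i. 0 \<le> w i) \<and>
    (\<forall>u. (\<integral>\<^sup>+x. indicator D x * ennreal \<bar>inner u x\<bar> \<partial>M) \<le>
      ennreal ((\<Sum>i<n. w i * \<bar>inner u (q i)\<bar>) + \<delta> * norm u * measure M D)) \<and>
    (\<forall>u. ennreal (\<Sum>i<n. w i * \<bar>inner u (q i)\<bar>) \<le>
      (\<integral>\<^sup>+x. indicator D x * ennreal \<bar>inner u x\<bar> \<partial>M) + ennreal (\<delta> * norm u * measure M D))"
proof -
  let ?I = "\<lambda>A u. \<integral>\<^sup>+x. indicator A x * ennreal \<bar>inner u x\<bar> \<partial>M"
  have [measurable]: "D \<in> sets borel" using D by (rule borel_compact)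
  obtain P where P: "finite P" "P \<subseteq> D" "D \<subseteq> (\<Union>p\<in>P. ball p \<delta>)"
    by (rule compactE_image[OF D, of D "\<lambda>p. ball p \<delta>"]) (use \<open>0 < \<delta>\<close> in auto)
  obtain n :: nat and q where q: "P = q ` {i. i < n}" "inj_on q {i. i < n}"
    using finite_imp_nat_seg_image_inj_on[OF P(1)] by blast
  \<comment> \<open>The cover by balls is made disjoint. Since \<open>disjointed\<close> acts on
    sequences, indices from \<open>n\<close> on get empty cells.\<close>
  define A where "A = disjointed (\<lambda>i. if i < n then ball (q i) \<delta> \<inter> D else {})"
  have disj: "disjoint_family A" unfolding A_def by (rule disjoint_family_disjointed)
  have Asub: "A i \<subseteq> ball (q i) \<delta> \<inter> D" if "i < n" for i
    using disjointed_subset[of "\<lambda>i. if i < n then ball (q i) \<delta> \<inter> D else {}" i] that by (simp add: A_def)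
  have Aempty: "A i = {}" if "\<not> i < n" for i
    using disjointed_subset[of "\<lambda>i. if i < n then ball (q i) \<delta> \<inter> D else {}" i] that by (simp add: A_def)
  have "(\<Union>i. A i) = (\<Union>i. if i < n then ball (q i) \<delta> \<inter> D else {})"
    unfolding A_def by (rule UN_disjointed_eq)
  also have "\<dots> = D" using P(3) q(1) by (auto split: if_splits)
  finally have "(\<Union>i. A i) = D" .
  then have UA: "(\<Union>i<n. A i) = D" using Aempty by fastforce
  have [measurable]: "A i \<in> sets borel" for i
  proof -
    have "range A \<subseteq> sets borel"
      unfolding A_def by (rule sets.range_disjointed_sets) auto
    then show ?thesis by blast
  qed
  define w where "w i = measure M (A i)" for i
  have finA: "emeasure M (A i) = ennreal (w i)" if "i < n" for i
  proof -
    have "emeasure M (A i) \<le> emeasure M D" using Asub[OF that] M by (intro emeasure_mono) auto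
    then have "emeasure M (A i) \<noteq> \<infinity>" using fin by (simp add: top_unique less_top)
    then show ?thesis by (simp add: w_def emeasure_eq_ennreal_measure)
  qed
  have ind: "indicator D x = (\<Sum>i<n. indicator (A i) x :: ennreal)" for x
    unfolding UA[symmetric] using disj
    by (intro indicator_UN_disjoint) (auto simp: disjoint_family_on_def)
  have sumw: "(\<Sum>i<n. w i) = measure M D"
  proof -
    have "ennreal (\<Sum>i<n. w i) = (\<Sum>i<n. emeasure M (A i))"
      by (subst sum_ennreal[symmetric]) (auto simp: finA w_def)
    also have "\<dots> = emeasure M D" unfolding UA[symmetric]
      using disj M by (intro sum_emeasure) (auto simp: disjoint_family_on_def)
    also have "\<dots> = ennreal (measure M D)" using fin by (simp add: emeasure_eq_ennreal_measure)
    finally show ?thesis by (simp add: sum_nonneg w_def)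
  qed
  have split: "?I D u =
      (\<Sum>i<n. ?I (A i) u)" for u
    unfolding ind sum_distrib_right by (rule nn_integral_sum) measurable
  have near: "\<bar>\<bar>inner u x\<bar> - \<bar>inner u (q i)\<bar>\<bar> \<le> \<delta> * norm u" if "i < n" "x \<in> A i" for i x u
  proof -
    have "\<bar>\<bar>inner u x\<bar> - \<bar>inner u (q i)\<bar>\<bar> \<le> \<bar>inner u (x - q i)\<bar>" by (simp add: inner_diff_right)
    also have "\<dots> \<le> norm u * norm (x - q i)" by (rule Cauchy_Schwarz_ineq2)
    also have "\<dots> \<le> norm u * \<delta>"
      using Asub[OF that(1)] that(2) by (intro mult_left_mono) (auto simp: dist_norm norm_minus_commute)
    finally show ?thesis by (simp add: mult.commute)
  qed
  have up: "?I (A i) u \<le> ennreal (w i * (\<bar>inner u (q i)\<bar> + \<delta> * norm u))"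
    if i: "i < n" for i u
  proof -
    have "?I (A i) u \<le>
        (\<integral>\<^sup>+x. ennreal (\<bar>inner u (q i)\<bar> + \<delta> * norm u) * indicator (A i) x \<partial>M)"
    proof (rule nn_integral_mono)
      fix x
      show "indicator (A i) x * ennreal \<bar>inner u x\<bar> \<le> ennreal (\<bar>inner u (q i)\<bar> + \<delta> * norm u) * indicator (A i) x"
        using near[OF i, of x u] by (auto simp: indicator_def simp del: ennreal_plus intro!: ennreal_leI)
    qed
    also have "\<dots> = ennreal (w i * (\<bar>inner u (q i)\<bar> + \<delta> * norm u))"
      using \<open>0 < \<delta>\<close> M by (subst nn_integral_cmult_indicator) (auto simp: finA[OF i] ennreal_mult mult.commute w_def)
    finally show ?thesis .
  qed
  have down: "ennreal (w i * \<bar>inner u (q i)\<bar>) \<le> ?I (A i) u + ennreal (w i * (\<delta> * norm u))"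
    if i: "i < n" for i u
  proof -
    have "ennreal (w i * \<bar>inner u (q i)\<bar>) = (\<integral>\<^sup>+x. ennreal \<bar>inner u (q i)\<bar> * indicator (A i) x \<partial>M)"
      using M by (subst nn_integral_cmult_indicator) (auto simp: finA[OF i] ennreal_mult mult.commute w_def)
    also have "\<dots> \<le> (\<integral>\<^sup>+x. indicator (A i) x * ennreal \<bar>inner u x\<bar> + ennreal (\<delta> * norm u) * indicator (A i) x \<partial>M)"
    proof (rule nn_integral_mono)
      fix x
      show "ennreal \<bar>inner u (q i)\<bar> * indicator (A i) x \<le>
          indicator (A i) x * ennreal \<bar>inner u x\<bar> + ennreal (\<delta> * norm u) * indicator (A i) x"
        using near[OF i, of x u] \<open>0 < \<delta>\<close>
        by (auto simp: indicator_def ennreal_plus[symmetric] simp del: ennreal_plus intro!: ennreal_leI)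
    qed
    also have "\<dots> = ?I (A i) u + ennreal (\<delta> * norm u) * emeasure M (A i)"
      using M by (subst nn_integral_add) (auto simp: nn_integral_cmult_indicator)
    finally show ?thesis using \<open>0 < \<delta>\<close> by (simp add: finA[OF i] ennreal_mult w_def mult.commute)
  qed
  show ?thesis
  proof (intro exI[of _ n] exI[of _ q] exI[of _ w] conjI allI impI)
    show "q i \<in> D" if "i < n" for i using P(2) q(1) that by auto
    show "0 \<le> w i" for i by (simp add: w_def)
    fix u
    have eq: "(\<Sum>i<n. w i * (\<bar>inner u (q i)\<bar> + \<delta> * norm u)) = (\<Sum>i<n. w i * \<bar>inner u (q i)\<bar>) + \<delta> * norm u * measure M D"
      by (simp add: distrib_left sum.distrib sumw[symmetric] sum_distrib_left mult_ac)
    have "?I D u \<le> (\<Sum>i<n. ennreal (w i * (\<bar>inner u (q i)\<bar> + \<delta> * norm u)))"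
      unfolding split using up by (intro sum_mono) auto
    also have "\<dots> = ennreal (\<Sum>i<n. w i * (\<bar>inner u (q i)\<bar> + \<delta> * norm u))"
      using \<open>0 < \<delta>\<close> by (intro sum_ennreal) (simp add: w_def)
    finally show "?I D u \<le> ennreal ((\<Sum>i<n. w i * \<bar>inner u (q i)\<bar>) + \<delta> * norm u * measure M D)"
      unfolding eq .
    have "ennreal (\<Sum>i<n. w i * \<bar>inner u (q i)\<bar>) = (\<Sum>i<n. ennreal (w i * \<bar>inner u (q i)\<bar>))"
      by (intro sum_ennreal[symmetric]) (simp add: w_def)
    also have "\<dots> \<le> (\<Sum>i<n. ?I (A i) u + ennreal (w i * (\<delta> * norm u)))"
      using down by (intro sum_mono) auto
    also have "\<dots> = ?I D u + ennreal (\<Sum>i<n. w i * (\<delta> * norm u))"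
      unfolding split sum.distrib using \<open>0 < \<delta>\<close> by (subst sum_ennreal) (auto simp: w_def)
    also have "(\<Sum>i<n. w i * (\<delta> * norm u)) = \<delta> * norm u * measure M D"
      by (simp add: sumw[symmetric] sum_distrib_left mult_ac)
    finally show "ennreal (\<Sum>i<n. w i * \<bar>inner u (q i)\<bar>) \<le> ?I D u + ennreal (\<delta> * norm u * measure M D)" .
  qed
qed

text \<open>The support function of \<open>zonotope vs\<close>: a segment from the origin to
  \<open>v\<close> contributes the larger of the values at its two endpoints.\<close>

definition zonotope_support :: "'a::real_inner list \<Rightarrow> 'a \<Rightarrow> real" where
  "zonotope_support vs u = (\<Sum>v\<leftarrow>vs. max 0 (inner u v))"

lemma inner_le_zonotope_support:
  "x \<in> zonotope vs \<Longrightarrow> inner u x \<le> zonotope_support vs u"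
proof (induction vs arbitrary: x)
  case (Cons v vs)
  then obtain t y where "0 \<le> t" "t \<le> 1" "y \<in> zonotope vs" "x = t *\<^sub>R v + y"
    by (auto simp: set_plus_def closed_segment_def)
  moreover have "t * inner u v \<le> max 0 (inner u v)"
    using \<open>0 \<le> t\<close> \<open>t \<le> 1\<close> by (cases "inner u v \<ge> 0")
      (auto simp: mult_left_le_one_le mult_nonneg_nonpos)
  ultimately show ?case using Cons.IH[of y] by (simp add: zonotope_support_def inner_add_right)
qed (simp add: zonotope_support_def)

lemma zonotope_support_attained: "\<exists>x\<in>zonotope vs. inner u x = zonotope_support vs u"
proof (induction vs)
  case (Cons v vs)
  then obtain y where y: "y \<in> zonotope vs" "inner u y = zonotope_support vs u" by auto
  define z where "z = (if inner u v \<ge> 0 then v else 0)"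
  have "z + y \<in> zonotope (v # vs)" unfolding zonotope_Cons z_def using y by (intro set_plus_intro) auto
  moreover have "inner u (z + y) = zonotope_support (v # vs) u"
    using y by (auto simp: z_def zonotope_support_def inner_add_right)
  ultimately show ?case by blast
qed (simp add: zonotope_support_def)

text \<open>The weighted nodes of a Riemann sum become generators, so the support function lies
  between 1 - \<open>\<epsilon>\<close> and 1 + \<open>\<epsilon>\<close> times the norm. Testing a
  point against itself gives the outer inclusion; the inner one compares a point with its nearest
  point in the zonotope.\<close>

lemma zonotope_approx_ball:
  fixes e :: "nat \<Rightarrow> 'a::{real_inner, second_countable_topology}"
  assumes e: "orthonormal_frame d e" and \<epsilon>: "0 < \<epsilon>"
  obtains vs where "set vs \<subseteq> span (e ` {..<d})" "frame_ball d e (1 - \<epsilon>) \<subseteq> zonotope vs"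
    "zonotope vs \<subseteq> frame_ball d e (1 + \<epsilon>)"
proof (cases d)
  case 0
  then show ?thesis using \<epsilon> that[of "[]"] by (auto simp: frame_ball_def)
next
  case (Suc m)
  let ?M = "frame_measure d e" and ?E = "span (e ` {..<d})"
  define D where "D = frame_ball d e 1"
  have D: "compact D" unfolding D_def by (rule compact_frame_ball[OF e])
  have fin: "emeasure ?M D < \<infinity>" using emeasure_frame_finite[OF e compact_imp_bounded[OF D]] .
  obtain c where c: "0 < c" "\<And>u. u \<in> ?E \<Longrightarrow>
      (\<integral>\<^sup>+x. indicator (cball 0 1) x * ennreal \<bar>inner u x\<bar> \<partial>?M) = ennreal (c * norm u)"
    using mean_width_ball e unfolding Suc by blast
  have [measurable]: "D \<in> sets borel" "cball (0 :: 'a) 1 \<in> sets borel"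
    using D by (auto intro: borel_compact)
  have [measurable]: "(\<lambda>x. ennreal \<bar>inner u x\<bar>) \<in> borel_measurable borel" for u :: 'a
    by (intro measurable_compose[OF _ measurable_ennreal] borel_measurable_abs borel_measurable_inner) simp_all
  have cD: "(\<integral>\<^sup>+x. indicator D x * ennreal \<bar>inner u x\<bar> \<partial>?M) = ennreal (c * norm u)" if "u \<in> ?E" for u
    unfolding c(2)[OF that, symmetric]
  proof (rule nn_integral_frame_cong)
    show "(\<lambda>x. indicator D x * ennreal \<bar>inner u x\<bar>) \<in> borel_measurable borel"
      "(\<lambda>x. indicator (cball 0 1) x * ennreal \<bar>inner u x\<bar>) \<in> borel_measurable borel"
      by measurable
  qed (auto simp: D_def frame_ball_def indicator_def)
  \<comment> \<open>Makes the error of the Riemann sum at most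
    \<open>\<epsilon> * c * norm u\<close>; the summand 1 keeps the denominator positive.\<close>
  define \<delta> where "\<delta> = \<epsilon> * c / (measure ?M D + 1)"
  have \<delta>: "0 < \<delta>" unfolding \<delta>_def using c(1) \<epsilon> by (intro divide_pos_pos mult_pos_pos add_nonneg_pos) auto
  have \<delta>D: "\<delta> * measure ?M D \<le> \<epsilon> * c"
    using mult_left_mono[of "measure ?M D / (measure ?M D + 1)" 1 "\<epsilon> * c"] c(1) \<epsilon>
    by (simp add: \<delta>_def add_nonneg_pos)
  obtain n :: nat and q w where qw: "\<And>i. i < n \<Longrightarrow> q i \<in> D" "\<And>i. 0 \<le> w i"
    "\<And>u. (\<integral>\<^sup>+x. indicator D x * ennreal \<bar>inner u x\<bar> \<partial>?M) \<le> ennreal ((\<Sum>i<n. w i * \<bar>inner u (q i)\<bar>) + \<delta> * norm u * measure ?M D)"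
    "\<And>u. ennreal (\<Sum>i<n. w i * \<bar>inner u (q i)\<bar>) \<le> (\<integral>\<^sup>+x. indicator D x * ennreal \<bar>inner u x\<bar> \<partial>?M) + ennreal (\<delta> * norm u * measure ?M D)"
    using riemann_sum_width[OF sets_frame_measure D fin \<delta>] by auto
  define S where "S u = (\<Sum>i<n. w i * \<bar>inner u (q i)\<bar>)" for u
  have S0: "0 \<le> S u" for u unfolding S_def using qw(2) by (intro sum_nonneg) auto
  have S: "(1 - \<epsilon>) * norm u \<le> S u / c" "S u / c \<le> (1 + \<epsilon>) * norm u" if u: "u \<in> ?E" for u
  proof -
    have \<delta>u: "\<delta> * norm u * measure ?M D \<le> \<epsilon> * c * norm u"
      using mult_right_mono[OF \<delta>D norm_ge_zero[of u]] by (simp add: mult_ac)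
    have "0 \<le> \<delta> * norm u * measure ?M D" using \<delta> by simp
    then have "c * norm u \<le> S u + \<delta> * norm u * measure ?M D" "S u \<le> c * norm u + \<delta> * norm u * measure ?M D"
      using qw(3)[of u] qw(4)[of u] c(1) S0[of u] unfolding cD[OF u] S_def[symmetric]
      by (auto simp: ennreal_plus[symmetric] simp del: ennreal_plus)
    then show "(1 - \<epsilon>) * norm u \<le> S u / c" "S u / c \<le> (1 + \<epsilon>) * norm u"
      using c(1) \<delta>u by (auto simp: field_simps)
  qed
  have "\<exists>vs. set vs \<subseteq> ?E \<and> (\<forall>u. zonotope_support vs u = (\<Sum>i<k. w i * \<bar>inner u (q i)\<bar>) / c)" if "k \<le> n" for k
    using that
  proof (induction k)
    case 0
    then show ?case by (intro exI[of _ "[]"]) (simp add: zonotope_support_def)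
  next
    case (Suc k)
    then obtain vs where vs: "set vs \<subseteq> ?E" "\<And>u. zonotope_support vs u = (\<Sum>i<k. w i * \<bar>inner u (q i)\<bar>) / c" by auto
    define v where "v = (w k / c) *\<^sub>R q k"
    have "q k \<in> ?E" using qw(1)[of k] Suc.prems by (simp add: D_def mem_frame_ball)
    then have "v \<in> ?E" by (simp add: v_def span_scale)
    \<comment> \<open>The pair \<open>v\<close>, \<open>- v\<close> turns positive parts into the
      absolute value that occurs in the Riemann sum.\<close>
    moreover have "max 0 (inner u v) + max 0 (inner u (- v)) = w k * \<bar>inner u (q k)\<bar> / c" for u
    proof -
      have "max 0 (inner u v) + max 0 (inner u (- v)) = \<bar>inner u v\<bar>" by auto
      then show ?thesis using c(1) qw(2)[of k] by (simp add: v_def abs_mult)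
    qed
    ultimately show ?case
      using vs by (intro exI[of _ "v # - v # vs"])
        (auto simp: zonotope_support_def add_divide_distrib span_neg)
  qed
  then obtain vs where vs: "set vs \<subseteq> ?E" "\<And>u. zonotope_support vs u = S u / c"
    unfolding S_def by blast
  note sub = zonotope_subset_subspace[OF subspace_span vs(1)]
  show ?thesis
  proof (rule that[OF vs(1)])
    show "zonotope vs \<subseteq> frame_ball d e (1 + \<epsilon>)"
    proof
      fix x assume x: "x \<in> zonotope vs"
      then have "norm x * norm x \<le> (1 + \<epsilon>) * norm x"
        using inner_le_zonotope_support[OF x, of x] S(2)[of x] vs(2)[of x] sub
        by (simp add: power2_norm_eq_inner[symmetric] power2_eq_square subset_iff)
      then have "norm x \<le> 1 + \<epsilon>" using \<epsilon> by (cases "x = 0") auto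
      then show "x \<in> frame_ball d e (1 + \<epsilon>)" using x sub by (auto simp: mem_frame_ball)
    qed
    show "frame_ball d e (1 - \<epsilon>) \<subseteq> zonotope vs"
    proof
      fix b assume b: "b \<in> frame_ball d e (1 - \<epsilon>)"
      have "zonotope vs \<noteq> {}" using zonotope_support_attained by blast
      then obtain z where z: "z \<in> zonotope vs" "\<forall>y\<in>zonotope vs. dist b z \<le> dist b y"
        using continuous_attains_inf[OF compact_zonotope _ continuous_on_dist[OF continuous_on_const continuous_on_id]]
        by blast
      define u where "u = b - z"
      have u: "u \<in> ?E" using b z sub by (auto simp: u_def mem_frame_ball intro!: span_diff)
      obtain x where x: "x \<in> zonotope vs" "inner u x = S u / c"
        using zonotope_support_attained[of vs u] vs(2) by auto
      \<comment> \<open>The zonotope lies behind the hyperplane through the nearest point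
        \<open>z\<close> with normal \<open>u\<close>, so its support value is at most
        \<open>inner u z\<close>. The lower bound on that value then forces
        \<open>u = 0\<close>.\<close>
      have "inner u (x - z) \<le> 0" unfolding u_def
        by (rule any_closest_point_dot[OF convex_zonotope compact_imp_closed[OF compact_zonotope] z(1) x(1) z(2)])
      then have "S u / c \<le> inner u z" using x by (simp add: inner_diff_right)
      also have "inner u z = inner u b - inner u u" by (simp add: u_def inner_diff_right)
      also have "inner u b \<le> (1 - \<epsilon>) * norm u"
        using Cauchy_Schwarz_ineq2[of u b] b mult_left_mono[of "norm b" "1 - \<epsilon>" "norm u"]
        by (simp add: mem_frame_ball mult.commute)
      finally have "inner u u \<le> 0" using S(1)[OF u] by simp
      then have "u = 0" by (metis inner_gt_zero_iff not_less)
      then show "b \<in> zonotope vs" using z by (simp add: u_def)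
    qed
  qed
qed

subsection \<open>The Steiner formula\<close>

lemma convergent_subseq_finite:
  fixes c :: "nat \<Rightarrow> nat \<Rightarrow> real"
  assumes "\<And>n k. \<bar>c n k\<bar> \<le> B"
  shows "\<exists>r l. strict_mono r \<and> (\<forall>k<d. (\<lambda>n. c (r n) k) \<longlonglongrightarrow> l k)"
proof (induction d)
  case 0
  then show ?case by (auto intro: exI[of _ id] simp: strict_mono_def)
next
  case (Suc d)
  then obtain r l where r: "strict_mono r" "\<And>k. k < d \<Longrightarrow> (\<lambda>n. c (r n) k) \<longlonglongrightarrow> l k" by blast
  have "\<forall>n. c (r n) d \<in> {- B..B}" using assms by (auto simp: abs_le_iff minus_le_iff)
  then obtain s m where s: "strict_mono s" "((\<lambda>n. c (r n) d) \<circ> s) \<longlonglongrightarrow> m"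
    by (metis seq_compactE[OF compact_imp_seq_compact[OF compact_Icc]])
  have "(\<lambda>n. c ((r \<circ> s) n) k) \<longlonglongrightarrow> (l(d := m)) k" if "k < Suc d" for k
  proof (cases "k = d")
    case True
    then show ?thesis using s(2) by (simp add: o_def)
  next
    case False
    then show ?thesis
      using LIMSEQ_subseq_LIMSEQ[OF r(2)[of k] s(1)] that by (simp add: o_def)
  qed
  then show ?case using strict_mono_o[OF r(1) s(1)] by blast
qed

text \<open>Nonnegative coefficients are bounded by the value at \<open>t = 1\<close>, which
  converges. Hence a subsequence of the coefficient vectors converges, and its limit serves every
  \<open>t\<close> because the values themselves converge.\<close>

lemma limit_of_nonneg_polynomials:
  fixes f :: "real \<Rightarrow> real" and c :: "nat \<Rightarrow> nat \<Rightarrow> real"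
  assumes lim: "\<And>t. 0 \<le> t \<Longrightarrow> (\<lambda>n. \<Sum>k\<le>d. c n k * t ^ k) \<longlonglongrightarrow> f t"
    and nonneg: "\<And>n k. 0 \<le> c n k"
  shows "\<exists>l. (\<forall>k. 0 \<le> l k) \<and> (\<forall>t\<ge>0. f t = (\<Sum>k\<le>d. l k * t ^ k))"
proof -
  obtain B where B: "\<And>n. \<bar>\<Sum>k\<le>d. c n k * 1 ^ k\<bar> \<le> B"
    using convergent_imp_Bseq[OF convergentI[OF lim[of 1]]] by (auto simp: Bseq_def)
  have "0 \<le> B" using B[of 0] by simp
  have "\<bar>if k \<le> d then c n k else 0\<bar> \<le> B" for n k
    using B[of n] member_le_sum[of k "{..d}" "c n"] nonneg \<open>0 \<le> B\<close> by auto
  then obtain r l where r: "strict_mono r"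
    and l: "\<And>k. k < Suc d \<Longrightarrow> (\<lambda>n. if k \<le> d then c (r n) k else 0) \<longlonglongrightarrow> l k"
    using convergent_subseq_finite[of "\<lambda>n k. if k \<le> d then c n k else 0" B "Suc d"] by blast
  have l: "(\<lambda>n. c (r n) k) \<longlonglongrightarrow> l k" if "k \<le> d" for k using l[of k] that by simp
  have "f t = (\<Sum>k\<le>d. (if k \<le> d then l k else 0) * t ^ k)" if "0 \<le> t" for t
  proof (rule LIMSEQ_unique)
    show "(\<lambda>n. \<Sum>k\<le>d. c (r n) k * t ^ k) \<longlonglongrightarrow> f t"
      using LIMSEQ_subseq_LIMSEQ[OF lim[OF that] r] by (simp add: o_def)
    show "(\<lambda>n. \<Sum>k\<le>d. c (r n) k * t ^ k) \<longlonglongrightarrow> (\<Sum>k\<le>d. (if k \<le> d then l k else 0) * t ^ k)"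
      by (intro tendsto_sum tendsto_mult tendsto_const) (simp add: l)
  qed
  moreover have "0 \<le> (if k \<le> d then l k else 0)" for k
    using LIMSEQ_le_const[OF l[of k], of 0] nonneg by auto
  ultimately show ?thesis by (intro exI[of _ "\<lambda>k. if k \<le> d then l k else 0"]) blast
qed

section \<open>Parallel bodies under dilation and translation\<close>

lemma emeasure_frame_scale:
  assumes "A \<in> sets borel" "0 < c"
  shows "emeasure (frame_measure d e) ((\<lambda>x. c *\<^sub>R x) ` A) = ennreal (c ^ d) * emeasure (frame_measure d e) A"
proof -
  have [measurable]: "(\<lambda>x. c *\<^sub>R x) ` A \<in> sets borel"
  proof -
    have "(\<lambda>x. c *\<^sub>R x) ` A = (\<lambda>x. inverse c *\<^sub>R x) -` A \<inter> space borel"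
      using assms(2) by (force intro: image_eqI[of _ _ "inverse c *\<^sub>R _"])
    then show ?thesis using measurable_sets[OF _ assms(1), of "\<lambda>x. inverse c *\<^sub>R x" borel] by simp
  qed
  have "indicator ((\<lambda>x. c *\<^sub>R x) ` A) (c *\<^sub>R x) = (indicator A x :: ennreal)" for x
    using assms(2) by (auto simp: indicator_def)
  then show ?thesis
    using nn_integral_frame_scale[of "indicator ((\<lambda>x. c *\<^sub>R x) ` A)" c d e] assms by simp
qed

lemma emeasure_frame_translate:
  assumes "orthonormal_frame d e" "v \<in> span (e ` {..<d})" "A \<in> sets borel"
  shows "emeasure (frame_measure d e) ((\<lambda>x. x + v) ` A) = emeasure (frame_measure d e) A"
proof -
  have [measurable]: "(\<lambda>x. x + v) ` A \<in> sets borel"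
  proof -
    have "(\<lambda>x. x + v) ` A = (\<lambda>x. x - v) -` A \<inter> space borel"
      by (force intro: image_eqI[of _ _ "_ - v"])
    then show ?thesis using measurable_sets[OF _ assms(3), of "\<lambda>x. x - v" borel] by simp
  qed
  have "indicator ((\<lambda>x. x + v) ` A) (x + v) = (indicator A x :: ennreal)" for x
    by (auto simp: indicator_def)
  then show ?thesis
    using nn_integral_frame_translate[OF assms(1,2), of "indicator ((\<lambda>x. x + v) ` A)"] assms by simp
qed

lemma frame_parallel_body_eq:
  assumes "0 \<le> r"
  shows "frame_parallel_body d e K r = K + frame_ball d e r"
proof (intro set_eqI iffI)
  fix y assume "y \<in> frame_parallel_body d e K r"
  then obtain x b where "x \<in> K" "b \<in> span (e ` {..<d})" "norm b \<le> 1" "y = x + r *\<^sub>R b"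
    by (auto simp: frame_parallel_body_def)
  then show "y \<in> K + frame_ball d e r"
    using assms by (auto simp: mem_frame_ball span_scale mult_left_le intro!: set_plus_intro)
next
  fix y assume "y \<in> K + frame_ball d e r"
  then obtain x b where xb: "x \<in> K" "b \<in> span (e ` {..<d})" "norm b \<le> r" "y = x + b"
    by (auto simp: set_plus_def mem_frame_ball)
  define b' where "b' = inverse r *\<^sub>R b"
  have "r *\<^sub>R b' = b" "norm b' \<le> 1"
    using xb assms by (cases "r = 0"; auto simp: b'_def divide_simps)+
  moreover have "b' \<in> span (e ` {..<d})" using xb by (simp add: b'_def span_scale)
  ultimately show "y \<in> frame_parallel_body d e K r"
    using xb by (auto simp: frame_parallel_body_def)
qed

lemma scaleR_frame_ball_subset:
  assumes "0 \<le> c" shows "x \<in> frame_ball d e r \<Longrightarrow> c *\<^sub>R x \<in> frame_ball d e (c * r)"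
  using assms mult_left_mono[of "norm x" r c] by (auto simp: mem_frame_ball span_scale)

text \<open>Seen from one of its points \<open>x0\<close>, a convex set lies in its dilate by
  \<open>c\<close>, so the larger parallel body lies in a dilate of the smaller one. This turns
  errors in the radius into a factor \<open>c ^ d\<close> and stands in for continuity of the
  volume.\<close>

lemma parallel_volume_scale_le:
  assumes e: "orthonormal_frame d e" and K: "compact K" "convex K" "K \<noteq> {}" "K \<subseteq> span (e ` {..<d})"
    and c: "1 \<le> c"
  shows "emeasure (frame_measure d e) (K + frame_ball d e (c * t)) \<le>
    ennreal (c ^ d) * emeasure (frame_measure d e) (K + frame_ball d e t)"
proof -
  let ?M = "frame_measure d e"
  obtain x0 where x0: "x0 \<in> K" using K by auto
  have comp: "compact (K + frame_ball d e r)" for r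
    using K(1) compact_frame_ball[OF e] by (rule compact_set_plus)
  define v where "v = x0 - c *\<^sub>R x0"
  have v: "v \<in> span (e ` {..<d})" using x0 K by (auto simp: v_def intro!: span_diff span_scale)
  let ?S = "(\<lambda>x. c *\<^sub>R x) ` (K + frame_ball d e t)"
  have compS: "compact ?S" by (intro compact_continuous_image comp continuous_intros)
  have compT: "compact ((\<lambda>x. x + v) ` ?S)" by (intro compact_continuous_image compS continuous_intros)
  have "K + frame_ball d e (c * t) \<subseteq> (\<lambda>x. x + v) ` ?S"
  proof
    fix y assume "y \<in> K + frame_ball d e (c * t)"
    then obtain x b where xb: "x \<in> K" "b \<in> frame_ball d e (c * t)" "y = x + b" by (auto simp: set_plus_def)
    define x' where "x' = (1 - 1 / c) *\<^sub>R x0 + (1 / c) *\<^sub>R x"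
    have "x' \<in> K" unfolding x'_def using xb x0 K c by (intro convexD) auto
    moreover have "(1 / c) *\<^sub>R b \<in> frame_ball d e t"
      using scaleR_frame_ball_subset[of "1 / c" b d e "c * t"] xb c by simp
    ultimately have "x' + (1 / c) *\<^sub>R b \<in> K + frame_ball d e t" by (rule set_plus_intro)
    moreover have "y = c *\<^sub>R (x' + (1 / c) *\<^sub>R b) + v"
      using c by (simp add: xb x'_def v_def algebra_simps)
    ultimately show "y \<in> (\<lambda>x. x + v) ` ?S" by blast
  qed
  then have "emeasure ?M (K + frame_ball d e (c * t)) \<le> emeasure ?M ((\<lambda>x. x + v) ` ?S)"
    using compT by (intro emeasure_mono) (auto intro: borel_compact)
  also have "\<dots> = ennreal (c ^ d) * emeasure ?M (K + frame_ball d e t)"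
    using emeasure_frame_translate[OF e v borel_compact[OF compS]]
      emeasure_frame_scale[OF borel_compact[OF comp[of t]], of c d e] c by simp
  finally show ?thesis .
qed

text \<open>Zonotopes between balls of radius 1 - \<open>\<epsilon> n\<close> and 1 +
  \<open>\<epsilon> n\<close> give polynomials that agree with the parallel volume up to factors
  tending to 1. Nonnegativity is recorded because the later estimates of single terms rest on
  it.\<close>

theorem steiner_formula_exists:
  fixes e :: "nat \<Rightarrow> 'a::{real_inner, second_countable_topology}"
  assumes e: "orthonormal_frame d e" and K: "compact K" "convex K" "K \<noteq> {}" "K \<subseteq> span (e ` {..<d})"
  shows "\<exists>V. steiner_formula d e K V \<and> (\<forall>k. 0 \<le> V k)"
proof -
  let ?M = "frame_measure d e"
  define M where "M t = measure ?M (K + frame_ball d e t)" for t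
  have comp: "compact (K + frame_ball d e r)" for r
    using K(1) compact_frame_ball[OF e] by (rule compact_set_plus)
  have fin: "emeasure ?M A = ennreal (measure ?M A)" if "compact A" for A
    using emeasure_frame_finite[OF e compact_imp_bounded[OF that]] by (simp add: emeasure_eq_ennreal_measure)
  have scale: "M (c * t) \<le> c ^ d * M t" if "1 \<le> c" for c t
    using parallel_volume_scale_le[OF e K that, of t] that unfolding fin[OF comp] M_def
    by (simp add: ennreal_mult'[symmetric])
  have mono: "measure ?M A \<le> measure ?M B" if "compact A" "compact B" "A \<subseteq> B" for A B
    using emeasure_mono[OF that(3), of ?M] borel_compact[OF that(2)] by (simp add: fin that)
  define \<epsilon> where "\<epsilon> n = 1 / (real n + 2)" for n
  have \<epsilon>: "0 < \<epsilon> n" "\<epsilon> n < 1" for n by (auto simp: \<epsilon>_def)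
  have "\<exists>vs. set vs \<subseteq> span (e ` {..<d}) \<and> frame_ball d e (1 - \<epsilon> n) \<subseteq> zonotope vs \<and>
      zonotope vs \<subseteq> frame_ball d e (1 + \<epsilon> n)" for n
    by (rule zonotope_approx_ball[OF e \<epsilon>(1)[of n]]) blast
  then obtain vs where vs: "\<And>n. set (vs n) \<subseteq> span (e ` {..<d})" "\<And>n. frame_ball d e (1 - \<epsilon> n) \<subseteq> zonotope (vs n)"
    "\<And>n. zonotope (vs n) \<subseteq> frame_ball d e (1 + \<epsilon> n)" by metis
  have "\<forall>n. \<exists>c. (\<forall>k. 0 \<le> c k) \<and> (\<forall>t\<ge>0. emeasure ?M (K + zonotope (map ((*\<^sub>R) t) (vs n))) =
      ennreal (\<Sum>k\<le>d. c k * t ^ k))"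
    by (intro allI volume_plus_zonotope_polynomial[OF e K(1,2,4) vs(1)])
  then obtain c where c: "\<And>n k. 0 \<le> c n k" "\<And>n t. 0 \<le> t \<Longrightarrow>
      emeasure ?M (K + zonotope (map ((*\<^sub>R) t) (vs n))) = ennreal (\<Sum>k\<le>d. c n k * t ^ k)"
    by metis
  have lim: "(\<lambda>n. \<Sum>k\<le>d. c n k * t ^ k) \<longlonglongrightarrow> M t" if t: "0 \<le> t" for t
  proof (rule tendsto_sandwich)
    have Z: "zonotope (map ((*\<^sub>R) t) (vs n)) = (\<lambda>x. t *\<^sub>R x) ` zonotope (vs n)" for n
      by (rule linear_image_zonotope[symmetric]) (rule linear_scaleR)
    have eq: "(\<Sum>k\<le>d. c n k * t ^ k) = measure ?M (K + zonotope (map ((*\<^sub>R) t) (vs n)))" for n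
      using c(2)[OF t, of n] c(1) t by (simp add: measure_def sum_nonneg)
    have compZ: "compact (K + zonotope (map ((*\<^sub>R) t) (vs n)))" for n
      using K(1) compact_zonotope by (rule compact_set_plus)
    have "(\<Sum>k\<le>d. c n k * t ^ k) \<le> (1 + \<epsilon> n) ^ d * M t" for n
    proof -
      have "zonotope (map ((*\<^sub>R) t) (vs n)) \<subseteq> frame_ball d e ((1 + \<epsilon> n) * t)"
        unfolding Z using vs(3)[of n] scaleR_frame_ball_subset[OF t] by (fastforce simp: mult.commute)
      then have "(\<Sum>k\<le>d. c n k * t ^ k) \<le> M ((1 + \<epsilon> n) * t)"
        unfolding eq M_def by (intro mono compZ comp set_plus_mono2) auto
      also have "\<dots> \<le> (1 + \<epsilon> n) ^ d * M t" using \<epsilon>[of n] by (intro scale) auto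
      finally show ?thesis .
    qed
    then show "\<forall>\<^sub>F n in sequentially. (\<Sum>k\<le>d. c n k * t ^ k) \<le> (1 + \<epsilon> n) ^ d * M t" by simp
    have "(1 - \<epsilon> n) ^ d * M t \<le> (\<Sum>k\<le>d. c n k * t ^ k)" for n
    proof -
      have "frame_ball d e ((1 - \<epsilon> n) * t) \<subseteq> zonotope (map ((*\<^sub>R) t) (vs n))"
      proof
        fix b assume b: "b \<in> frame_ball d e ((1 - \<epsilon> n) * t)"
        show "b \<in> zonotope (map ((*\<^sub>R) t) (vs n))"
        proof (cases "t = 0")
          case True
          have "zonotope (vs n) \<noteq> {}" using zonotope_support_attained by blast
          then show ?thesis unfolding Z using True b by (auto simp: mem_frame_ball image_constant_conv)
        next
          case False
          then have eq1: "inverse t * ((1 - \<epsilon> n) * t) = 1 - \<epsilon> n" by simp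
          have "inverse t *\<^sub>R b \<in> frame_ball d e (inverse t * ((1 - \<epsilon> n) * t))"
            using t by (intro scaleR_frame_ball_subset b) simp
          then have "inverse t *\<^sub>R b \<in> frame_ball d e (1 - \<epsilon> n)" by (simp only: eq1)
          then show ?thesis unfolding Z using vs(2)[of n] False by (force intro!: image_eqI[of _ _ "inverse t *\<^sub>R b"])
        qed
      qed
      then have *: "M ((1 - \<epsilon> n) * t) \<le> (\<Sum>k\<le>d. c n k * t ^ k)"
        unfolding eq M_def by (intro mono compZ comp set_plus_mono2) auto
      \<comment> \<open>The scaling bound concerns factors of at least 1, so the shrunken radius is
        taken as the start and blown up to \<open>t\<close>.\<close>
      have "inverse (1 - \<epsilon> n) * ((1 - \<epsilon> n) * t) = t"
        using \<epsilon>[of n] by (simp add: mult.assoc[symmetric])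
      then have "M t = M (inverse (1 - \<epsilon> n) * ((1 - \<epsilon> n) * t))" by (simp only:)
      also have "\<dots> \<le> inverse (1 - \<epsilon> n) ^ d * M ((1 - \<epsilon> n) * t)"
        using \<epsilon>[of n] by (intro scale) (auto simp: one_le_inverse_iff)
      finally have "M t \<le> M ((1 - \<epsilon> n) * t) / (1 - \<epsilon> n) ^ d"
        by (simp add: power_inverse divide_inverse mult.commute)
      then have "(1 - \<epsilon> n) ^ d * M t \<le> M ((1 - \<epsilon> n) * t)"
        using \<epsilon>[of n] by (simp add: pos_le_divide_eq mult.commute)
      then show ?thesis using * by linarith
    qed
    then show "\<forall>\<^sub>F n in sequentially. (1 - \<epsilon> n) ^ d * M t \<le> (\<Sum>k\<le>d. c n k * t ^ k)" by simp
    have \<epsilon>0: "\<epsilon> \<longlonglongrightarrow> 0" unfolding \<epsilon>_def by real_asymp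
    have "(\<lambda>n. (1 + \<epsilon> n) ^ d * M t) \<longlonglongrightarrow> (1 + 0) ^ d * M t" "(\<lambda>n. (1 - \<epsilon> n) ^ d * M t) \<longlonglongrightarrow> (1 - 0) ^ d * M t"
      by (intro tendsto_mult tendsto_power tendsto_diff tendsto_add tendsto_const \<epsilon>0)+
    then show "(\<lambda>n. (1 + \<epsilon> n) ^ d * M t) \<longlonglongrightarrow> M t" "(\<lambda>n. (1 - \<epsilon> n) ^ d * M t) \<longlonglongrightarrow> M t" by simp_all
  qed
  obtain l where l: "\<And>k. 0 \<le> l k" "\<And>t. 0 \<le> t \<Longrightarrow> M t = (\<Sum>k\<le>d. l k * t ^ k)"
    using limit_of_nonneg_polynomials[OF lim c(1)] by blast
  \<comment> \<open>The Steiner formula counts powers from the top: \<open>V k\<close> comes from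
    the coefficient at \<open>r ^ (d - k)\<close>, divided by the volume of the unit ball of that
    dimension.\<close>
  define V where "V k = (if k \<le> d then l (d - k) / unit_ball_vol (real (d - k)) else 0)" for k
  have "frame_volume d e (frame_parallel_body d e K r) =
      (\<Sum>k\<le>d. unit_ball_vol (real (d - k)) * V k * r ^ (d - k))" if "0 \<le> r" for r
  proof -
    have "frame_volume d e (frame_parallel_body d e K r) = (\<Sum>k\<le>d. l k * r ^ k)"
      using that borel_compact[OF comp] by (simp add: frame_parallel_body_eq frame_volume_eq_measure l(2)[symmetric] M_def)
    also have "\<dots> = (\<Sum>k\<le>d. l (d - k) * r ^ (d - k))"
      by (rule sum.reindex_bij_witness[of _ "\<lambda>k. d - k" "\<lambda>k. d - k"]) auto
    also have "\<dots> = (\<Sum>k\<le>d. unit_ball_vol (real (d - k)) * V k * r ^ (d - k))"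
      using unit_ball_vol_pos by (intro sum.cong) (auto simp: V_def less_le)
    finally show ?thesis .
  qed
  moreover have "0 \<le> V k" for k using l(1) by (simp add: V_def)
  ultimately show ?thesis unfolding steiner_formula_def by (intro exI[of _ V]) (auto simp: V_def)
qed

subsection \<open>The Wills functional\<close>

lemma borel_measurable_infdist [measurable]: "(\<lambda>x. infdist x K) \<in> borel_measurable borel"
  by (intro borel_measurable_continuous_onI continuous_intros)

definition wills ::
    "nat \<Rightarrow> (nat \<Rightarrow> 'a::{real_inner, second_countable_topology}) \<Rightarrow> 'a set \<Rightarrow> ennreal" where
  "wills d e K = (\<integral>\<^sup>+x. ennreal (exp (- pi * (infdist x K)\<^sup>2)) \<partial>frame_measure d e)"

lemma infdist_attained:
  assumes "compact K" "K \<noteq> {}"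
  obtains a where "a \<in> K" "infdist x K = dist x a"
proof -
  obtain a where a: "a \<in> K" "\<forall>y\<in>K. dist x a \<le> dist x y"
    using continuous_attains_inf[OF assms continuous_on_dist[OF continuous_on_const continuous_on_id]] by blast
  have "infdist x K = dist x a"
    unfolding infdist_notempty[OF assms(2)] using a
    by (intro antisym cINF_lower2[of _ _ a] cINF_greatest assms(2)) (auto intro: bdd_belowI2[of _ 0])
  then show ?thesis using that a by blast
qed

lemma infdist_scaleR:
  fixes K :: "'a::real_normed_vector set"
  assumes "0 < r"
  shows "infdist (r *\<^sub>R x) ((*\<^sub>R) r ` K) = r * infdist x K"
proof (cases "K = {}")
  case False
  have *: "c * infdist x K \<le> infdist (c *\<^sub>R x) ((*\<^sub>R) c ` K)" if "0 < c" "K \<noteq> {}" for c x and K :: "'a set"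
  proof -
    have "c * infdist x K \<le> dist (c *\<^sub>R x) (c *\<^sub>R a)" if "a \<in> K" for a
      using infdist_le[OF that, of x] \<open>0 < c\<close> by (simp add: dist_norm scaleR_diff_right[symmetric])
    then show ?thesis
      using that by (subst infdist_notempty[of "(*\<^sub>R) c ` K"]) (auto intro!: cINF_greatest)
  qed
  have "inverse r * infdist (r *\<^sub>R x) ((*\<^sub>R) r ` K) \<le> infdist x K"
    using *[of "inverse r" "(*\<^sub>R) r ` K" "r *\<^sub>R x"] assms False by (simp add: image_image)
  then have "infdist (r *\<^sub>R x) ((*\<^sub>R) r ` K) \<le> r * infdist x K"
    using assms by (simp add: field_simps)
  with *[of r K x] assms False show ?thesis by (intro antisym)
qed (simp add: infdist_def)

lemma sigma_finite_frame_measure: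
  assumes "orthonormal_frame d e"
  shows "sigma_finite_measure (frame_measure d e)"
proof
  show "\<exists>A. countable A \<and> A \<subseteq> sets (frame_measure d e) \<and> \<Union> A = space (frame_measure d e) \<and>
      (\<forall>a\<in>A. emeasure (frame_measure d e) a \<noteq> \<infinity>)"
  proof (intro exI[of _ "range (\<lambda>n. cball 0 (real n))"] conjI ballI)
    show "\<Union> (range (\<lambda>n. cball 0 (real n))) = space (frame_measure d e)"
      using real_arch_simple by (auto simp: real_nat_ceiling_ge)
    show "emeasure (frame_measure d e) a \<noteq> \<infinity>" if "a \<in> range (\<lambda>n. cball 0 (real n))" for a
      using emeasure_frame_finite[OF assms, of a] that by auto
  qed auto
qed

lemma parallel_body_iff_infdist:
  assumes K: "compact K" "K \<noteq> {}" "K \<subseteq> span (e ` {..<d})" and "0 \<le> \<rho>"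
  shows "{x. infdist x K \<le> \<rho>} \<inter> span (e ` {..<d}) = K + frame_ball d e \<rho>"
proof (intro set_eqI iffI)
  fix x assume x: "x \<in> {x. infdist x K \<le> \<rho>} \<inter> span (e ` {..<d})"
  obtain a where a: "a \<in> K" "infdist x K = dist x a" using infdist_attained[OF K(1,2)] .
  then have "x - a \<in> frame_ball d e \<rho>" using x K by (auto simp: mem_frame_ball dist_norm intro!: span_diff)
  then have "a + (x - a) \<in> K + frame_ball d e \<rho>" using a by (intro set_plus_intro)
  then show "x \<in> K + frame_ball d e \<rho>" by simp
next
  fix x assume "x \<in> K + frame_ball d e \<rho>"
  then obtain a b where ab: "a \<in> K" "b \<in> frame_ball d e \<rho>" "x = a + b" by (auto simp: set_plus_def)
  have "infdist x K \<le> \<rho>" using ab infdist_le[OF ab(1), of x] by (simp add: dist_norm mem_frame_ball)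
  then show "x \<in> {x. infdist x K \<le> \<rho>} \<inter> span (e ` {..<d})"
    using ab K by (auto simp: mem_frame_ball intro!: span_add)
qed

text \<open>The weight is minus the derivative of exp (- pi r^2 rho^2), which vanishes at
  infinity.\<close>

lemma gaussian_layer_cake:
  assumes "0 < r" "0 \<le> s"
  shows "(\<integral>\<^sup>+\<rho>. ennreal (2 * pi * r\<^sup>2 * \<rho> * exp (- pi * r\<^sup>2 * \<rho>\<^sup>2)) * indicator {s..} \<rho> \<partial>lborel) =
    ennreal (exp (- pi * r\<^sup>2 * s\<^sup>2))"
proof -
  have "((\<lambda>\<rho>. - exp (- pi * r\<^sup>2 * \<rho>\<^sup>2)) \<longlongrightarrow> 0) at_top"
    using assms by real_asymp
  then have "(\<integral>\<^sup>+\<rho>. ennreal (2 * pi * r\<^sup>2 * \<rho> * exp (- pi * r\<^sup>2 * \<rho>\<^sup>2)) * indicator {s..} \<rho> \<partial>lborel) =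
      ennreal (0 - (- exp (- pi * r\<^sup>2 * s\<^sup>2)))"
    using assms by (intro nn_integral_FTC_atLeast) (auto intro!: derivative_eq_intros simp: power2_eq_square)
  then show ?thesis by simp
qed

text \<open>The Gaussian of the distance is an integral over the levels \<open>\<rho>\<close> above
  that distance. After Fubini each level contributes the volume of a parallel body, to which the
  Steiner formula applies.\<close>

lemma gaussian_infdist_layer_cake:
  assumes e: "orthonormal_frame d e" and K: "compact K" "K \<noteq> {}" "K \<subseteq> span (e ` {..<d})" and r: "0 < r"
  shows "(\<integral>\<^sup>+x. ennreal (exp (- pi * r\<^sup>2 * (infdist x K)\<^sup>2)) \<partial>frame_measure d e) =
    (\<integral>\<^sup>+\<rho>. ennreal (2 * pi * r\<^sup>2 * \<rho> * exp (- pi * r\<^sup>2 * \<rho>\<^sup>2)) *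
      emeasure (frame_measure d e) (K + frame_ball d e \<rho>) \<partial>lborel)"
proof -
  let ?i = "\<lambda>x \<rho>. indicator {p. infdist (fst p) K \<le> snd p} (x, \<rho>) :: ennreal"
  let ?M = "frame_measure d e"
  let ?w = "\<lambda>\<rho>. ennreal (2 * pi * r\<^sup>2 * \<rho> * exp (- pi * r\<^sup>2 * \<rho>\<^sup>2))"
  interpret sigma_finite_measure ?M using e by (rule sigma_finite_frame_measure)
  interpret P: pair_sigma_finite ?M lborel ..
  have "(\<integral>\<^sup>+x. ennreal (exp (- pi * r\<^sup>2 * (infdist x K)\<^sup>2)) \<partial>?M) =
      (\<integral>\<^sup>+x. (\<integral>\<^sup>+\<rho>. ?w \<rho> * ?i x \<rho> \<partial>lborel) \<partial>?M)"
  proof (rule nn_integral_cong)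
    fix x
    have "ennreal (exp (- pi * r\<^sup>2 * (infdist x K)\<^sup>2)) = (\<integral>\<^sup>+\<rho>. ?w \<rho> * indicator {infdist x K..} \<rho> \<partial>lborel)"
      using gaussian_layer_cake[OF r infdist_nonneg] ..
    also have "\<dots> = (\<integral>\<^sup>+\<rho>. ?w \<rho> * ?i x \<rho> \<partial>lborel)"
      by (simp add: indicator_def)
    finally show "ennreal (exp (- pi * r\<^sup>2 * (infdist x K)\<^sup>2)) =
      (\<integral>\<^sup>+\<rho>. ?w \<rho> * ?i x \<rho> \<partial>lborel)" .
  qed
  also have "\<dots> = (\<integral>\<^sup>+\<rho>. (\<integral>\<^sup>+x. ?w \<rho> * ?i x \<rho> \<partial>?M) \<partial>lborel)"
    by (rule P.Fubini'[symmetric]) measurable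
  also have "\<dots> = (\<integral>\<^sup>+\<rho>. ?w \<rho> * emeasure ?M (K + frame_ball d e \<rho>) \<partial>lborel)"
  proof (rule nn_integral_cong)
    fix \<rho>
    show "(\<integral>\<^sup>+x. ?w \<rho> * ?i x \<rho> \<partial>?M) = ?w \<rho> * emeasure ?M (K + frame_ball d e \<rho>)"
    proof (cases "0 \<le> \<rho>")
      case True
      have [measurable]: "{x. infdist x K \<le> \<rho>} \<in> sets borel" by measurable
      have "(\<integral>\<^sup>+x. ?w \<rho> * ?i x \<rho> \<partial>?M) =
          (\<integral>\<^sup>+x. ?w \<rho> * indicator {x. infdist x K \<le> \<rho>} x \<partial>?M)" by (simp add: indicator_def)
      also have "\<dots> = ?w \<rho> * emeasure ?M {x. infdist x K \<le> \<rho>}"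
        by (rule nn_integral_cmult_indicator) simp
      also have "emeasure ?M {x. infdist x K \<le> \<rho>} = emeasure ?M (K + frame_ball d e \<rho>)"
        by (subst emeasure_frame_eq_span_Int[OF e]) (simp_all add: parallel_body_iff_infdist[OF K True])
      finally show ?thesis .
    next
      case False
      \<comment> \<open>At negative levels the weight is a negative real, which
        \<open>ennreal\<close> sends to 0.\<close>
      then have "?w \<rho> = 0" by (intro ennreal_neg mult_nonpos_nonneg mult_nonneg_nonpos) auto
      then show ?thesis by simp
    qed
  qed
  finally show ?thesis .
qed

lemma frame_le: "orthonormal_frame d e \<Longrightarrow> j \<le> d \<Longrightarrow> orthonormal_frame j e"
  by (simp add: orthonormal_frame_def)

text \<open>
  The moments of the radial Gaussian density are read off from the layer-cake formula for a single
  point.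
\<close>

lemma gaussian_moment_ball_vol:
  fixes e :: "nat \<Rightarrow> 'a::{real_inner, second_countable_topology}"
  assumes e: "orthonormal_frame j e" and r: "0 < r"
  shows "ennreal (r ^ j) * (\<integral>\<^sup>+\<rho>. ennreal (2 * pi * r\<^sup>2 * \<rho> * exp (- pi * r\<^sup>2 * \<rho>\<^sup>2)) *
      ennreal (unit_ball_vol (real j) * \<rho> ^ j) \<partial>lborel) = 1"
proof -
  let ?M = "frame_measure j e"
  let ?w = "\<lambda>\<rho>. ennreal (2 * pi * r\<^sup>2 * \<rho> * exp (- pi * r\<^sup>2 * \<rho>\<^sup>2))"
  have "1 = (\<integral>\<^sup>+x. ennreal (exp (- pi * (norm x)\<^sup>2)) \<partial>?M)"
    using nn_integral_frame_gaussian[OF e] ..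
  also have "\<dots> = ennreal (r ^ j) * (\<integral>\<^sup>+x. ennreal (exp (- pi * (norm (r *\<^sub>R x))\<^sup>2)) \<partial>?M)"
    using nn_integral_frame_scale[of "\<lambda>x. ennreal (exp (- pi * (norm x)\<^sup>2))" r j e] r by simp
  also have "(\<integral>\<^sup>+x. ennreal (exp (- pi * (norm (r *\<^sub>R x))\<^sup>2)) \<partial>?M) =
      (\<integral>\<^sup>+x. ennreal (exp (- pi * r\<^sup>2 * (infdist x {0})\<^sup>2)) \<partial>?M)"
    using r by (simp add: power_mult_distrib mult_ac)
  also have "\<dots> = (\<integral>\<^sup>+\<rho>. ?w \<rho> * emeasure ?M ({0} + frame_ball j e \<rho>) \<partial>lborel)"
    by (rule gaussian_infdist_layer_cake[OF e _ _ _ r]) (auto simp: span_zero)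
  also have "\<dots> = (\<integral>\<^sup>+\<rho>. ?w \<rho> * ennreal (unit_ball_vol (real j) * \<rho> ^ j) \<partial>lborel)"
  proof (rule nn_integral_cong)
    fix \<rho>
    show "?w \<rho> * emeasure ?M ({0} + frame_ball j e \<rho>) = ?w \<rho> * ennreal (unit_ball_vol (real j) * \<rho> ^ j)"
    proof (cases "0 < \<rho>")
      case True
      then show ?thesis by (simp add: emeasure_frame_ball[OF e])
    next
      case False
      then have "?w \<rho> = 0" by (intro ennreal_neg mult_nonpos_nonneg mult_nonneg_nonpos) auto
      then show ?thesis by simp
    qed
  qed
  finally show ?thesis ..
qed

text \<open>The substitution moves the dilation from the body into the Gaussian, so that only
  parallel bodies of the fixed \<open>K\<close> occur.\<close>

lemma wills_scale:
  assumes r: "0 < r"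
  shows "wills d e ((*\<^sub>R) r ` K) =
    ennreal (r ^ d) * (\<integral>\<^sup>+x. ennreal (exp (- pi * r\<^sup>2 * (infdist x K)\<^sup>2)) \<partial>frame_measure d e)"
proof -
  have "wills d e ((*\<^sub>R) r ` K) = ennreal (r ^ d) *
      (\<integral>\<^sup>+x. ennreal (exp (- pi * (infdist (r *\<^sub>R x) ((*\<^sub>R) r ` K))\<^sup>2)) \<partial>frame_measure d e)"
    unfolding wills_def
    using nn_integral_frame_scale[of "\<lambda>x. ennreal (exp (- pi * (infdist x ((*\<^sub>R) r ` K))\<^sup>2))" r d e] r by simp
  then show ?thesis using r by (simp add: infdist_scaleR power_mult_distrib mult_ac)
qed

text \<open>The ball volumes of the Steiner formula cancel against the Gaussian moments: of
  \<open>r ^ d\<close> the part \<open>r ^ (d - k)\<close> is used up by the moment of order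
  \<open>d - k\<close>, and \<open>r ^ k\<close> remains.\<close>

lemma wills_eq_steiner_polynomial:
  assumes e: "orthonormal_frame d e" and K: "compact K" "K \<noteq> {}" "K \<subseteq> span (e ` {..<d})"
    and V: "steiner_formula d e K V" "\<And>k. 0 \<le> V k" and r: "0 < r"
  shows "wills d e ((*\<^sub>R) r ` K) = ennreal (\<Sum>k\<le>d. V k * r ^ k)"
proof -
  let ?b = "\<lambda>k \<rho>. ennreal (unit_ball_vol (real (d - k)) * \<rho> ^ (d - k))"
  let ?I = "\<lambda>k. \<integral>\<^sup>+\<rho>. ennreal (2 * pi * r\<^sup>2 * \<rho> * exp (- pi * r\<^sup>2 * \<rho>\<^sup>2)) * ?b k \<rho> \<partial>lborel"
  let ?M = "frame_measure d e"
  let ?w = "\<lambda>\<rho>. ennreal (2 * pi * r\<^sup>2 * \<rho> * exp (- pi * r\<^sup>2 * \<rho>\<^sup>2))"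
  have comp: "compact (K + frame_ball d e \<rho>)" for \<rho>
    using K(1) compact_frame_ball[OF e] by (rule compact_set_plus)
  have vol: "emeasure ?M (K + frame_ball d e \<rho>) = ennreal (\<Sum>k\<le>d. unit_ball_vol (real (d - k)) * V k * \<rho> ^ (d - k))"
    if "0 < \<rho>" for \<rho>
  proof -
    have "emeasure ?M (K + frame_ball d e \<rho>) = ennreal (measure ?M (K + frame_ball d e \<rho>))"
      using emeasure_frame_finite[OF e compact_imp_bounded[OF comp[of \<rho>]]] by (simp add: emeasure_eq_ennreal_measure)
    also have "measure ?M (K + frame_ball d e \<rho>) = frame_volume d e (frame_parallel_body d e K \<rho>)"
      using that borel_compact[OF comp] by (simp add: frame_parallel_body_eq frame_volume_eq_measure)
    finally show ?thesis using V(1) that by (simp add: steiner_formula_def)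
  qed
  have "wills d e ((*\<^sub>R) r ` K) = ennreal (r ^ d) * (\<integral>\<^sup>+\<rho>. ?w \<rho> * emeasure ?M (K + frame_ball d e \<rho>) \<partial>lborel)"
    unfolding wills_scale[OF r] gaussian_infdist_layer_cake[OF e K r] ..
  also have "(\<integral>\<^sup>+\<rho>. ?w \<rho> * emeasure ?M (K + frame_ball d e \<rho>) \<partial>lborel) =
      (\<integral>\<^sup>+\<rho>. (\<Sum>k\<le>d. ennreal (V k) * (?w \<rho> * ?b k \<rho>)) \<partial>lborel)"
  proof (rule nn_integral_cong)
    fix \<rho>
    show "?w \<rho> * emeasure ?M (K + frame_ball d e \<rho>) =
        (\<Sum>k\<le>d. ennreal (V k) * (?w \<rho> * ?b k \<rho>))"
    proof (cases "0 < \<rho>")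
      case True
      have "emeasure ?M (K + frame_ball d e \<rho>) = (\<Sum>k\<le>d. ennreal (V k) * ?b k \<rho>)"
        unfolding vol[OF True] using V(2) True
        by (subst sum_ennreal[symmetric]) (auto simp: ennreal_mult'[symmetric] mult_ac)
      then show ?thesis by (simp only: sum_distrib_left) (intro sum.cong refl mult.left_commute)
    next
      case False
      then have "?w \<rho> = 0" by (intro ennreal_neg mult_nonpos_nonneg mult_nonneg_nonpos) auto
      then show ?thesis by simp
    qed
  qed
  also have "\<dots> = (\<Sum>k\<le>d. ennreal (V k) * ?I k)"
    by (subst nn_integral_sum) (auto simp: nn_integral_cmult)
  also have "ennreal (r ^ d) * \<dots> = (\<Sum>k\<le>d. ennreal (V k * r ^ k) *
      (ennreal (r ^ (d - k)) * ?I k))"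
    unfolding sum_distrib_left
  proof (rule sum.cong)
    fix k assume "k \<in> {..d}"
    then have "r ^ d = r ^ k * r ^ (d - k)" by (simp add: power_add[symmetric])
    then have "ennreal (r ^ d) * ennreal (V k) = ennreal (V k * r ^ k) * ennreal (r ^ (d - k))"
      using r V(2) by (simp add: ennreal_mult'[symmetric] mult_ac)
    then show "ennreal (r ^ d) * (ennreal (V k) * ?I k) =
      ennreal (V k * r ^ k) * (ennreal (r ^ (d - k)) * ?I k)"
      by (simp add: mult.assoc[symmetric])
  qed simp
  also have "\<dots> = (\<Sum>k\<le>d. ennreal (V k * r ^ k))"
    using gaussian_moment_ball_vol[OF frame_le[OF e] r] by (simp del: of_nat_diff)
  also have "\<dots> = ennreal (\<Sum>k\<le>d. V k * r ^ k)" using V(2) r by (intro sum_ennreal) simp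
  finally show ?thesis .
qed

section \<open>Uniqueness of the coefficients and independence of the ambient space\<close>

lemma polynomial_coeffs_eq:
  fixes a b :: "nat \<Rightarrow> real"
  assumes "\<And>r. 0 < r \<Longrightarrow> (\<Sum>k\<le>d. a k * r ^ k) = (\<Sum>k\<le>d. b k * r ^ k)" "k \<le> d"
  shows "a k = b k"
proof (rule ccontr)
  assume "a k \<noteq> b k"
  then have "\<exists>i\<le>d. a i - b i \<noteq> 0" using assms(2) by (intro exI[of _ k]) auto
  then have "finite {r. (\<Sum>k\<le>d. (a k - b k) * r ^ k) = 0}"
    unfolding polyfun_finite_roots .
  moreover have "{0<..} \<subseteq> {r. (\<Sum>k\<le>d. (a k - b k) * r ^ k) = 0}"
    using assms(1) by (auto simp: left_diff_distrib sum_subtractf)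
  ultimately show False using infinite_Ioi[of "0::real"] finite_subset by blast
qed

lemma steiner_formula_unique:
  assumes "steiner_formula d e K V" "steiner_formula d e K V'"
  shows "V = V'"
proof
  fix k
  show "V k = V' k"
  proof (cases "k \<le> d")
    case True
    have rev: "(\<Sum>k\<le>d. unit_ball_vol (real (d - k)) * V k * r ^ (d - k)) = (\<Sum>k\<le>d. (unit_ball_vol (real k) * V (d - k)) * r ^ k)"
      for V :: "nat \<Rightarrow> real" and r
      by (rule sum.reindex_bij_witness[of _ "\<lambda>k. d - k" "\<lambda>k. d - k"]) auto
    have "unit_ball_vol (real (d - k)) * V (d - (d - k)) = unit_ball_vol (real (d - k)) * V' (d - (d - k))"
    proof (rule polynomial_coeffs_eq[where d = d and a = "\<lambda>k. unit_ball_vol (real k) * V (d - k)"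
          and b = "\<lambda>k. unit_ball_vol (real k) * V' (d - k)"])
      fix r :: real assume "0 < r"
      then have "frame_volume d e (frame_parallel_body d e K r) =
          (\<Sum>k\<le>d. unit_ball_vol (real (d - k)) * U k * r ^ (d - k))" if "steiner_formula d e K U" for U
        using that by (auto simp: steiner_formula_def)
      from this[OF assms(1)] this[OF assms(2)]
      show "(\<Sum>k\<le>d. (unit_ball_vol (real k) * V (d - k)) * r ^ k) = (\<Sum>k\<le>d. (unit_ball_vol (real k) * V' (d - k)) * r ^ k)"
        unfolding rev[symmetric] by simp
    qed simp
    moreover have "unit_ball_vol (real (d - k)) \<noteq> 0" using unit_ball_vol_pos[of "real (d - k)"] by (metis less_irrefl of_nat_0_le_iff)
    ultimately show ?thesis using True by (simp del: of_nat_diff)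
  next
    case False
    then show ?thesis using assms by (simp add: steiner_formula_def)
  qed
qed

text \<open>By Pythagoras the squared distance to \<open>K\<close> is that of the projected point
  plus the square of the new coordinate. The integrand factors, and the Gaussian in the new
  coordinate has integral 1.\<close>

lemma wills_Suc:
  assumes e: "orthonormal_frame (Suc d) e" and K: "compact K" "K \<noteq> {}" "K \<subseteq> span (e ` {..<d})"
  shows "wills (Suc d) e K = wills d e K"
proof -
  have inf: "(infdist (x + t *\<^sub>R e d) K)\<^sup>2 = (infdist x K)\<^sup>2 + t\<^sup>2" if x: "x \<in> span (e ` {..<d})" for x t
  proof -
    have d: "(dist (x + t *\<^sub>R e d) a)\<^sup>2 = (dist x a)\<^sup>2 + t\<^sup>2" if "a \<in> K" for a
      using norm_add_frame_next[OF e, of "x - a" t] x K that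
      by (auto simp: dist_norm algebra_simps intro!: span_diff)
    obtain a where a: "a \<in> K" "infdist x K = dist x a" using infdist_attained[OF K(1,2)] .
    obtain b where b: "b \<in> K" "infdist (x + t *\<^sub>R e d) K = dist (x + t *\<^sub>R e d) b" using infdist_attained[OF K(1,2)] .
    have "(infdist (x + t *\<^sub>R e d) K)\<^sup>2 \<le> (dist (x + t *\<^sub>R e d) a)\<^sup>2"
      using infdist_le[OF a(1)] by (intro power_mono infdist_nonneg)
    moreover have "(infdist x K)\<^sup>2 \<le> (dist x b)\<^sup>2"
      using infdist_le[OF b(1)] by (intro power_mono infdist_nonneg)
    ultimately show ?thesis using d[OF a(1)] d[OF b(1)] unfolding a(2) b(2) by linarith
  qed
  have "wills (Suc d) e K = (\<integral>\<^sup>+x. (\<integral>\<^sup>+t. ennreal (exp (- pi * (infdist (x + t *\<^sub>R e d) K)\<^sup>2)) \<partial>lborel) \<partial>frame_measure d e)"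
    unfolding wills_def by (rule nn_integral_frame_Suc) simp
  also have "\<dots> = (\<integral>\<^sup>+x. (\<integral>\<^sup>+t. ennreal (exp (- pi * (infdist x K)\<^sup>2)) * ennreal (exp (- pi * t\<^sup>2)) \<partial>lborel) \<partial>frame_measure d e)"
    by (rule nn_integral_frame_cong) (auto simp: inf ennreal_mult'[symmetric] exp_add[symmetric] algebra_simps)
  also have "\<dots> = wills d e K"
    using nn_integral_gaussian by (simp add: nn_integral_cmult wills_def)
  finally show ?thesis .
qed

lemma wills_extend:
  assumes "d \<le> d'" "orthonormal_frame d' e" and K: "compact K" "K \<noteq> {}" "K \<subseteq> span (e ` {..<d})"
  shows "wills d' e K = wills d e K"
  using assms(1,2)
proof (induction d' rule: dec_induct)
  case (step n)
  have "K \<subseteq> span (e ` {..<n})"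
    using K(3) extend_frame_span_mono[OF step.hyps(1), of e e] by auto
  then show ?case using wills_Suc[OF step.prems K(1,2)] step orthonormal_frame_Suc by metis
qed simp

lemma frame_measure_cong: "(\<And>i. i < d \<Longrightarrow> e i = e' i) \<Longrightarrow> frame_measure d e = frame_measure d e'"
  unfolding frame_measure_def by (intro distr_cong) (auto simp: frame_map_def)

text \<open>Both frames are extended to frames of one common span. Extension does not change the
  functional, and on a fixed span the measure does not depend on the frame.\<close>

lemma wills_independent:
  fixes e e' :: "nat \<Rightarrow> 'a::{real_inner, second_countable_topology}"
  assumes e: "orthonormal_frame d e" "K \<subseteq> span (e ` {..<d})"
    and e': "orthonormal_frame d' e'" "K \<subseteq> span (e' ` {..<d'})"
    and K: "compact K" "K \<noteq> {}"
  shows "wills d e K = wills d' e' K"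
proof -
  have ext: "\<exists>m f. orthonormal_frame m f \<and> span (f ` {..<m}) = span (B \<union> e ` {..<d}) \<and> wills d e K = wills m f K"
    if e: "orthonormal_frame d e" "K \<subseteq> span (e ` {..<d})" and fin: "finite B" for d and e :: "nat \<Rightarrow> 'a" and B
  proof -
    obtain m f where f: "d \<le> m" "orthonormal_frame m f" "\<And>i. i < d \<Longrightarrow> f i = e i"
      "span (f ` {..<m}) = span (B \<union> e ` {..<d})" using extend_frame[OF fin e(1)] by metis
    have "K \<subseteq> span (f ` {..<d})" using e(2) f(3) by (metis (no_types, lifting) image_cong lessThan_iff)
    then have "wills m f K = wills d f K" using f K by (intro wills_extend)
    also have "\<dots> = wills d e K" unfolding wills_def using frame_measure_cong[OF f(3)] by simp
    finally show ?thesis using f by metis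
  qed
  obtain m f where f: "orthonormal_frame m f" "span (f ` {..<m}) = span (e' ` {..<d'} \<union> e ` {..<d})"
    "wills d e K = wills m f K" using ext[OF e, of "e' ` {..<d'}"] by auto
  obtain m' f' where f': "orthonormal_frame m' f'" "span (f' ` {..<m'}) = span (e ` {..<d} \<union> e' ` {..<d'})"
    "wills d' e' K = wills m' f' K" using ext[OF e', of "e ` {..<d}"] by auto
  have "wills m f K = wills m' f' K"
    unfolding wills_def using f f' by (intro nn_integral_frame_change) (auto simp: Un_commute)
  then show ?thesis using f f' by simp
qed

text \<open>The definite description ranges over all frames and dimensions. Any two admissible
  sequences have the same generating polynomial, namely the Wills functional of the dilates, and
  therefore agree.\<close>

lemma fin_intrinsic_volume_eq:
  fixes e :: "nat \<Rightarrow> 'a::{real_inner, second_countable_topology}"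
  assumes e: "orthonormal_frame d e" and K: "compact K" "convex K" "K \<noteq> {}" "K \<subseteq> span (e ` {..<d})"
    and V: "steiner_formula d e K V"
  shows "fin_intrinsic_volume k K = V k"
proof -
  have "V' = V" if e': "orthonormal_frame d' e'" "K \<subseteq> span (e' ` {..<d'})" and V': "steiner_formula d' e' K V'"
    for d' V' and e' :: "nat \<Rightarrow> 'a"
  proof -
    have nonneg: "0 \<le> V k" "0 \<le> V' k" for k
      using steiner_formula_exists[OF e K] steiner_formula_exists[OF e'(1) K(1-3) e'(2)]
        steiner_formula_unique V V' by metis+
    \<comment> \<open>Each sequence vanishes beyond its own dimension, so both sums can be padded to
      the common degree \<open>d + d'\<close>.\<close>
    have poly: "(\<Sum>k\<le>d + d'. V k * r ^ k) = (\<Sum>k\<le>d + d'. V' k * r ^ k)" if r: "0 < r" for r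
    proof -
      have trunc: "(\<Sum>k\<le>m. U k * r ^ k) = (\<Sum>k\<le>d + d'. U k * r ^ k)"
        if "m \<le> d + d'" "\<forall>k>m. U k = 0" for U :: "nat \<Rightarrow> real" and m
        using that by (intro sum.mono_neutral_left) auto
      have "compact ((*\<^sub>R) r ` K)" "(*\<^sub>R) r ` K \<noteq> {}"
        using K by (auto intro!: compact_continuous_image continuous_intros)
      moreover have "(*\<^sub>R) r ` K \<subseteq> span (e ` {..<d})" "(*\<^sub>R) r ` K \<subseteq> span (e' ` {..<d'})"
        using K e' by (auto intro: span_scale)
      ultimately have "wills d e ((*\<^sub>R) r ` K) = wills d' e' ((*\<^sub>R) r ` K)"
        using e e' by (intro wills_independent)
      then have "ennreal (\<Sum>k\<le>d. V k * r ^ k) = ennreal (\<Sum>k\<le>d'. V' k * r ^ k)"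
        using wills_eq_steiner_polynomial[OF e K(1,3,4) V nonneg(1) r]
          wills_eq_steiner_polynomial[OF e'(1) K(1,3) e'(2) V' nonneg(2) r] by simp
      then have "(\<Sum>k\<le>d. V k * r ^ k) = (\<Sum>k\<le>d'. V' k * r ^ k)"
        using nonneg r by (simp add: sum_nonneg)
      then show ?thesis
        using trunc[of d V] trunc[of d' V'] V V' by (simp add: steiner_formula_def)
    qed
    show "V' = V"
    proof
      fix k
      show "V' k = V k"
      proof (cases "k \<le> d + d'")
        case True
        then show ?thesis using polynomial_coeffs_eq[OF poly True] by simp
      next
        case False
        then show ?thesis using V V' by (simp add: steiner_formula_def)
      qed
    qed
  qed
  then have "(THE V. \<exists>d e. orthonormal_frame d e \<and> K \<subseteq> span (e ` {..<d}) \<and> steiner_formula d e K V) = V"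
    using e K V by (intro the_equality) blast+
  then show ?thesis by (simp add: fin_intrinsic_volume_def)
qed

lemma
  assumes e: "orthonormal_frame d e" and K: "compact K" "convex K" "K \<noteq> {}" "K \<subseteq> span (e ` {..<d})"
  shows fin_intrinsic_volume_nonneg: "0 \<le> fin_intrinsic_volume k K"
    and fin_intrinsic_volume_eq_0: "d < k \<Longrightarrow> fin_intrinsic_volume k K = 0"
    and wills_eq_intrinsic_volumes: "0 < r \<Longrightarrow>
      wills d e ((*\<^sub>R) r ` K) = ennreal (\<Sum>k\<le>d. fin_intrinsic_volume k K * r ^ k)"
proof -
  obtain V where V: "steiner_formula d e K V" "\<And>k. 0 \<le> V k" using steiner_formula_exists[OF e K] by blast
  note eq = fin_intrinsic_volume_eq[OF e K V(1)]
  show "0 \<le> fin_intrinsic_volume k K" using V by (simp add: eq)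
  show "d < k \<Longrightarrow> fin_intrinsic_volume k K = 0" using V by (simp add: eq steiner_formula_def)
  show "0 < r \<Longrightarrow> wills d e ((*\<^sub>R) r ` K) = ennreal (\<Sum>k\<le>d. fin_intrinsic_volume k K * r ^ k)"
    unfolding eq using wills_eq_steiner_polynomial[OF e K(1,3,4) V] by blast
qed

lemma fin_dim_convex_body_frame:
  fixes K :: "'a::real_inner set"
  assumes "fin_dim_convex_body K"
  obtains d and e :: "nat \<Rightarrow> 'a" where "orthonormal_frame d e" "K \<subseteq> span (e ` {..<d})"
proof -
  obtain B where B: "finite B" "K \<subseteq> span B" using assms by (auto simp: fin_dim_convex_body_def)
  have "orthonormal_frame 0 (\<lambda>_. 0 :: 'a)" by (simp add: orthonormal_frame_def)
  then obtain d e where "orthonormal_frame d e" "span (e ` {..<d}) = span (B \<union> (\<lambda>_. 0 :: 'a) ` {..<0::nat})"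
    using extend_frame[OF B(1)] by metis
  then show ?thesis using that B by auto
qed

subsection \<open>A Prekopa-Leindler inequality for midpoints\<close>

lemma emeasure_lborel_affine_vimage:
  fixes c t :: real
  assumes "c \<noteq> 0" and [measurable]: "D \<in> sets borel"
  shows "emeasure lborel D = ennreal \<bar>c\<bar> * emeasure lborel {x. t + c * x \<in> D}"
proof -
  have m: "{x. t + c * x \<in> D} \<in> sets borel" by measurable
  have "emeasure lborel D = ennreal \<bar>c\<bar> * (\<integral>\<^sup>+x. indicator D (t + c * x) \<partial>lborel)"
    using nn_integral_real_affine[of "indicator D" c t] assms by simp
  also have "(\<integral>\<^sup>+x. indicator D (t + c * x) \<partial>lborel) = (\<integral>\<^sup>+x. indicator {x. t + c * x \<in> D} x \<partial>lborel)"
    by (simp add: indicator_def)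
  also have "\<dots> = emeasure lborel {x. t + c * x \<in> D}"
    using m by simp
  finally show ?thesis .
qed

text \<open>Cutting \<open>A\<close> off at or below its own elements exhausts it except possibly
  for its supremum, and a point is null.\<close>

lemma emeasure_le_from_initial_parts:
  fixes A :: "real set"
  assumes A [measurable]: "A \<in> sets borel" and ne: "A \<noteq> {}"
    and le: "\<And>a. a \<in> A \<Longrightarrow> emeasure lborel (A \<inter> {..a}) + y \<le> X"
  shows "emeasure lborel A + y \<le> X"
proof -
  have "\<exists>c s. incseq c \<and> (\<forall>n::nat. \<exists>a\<in>A. c n \<le> a) \<and> A - {s} \<subseteq> (\<Union>n. {..c n})"
  proof (cases "bdd_above A")
    case True
    have "\<exists>a\<in>A. Sup A - 1 / (real n + 1) \<le> a" for n
      using less_cSup_iff[OF ne True, of "Sup A - 1 / (real n + 1)"] by (auto intro: less_imp_le)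
    moreover have "incseq (\<lambda>n. Sup A - 1 / (real n + 1))"
      by (auto simp: incseq_def intro!: divide_left_mono)
    moreover have "A - {Sup A} \<subseteq> (\<Union>n. {..Sup A - 1 / (real n + 1)})"
    proof
      fix x assume x: "x \<in> A - {Sup A}"
      then have "0 < Sup A - x" using cSup_upper[OF _ True, of x] by auto
      then obtain n where "inverse (real (Suc n)) < Sup A - x" using reals_Archimedean by blast
      then have "x \<le> Sup A - 1 / (real n + 1)" by (simp add: divide_inverse add.commute)
      then show "x \<in> (\<Union>n. {..Sup A - 1 / (real n + 1)})" by blast
    qed
    ultimately show ?thesis by blast
  next
    case False
    then have "\<exists>a\<in>A. real n \<le> a" for n by (meson bdd_aboveI2 bdd_above.I linear)
    moreover have "incseq real" by (simp add: incseq_def)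
    moreover have "A - {0} \<subseteq> (\<Union>n. {..real n})" using real_arch_simple by auto
    ultimately show ?thesis by blast
  qed
  then obtain c s where c: "incseq c" "\<And>n::nat. \<exists>a\<in>A. c n \<le> a" "A - {s} \<subseteq> (\<Union>n. {..c n})" by blast
  have [measurable]: "A \<inter> {..c n} \<in> sets borel" for n by simp
  have "emeasure lborel A \<le> emeasure lborel ((\<Union>n. A \<inter> {..c n}) \<union> {s})"
    using c(3) by (intro emeasure_mono) auto
  also have "\<dots> \<le> emeasure lborel (\<Union>n. A \<inter> {..c n}) + emeasure lborel {s}"
    by (intro emeasure_subadditive) auto
  also have "\<dots> = emeasure lborel (\<Union>n. A \<inter> {..c n})" by simp
  also have "\<dots> = (SUP n. emeasure lborel (A \<inter> {..c n}))"
    using c(1) by (intro SUP_emeasure_incseq[symmetric]) (auto simp: incseq_def intro: order.trans)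
  finally have "emeasure lborel A + y \<le> (SUP n. emeasure lborel (A \<inter> {..c n}) + y)"
    by (simp add: ennreal_SUP_add_left add_right_mono)
  also have "\<dots> \<le> X"
  proof (rule SUP_least)
    fix n
    obtain a where a: "a \<in> A" "c n \<le> a" using c(2) by blast
    have "emeasure lborel (A \<inter> {..c n}) \<le> emeasure lborel (A \<inter> {..a})"
      using a by (intro emeasure_mono) auto
    then show "emeasure lborel (A \<inter> {..c n}) + y \<le> X" using le[OF a(1)] by (meson add_right_mono order.trans)
  qed
  finally show ?thesis .
qed

text \<open>The part of \<open>A\<close> below \<open>a\<close> paired with \<open>b\<close>, and
  the part of \<open>B\<close> above \<open>b\<close> paired with \<open>a\<close>, have midpoints
  in \<open>C\<close> on opposite sides of the midpoint of \<open>a\<close> and \<open>b\<close>. So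
  their measures add up; then \<open>a\<close> moves to the top of \<open>A\<close> and
  \<open>b\<close> to the bottom of \<open>B\<close>. Letting \<open>C\<close> be any Borel set that
  contains the midpoints avoids measurability of the set of midpoints.\<close>

lemma brunn_minkowski_real_line:
  fixes A B C :: "real set"
  assumes [measurable]: "A \<in> sets borel" "B \<in> sets borel" "C \<in> sets borel" and ne: "A \<noteq> {}" "B \<noteq> {}"
    and sub: "\<And>a b. a \<in> A \<Longrightarrow> b \<in> B \<Longrightarrow> (a + b) / 2 \<in> C"
  shows "emeasure lborel A + emeasure lborel B \<le> 2 * emeasure lborel C"
proof -
  have half: "2 * emeasure lborel D = emeasure lborel {x. (x + t) / 2 \<in> D}" if "D \<in> sets borel" for D and t :: real
  proof -
    have "emeasure lborel D = ennreal (1 / 2) * emeasure lborel {x. t / 2 + (1 / 2) * x \<in> D}"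
      using emeasure_lborel_affine_vimage[of "1/2" D "t/2"] that by simp
    then have "2 * emeasure lborel D = ennreal 2 * ennreal (1 / 2) * emeasure lborel {x. t / 2 + (1 / 2) * x \<in> D}"
      by (simp add: mult.assoc)
    also have "ennreal 2 * ennreal (1 / 2) = 1" by (subst ennreal_mult[symmetric]) auto
    finally show ?thesis by (simp add: add_divide_distrib add.commute)
  qed
  have neg: "emeasure lborel {x. - x \<in> D} = emeasure lborel D" if "D \<in> sets borel" for D :: "real set"
    using emeasure_lborel_affine_vimage[of "- 1" D 0] that by simp
  have 1: "emeasure lborel (A \<inter> {..a}) + emeasure lborel (B \<inter> {b..}) \<le> 2 * emeasure lborel C"
    if ab: "a \<in> A" "b \<in> B" for a b
  proof -
    let ?m = "(a + b) / 2"
    have "emeasure lborel (A \<inter> {..a}) \<le> emeasure lborel {x. (x + b) / 2 \<in> C \<inter> {..?m}}"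
      using sub ab by (intro emeasure_mono) auto
    moreover have "emeasure lborel (B \<inter> {b..}) \<le> emeasure lborel {x. (x + a) / 2 \<in> C \<inter> {?m..}}"
      using sub[of a] ab by (intro emeasure_mono) (auto simp: add.commute[of _ a])
    ultimately have "emeasure lborel (A \<inter> {..a}) + emeasure lborel (B \<inter> {b..}) \<le>
        2 * emeasure lborel (C \<inter> {..?m}) + 2 * emeasure lborel (C \<inter> {?m..})"
      using half[of "C \<inter> {..?m}" b] half[of "C \<inter> {?m..}" a] by (simp add: add_mono)
    also have "emeasure lborel (C \<inter> {?m..}) \<le> emeasure lborel ((C \<inter> {?m<..}) \<union> {?m})"
      by (intro emeasure_mono) auto
    also have "\<dots> \<le> emeasure lborel (C \<inter> {?m<..}) + emeasure lborel {?m}"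
      by (intro emeasure_subadditive) auto
    also have "\<dots> = emeasure lborel (C \<inter> {?m<..})" by simp
    also have "2 * emeasure lborel (C \<inter> {..?m}) + 2 * emeasure lborel (C \<inter> {?m<..}) =
        2 * (emeasure lborel (C \<inter> {..?m}) + emeasure lborel (C \<inter> {?m<..}))" by (simp add: distrib_left)
    also have "emeasure lborel (C \<inter> {..?m}) + emeasure lborel (C \<inter> {?m<..}) =
        emeasure lborel ((C \<inter> {..?m}) \<union> (C \<inter> {?m<..}))" by (intro plus_emeasure) auto
    also have "(C \<inter> {..?m}) \<union> (C \<inter> {?m<..}) = C" by auto
    finally show ?thesis by (simp add: add_left_mono mult_left_mono)
  qed
  have 2: "emeasure lborel A + emeasure lborel (B \<inter> {b..}) \<le> 2 * emeasure lborel C" if "b \<in> B" for b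
    by (rule emeasure_le_from_initial_parts[OF assms(1) ne(1) 1[OF _ that]])
  \<comment> \<open>Upper parts of \<open>B\<close> are lower parts of its mirror image, so the same
    exhaustion applies.\<close>
  have m: "{x. - x \<in> B} \<in> sets borel" by measurable
  have "emeasure lborel {x. - x \<in> B} + emeasure lborel A \<le> 2 * emeasure lborel C"
  proof (rule emeasure_le_from_initial_parts[OF m])
    show "{x. - x \<in> B} \<noteq> {}" using ne(2) by (metis (mono_tags, lifting) Collect_empty_eq ex_in_conv minus_minus)
    fix b assume "b \<in> {x. - x \<in> B}"
    then have "emeasure lborel A + emeasure lborel (B \<inter> {- b..}) \<le> 2 * emeasure lborel C" by (intro 2) simp
    moreover have "{x. - x \<in> B \<inter> {- b..}} = {x. - x \<in> B} \<inter> {..b}" by auto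
    ultimately show "emeasure lborel ({x. - x \<in> B} \<inter> {..b}) + emeasure lborel A \<le> 2 * emeasure lborel C"
      using neg[of "B \<inter> {- b..}"] by (simp add: add.commute)
  qed
  then show ?thesis using neg[of B] by (simp add: add.commute)
qed

text \<open>The free factor \<open>c\<close> rescales the levels, so that functions with different
  suprema can be compared at the same \<open>t\<close>.\<close>

lemma nn_integral_layer_cake:
  fixes f :: "real \<Rightarrow> ennreal"
  assumes [measurable]: "f \<in> borel_measurable borel" and c: "0 < c"
  shows "(\<integral>\<^sup>+x. f x \<partial>lborel) = ennreal c *
    (\<integral>\<^sup>+t. indicator {0<..} t * emeasure lborel {x. ennreal (c * t) < f x} \<partial>lborel)"
proof -
  let ?i = "\<lambda>x t. indicator {p. 0 < snd p \<and> ennreal (c * snd p) < f (fst p)} (x, t) :: ennreal"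
  have len: "f x = ennreal c * emeasure lborel {t. 0 < t \<and> ennreal (c * t) < f x}" for x
  proof (cases "f x")
    case (real r)
    have "{t. 0 < t \<and> ennreal (c * t) < f x} = {0<..<r / c}"
      using c real by (auto simp: ennreal_less_iff field_simps)
    then show ?thesis using real c by (simp add: ennreal_mult[symmetric])
  next
    case top
    have "{t::real. 0 < t \<and> ennreal (c * t) < f x} = {0<..}" using top by auto
    moreover have "emeasure lborel {0::real<..} = \<infinity>"
    proof (rule ccontr)
      assume "emeasure lborel {0::real<..} \<noteq> \<infinity>"
      then obtain r where r: "0 \<le> r" "emeasure lborel {0::real<..} = ennreal r"
        by (cases "emeasure lborel {0::real<..}") auto
      have "emeasure lborel {0<..<r + 1} \<le> emeasure lborel {0::real<..}" by (intro emeasure_mono) auto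
      then show False using r by simp
    qed
    ultimately show ?thesis using top c by (simp add: ennreal_mult_top)
  qed
  have "(\<integral>\<^sup>+x. f x \<partial>lborel) = (\<integral>\<^sup>+x. ennreal c * (\<integral>\<^sup>+t. ?i x t \<partial>lborel) \<partial>lborel)"
  proof (rule nn_integral_cong)
    fix x
    have "{t. 0 < t \<and> ennreal (c * t) < f x} \<in> sets lborel" by measurable
    then have "emeasure lborel {t. 0 < t \<and> ennreal (c * t) < f x} = (\<integral>\<^sup>+t. indicator {t. 0 < t \<and> ennreal (c * t) < f x} t \<partial>lborel)"
      by simp
    then show "f x = ennreal c * (\<integral>\<^sup>+t. ?i x t \<partial>lborel)"
      using len[of x] by (simp add: indicator_def)
  qed
  also have "\<dots> = ennreal c * (\<integral>\<^sup>+x. (\<integral>\<^sup>+t. ?i x t \<partial>lborel) \<partial>lborel)"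
    by (rule nn_integral_cmult) measurable
  also have "(\<integral>\<^sup>+x. (\<integral>\<^sup>+t. ?i x t \<partial>lborel) \<partial>lborel) =
      (\<integral>\<^sup>+t. (\<integral>\<^sup>+x. ?i x t \<partial>lborel) \<partial>lborel)"
    by (rule lborel_pair.Fubini'[symmetric]) measurable
  also have "\<dots> = (\<integral>\<^sup>+t. indicator {0<..} t * emeasure lborel {x. ennreal (c * t) < f x} \<partial>lborel)"
  proof (rule nn_integral_cong)
    fix t :: real
    have "{x. ennreal (c * t) < f x} \<in> sets lborel" by measurable
    then have "emeasure lborel {x. ennreal (c * t) < f x} = (\<integral>\<^sup>+x. indicator {x. ennreal (c * t) < f x} x \<partial>lborel)"
      by simp
    then show "(\<integral>\<^sup>+x. ?i x t \<partial>lborel) =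
        indicator {0<..} t * emeasure lborel {x. ennreal (c * t) < f x}"
      by (simp add: indicator_def)
  qed
  finally show ?thesis .
qed

text \<open>Levels are taken relative to the suprema. Then for \<open>t < 1\<close> both superlevel
  sets are nonempty, as the inequality for sets on the line requires, and from 1 on both are empty.
  This bounds the sum of the two normalized integrals, and the inequality between arithmetic and
  geometric mean bounds their product.\<close>

lemma prekopa_leindler_bounded:
  fixes f g h :: "real \<Rightarrow> ennreal"
  assumes [measurable]: "f \<in> borel_measurable borel" "g \<in> borel_measurable borel" "h \<in> borel_measurable borel"
    and fgh: "\<And>x y. f x * g y \<le> (h ((x + y) / 2))\<^sup>2"
    and bdd: "(SUP x. f x) < \<infinity>" "(SUP x. g x) < \<infinity>"
  shows "(\<integral>\<^sup>+x. f x \<partial>lborel) * (\<integral>\<^sup>+x. g x \<partial>lborel) \<le> (\<integral>\<^sup>+x. h x \<partial>lborel)\<^sup>2"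
proof -
  obtain a where a: "(SUP x. f x) = ennreal a" "0 \<le> a" using bdd(1) by (cases "SUP x. f x") auto
  obtain b where b: "(SUP x. g x) = ennreal b" "0 \<le> b" using bdd(2) by (cases "SUP x. g x") auto
  have fa: "f x \<le> ennreal a" for x unfolding a(1)[symmetric] by (rule SUP_upper) simp
  have gb: "g x \<le> ennreal b" for x unfolding b(1)[symmetric] by (rule SUP_upper) simp
  show ?thesis
  proof (cases "a = 0 \<or> b = 0 \<or> (\<integral>\<^sup>+x. h x \<partial>lborel) = \<infinity>")
    case True
    have "f = (\<lambda>_. 0)" if "a = 0" using fa that by auto
    moreover have "g = (\<lambda>_. 0)" if "b = 0" using gb that by auto
    ultimately show ?thesis using True by (auto simp: power2_eq_square ennreal_top_mult)
  next
    case False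
    then have ab: "0 < a" "0 < b" using a b by auto
    \<comment> \<open>The level scale for \<open>h\<close> is the geometric mean of the two suprema,
      because the square of \<open>h\<close> dominates the product.\<close>
    define q where "q = sqrt (a * b)"
    have q: "0 < q" "q\<^sup>2 = a * b" using ab by (auto simp: q_def)
    define F where "F t = emeasure lborel {x. ennreal (a * t) < f x}" for t
    define G where "G t = emeasure lborel {x. ennreal (b * t) < g x}" for t
    define H where "H t = emeasure lborel {x. ennreal (q * t) < h x}" for t
    have level_meas: "(\<lambda>t. emeasure lborel {x. ennreal (c * t) < u x}) \<in> borel_measurable borel"
      if [measurable]: "u \<in> borel_measurable borel" for u :: "real \<Rightarrow> ennreal" and c
    proof -
      have "{x. ennreal (c * t) < u x} = Pair t -` {p. ennreal (c * fst p) < u (snd p)}" for t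
        by auto
      moreover have "{p \<in> space (borel \<Otimes>\<^sub>M lborel). ennreal (c * fst p) < u (snd p)} \<in> sets (borel \<Otimes>\<^sub>M lborel)"
        by measurable
      ultimately show ?thesis
        using lborel.measurable_emeasure_Pair[of _ "borel :: real measure"] by (simp add: space_pair_measure)
    qed
    have [measurable]: "F \<in> borel_measurable borel" "G \<in> borel_measurable borel" "H \<in> borel_measurable borel"
      unfolding F_def G_def H_def by (auto intro: level_meas)
    have FGH: "F t + G t \<le> 2 * H t" if t: "0 < t" "t < 1" for t
      unfolding F_def G_def H_def
    proof (rule brunn_minkowski_real_line)
      have "ennreal (a * t) < (SUP x. f x)" unfolding a(1) using t ab by (auto simp: ennreal_less_iff)
      then show "{x. ennreal (a * t) < f x} \<noteq> {}" by (auto simp: less_SUP_iff)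
      have "ennreal (b * t) < (SUP x. g x)" unfolding b(1) using t ab by (auto simp: ennreal_less_iff)
      then show "{x. ennreal (b * t) < g x} \<noteq> {}" by (auto simp: less_SUP_iff)
      fix x y assume "x \<in> {x. ennreal (a * t) < f x}" "y \<in> {x. ennreal (b * t) < g x}"
      then have xy: "ennreal (a * t) < f x" "ennreal (b * t) < g y" by auto
      have "ennreal (a * t) * ennreal (b * t) < f x * ennreal (b * t)"
        using xy(1) ab t by (intro ennreal_mult_strict_right_mono) auto
      also have "\<dots> \<le> f x * g y" using xy(2) by (intro mult_left_mono) auto
      also have "\<dots> \<le> (h ((x + y) / 2))\<^sup>2" by (rule fgh)
      also have "ennreal (a * t) * ennreal (b * t) = (ennreal (q * t))\<^sup>2"
        using ab t q by (simp add: ennreal_mult[symmetric] ennreal_power power_mult_distrib power2_eq_square[of t] mult_ac)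
      finally show "(x + y) / 2 \<in> {x. ennreal (q * t) < h x}"
        by (metis (mono_tags, lifting) mem_Collect_eq not_less power_mono zero_le)
    qed measurable
    have zero: "F t = 0" "G t = 0" if "1 \<le> t" for t
    proof -
      have "ennreal a \<le> ennreal (a * t)" "ennreal b \<le> ennreal (b * t)" using ab that by (auto intro!: ennreal_leI)
      then have "{x. ennreal (a * t) < f x} = {}" "{x. ennreal (b * t) < g x} = {}"
        using fa gb by (auto simp: not_less intro: order.trans)
      then show "F t = 0" "G t = 0" by (simp_all add: F_def G_def)
    qed
    have lf: "(\<integral>\<^sup>+x. f x \<partial>lborel) = ennreal a * (\<integral>\<^sup>+t. indicator {0<..} t * F t \<partial>lborel)"
      unfolding F_def using ab by (intro nn_integral_layer_cake) auto
    have lg: "(\<integral>\<^sup>+x. g x \<partial>lborel) = ennreal b * (\<integral>\<^sup>+t. indicator {0<..} t * G t \<partial>lborel)"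
      unfolding G_def using ab by (intro nn_integral_layer_cake) auto
    have lh: "(\<integral>\<^sup>+x. h x \<partial>lborel) = ennreal q * (\<integral>\<^sup>+t. indicator {0<..} t * H t \<partial>lborel)"
      unfolding H_def using q by (intro nn_integral_layer_cake) auto
    define f1 where "f1 = (\<integral>\<^sup>+t. indicator {0<..} t * F t \<partial>lborel)"
    define g1 where "g1 = (\<integral>\<^sup>+t. indicator {0<..} t * G t \<partial>lborel)"
    define h1 where "h1 = (\<integral>\<^sup>+t. indicator {0<..} t * H t \<partial>lborel)"
    have "f1 + g1 = (\<integral>\<^sup>+t. indicator {0<..} t * F t + indicator {0<..} t * G t \<partial>lborel)"
      unfolding f1_def g1_def by (rule nn_integral_add[symmetric]) measurable
    also have "\<dots> \<le> (\<integral>\<^sup>+t. 2 * (indicator {0<..} t * H t) \<partial>lborel)"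
    proof (rule nn_integral_mono)
      fix t
      show "indicator {0<..} t * F t + indicator {0<..} t * G t \<le> 2 * (indicator {0<..} t * H t)"
        using FGH[of t] zero[of t] by (cases "t < 1") (auto simp: indicator_def)
    qed
    also have "\<dots> = 2 * h1" unfolding h1_def by (rule nn_integral_cmult) measurable
    finally have sum: "f1 + g1 \<le> 2 * h1" .
    have "h1 \<noteq> \<infinity>" using False lh q unfolding h1_def[symmetric] by (auto simp: ennreal_mult_top)
    then obtain h2 where h2: "h1 = ennreal h2" "0 \<le> h2" by (cases h1) auto
    have "f1 + g1 \<le> ennreal (2 * h2)" using sum h2 by (simp add: ennreal_mult)
    then have "f1 \<noteq> \<infinity>" "g1 \<noteq> \<infinity>" by (auto simp: top_unique)
    then obtain f2 g2 where fg2: "f1 = ennreal f2" "0 \<le> f2" "g1 = ennreal g2" "0 \<le> g2" by (cases f1; cases g1) auto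
    have "f2 + g2 \<le> 2 * h2"
      using \<open>f1 + g1 \<le> ennreal (2 * h2)\<close> fg2 h2 by (simp add: ennreal_plus[symmetric] del: ennreal_plus)
    then have "(f2 + g2)\<^sup>2 \<le> (2 * h2)\<^sup>2" using fg2 by (intro power_mono) auto
    moreover have "0 \<le> (f2 - g2)\<^sup>2" by simp
    ultimately have "f2 * g2 \<le> h2\<^sup>2" by (simp add: power2_eq_square algebra_simps)
    then have "(a * b) * (f2 * g2) \<le> (a * b) * h2\<^sup>2" using ab by (intro mult_left_mono) auto
    then have "a * f2 * (b * g2) \<le> (q * h2)\<^sup>2" by (simp add: power_mult_distrib q mult_ac)
    then show ?thesis
      unfolding lf lg lh f1_def[symmetric] g1_def[symmetric] h1_def[symmetric] fg2 h2
      using ab fg2 h2 q by (simp add: ennreal_mult[symmetric] ennreal_power)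
  qed
qed

text \<open>Truncating \<open>f\<close> and \<open>g\<close> preserves the hypothesis with the same
  \<open>h\<close>, and monotone convergence removes the two truncations independently.\<close>

lemma prekopa_leindler_real_line:
  fixes f g h :: "real \<Rightarrow> ennreal"
  assumes [measurable]: "f \<in> borel_measurable borel" "g \<in> borel_measurable borel" "h \<in> borel_measurable borel"
    and fgh: "\<And>x y. f x * g y \<le> (h ((x + y) / 2))\<^sup>2"
  shows "(\<integral>\<^sup>+x. f x \<partial>lborel) * (\<integral>\<^sup>+x. g x \<partial>lborel) \<le> (\<integral>\<^sup>+x. h x \<partial>lborel)\<^sup>2"
proof -
  have trunc: "(\<integral>\<^sup>+x. u x \<partial>lborel) = (SUP n. \<integral>\<^sup>+x. min (u x) (of_nat n) \<partial>lborel)"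
    if [measurable]: "u \<in> borel_measurable borel" for u :: "real \<Rightarrow> ennreal"
  proof -
    have "u x = (SUP n. min (u x) (of_nat n))" for x
    proof -
      have "u x = inf (u x) (SUP n. of_nat n)" by (simp add: ennreal_SUP_of_nat_eq_top)
      also have "\<dots> = (SUP n. inf (u x) (of_nat n))" by (rule inf_SUP)
      finally show ?thesis by (simp only: inf_min)
    qed
    then have "(\<integral>\<^sup>+x. u x \<partial>lborel) = (\<integral>\<^sup>+x. (SUP n. min (u x) (of_nat n)) \<partial>lborel)" by simp
    also have "\<dots> = (SUP n. \<integral>\<^sup>+x. min (u x) (of_nat n) \<partial>lborel)"
      by (rule nn_integral_monotone_convergence_SUP)
        (auto simp: incseq_def le_fun_def intro: min.coboundedI2 simp del: min_less_iff_conj)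
    finally show ?thesis .
  qed
  have "(\<integral>\<^sup>+x. min (f x) (of_nat n) \<partial>lborel) * (\<integral>\<^sup>+x. min (g x) (of_nat m) \<partial>lborel) \<le> (\<integral>\<^sup>+x. h x \<partial>lborel)\<^sup>2" for n m
  proof (rule prekopa_leindler_bounded)
    show "min (f x) (of_nat n) * min (g y) (of_nat m) \<le> (h ((x + y) / 2))\<^sup>2" for x y
      using fgh[of x y] by (meson min.cobounded1 mult_mono order.trans zero_le)
    show "(SUP x. min (f x) (of_nat n)) < \<infinity>" "(SUP x. min (g x) (of_nat m)) < \<infinity>"
      by (auto intro!: le_less_trans[OF SUP_least[OF min.cobounded2]] simp: of_nat_less_top)
  qed measurable
  then show ?thesis
    unfolding trunc[OF assms(1)] trunc[OF assms(2)] SUP_mult_right_ennreal SUP_mult_left_ennreal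
    by (intro SUP_least)
qed

text \<open>The fibre integrals along the last vector satisfy the hypothesis again, by the
  inequality on the line.\<close>

lemma prekopa_leindler_frame:
  assumes "f \<in> borel_measurable borel" "g \<in> borel_measurable borel" "h \<in> borel_measurable borel"
    and "\<And>x y. f x * g y \<le> (h ((1 / 2) *\<^sub>R (x + y)))\<^sup>2"
  shows "(\<integral>\<^sup>+x. f x \<partial>frame_measure d e) * (\<integral>\<^sup>+x. g x \<partial>frame_measure d e) \<le> (\<integral>\<^sup>+x. h x \<partial>frame_measure d e)\<^sup>2"
  using assms
proof (induction d arbitrary: f g h)
  case 0
  then show ?case using "0.prems"(4)[of 0 0] by (simp add: nn_integral_frame_0)
next
  case (Suc d)
  note [measurable] = Suc.prems(1-3)
  show ?case
    unfolding nn_integral_frame_Suc[OF Suc.prems(1)] nn_integral_frame_Suc[OF Suc.prems(2)]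
      nn_integral_frame_Suc[OF Suc.prems(3)]
  proof (rule Suc.IH)
    fix x y
    show "(\<integral>\<^sup>+t. f (x + t *\<^sub>R e d) \<partial>lborel) * (\<integral>\<^sup>+t. g (y + t *\<^sub>R e d) \<partial>lborel) \<le>
        (\<integral>\<^sup>+t. h ((1 / 2) *\<^sub>R (x + y) + t *\<^sub>R e d) \<partial>lborel)\<^sup>2"
    proof (rule prekopa_leindler_real_line)
      fix s t :: real
      have "(1 / 2) *\<^sub>R ((x + s *\<^sub>R e d) + (y + t *\<^sub>R e d)) = (1 / 2) *\<^sub>R (x + y) + ((s + t) / 2) *\<^sub>R e d"
        by (simp add: algebra_simps add_divide_distrib)
      then show "f (x + s *\<^sub>R e d) * g (y + t *\<^sub>R e d) \<le> (h ((1 / 2) *\<^sub>R (x + y) + ((s + t) / 2) *\<^sub>R e d))\<^sup>2"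
        using Suc.prems(4)[of "x + s *\<^sub>R e d" "y + t *\<^sub>R e d"] by simp
    qed measurable
  qed measurable
qed

subsection \<open>Log-concavity of the Wills functional\<close>

text \<open>Midpoint log-concavity between the origin, whose functional is 1, and \<open>K\<close>.
  The midpoint of \<open>x\<close> and \<open>y\<close> has distance from the half-size body at most
  the mean of \<open>norm x\<close> and \<open>infdist y K\<close>, and the square of a mean is at
  most the mean of the squares.\<close>

lemma wills_le_square_half:
  fixes e :: "nat \<Rightarrow> 'a::{real_inner, second_countable_topology}"
  assumes e: "orthonormal_frame d e"
  shows "wills d e K \<le> (wills d e ((*\<^sub>R) (1 / 2) ` K))\<^sup>2"
proof -
  let ?f = "\<lambda>x. ennreal (exp (- pi * (norm x)\<^sup>2))" and ?g = "\<lambda>x. ennreal (exp (- pi * (infdist x K)\<^sup>2))"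
  let ?h = "\<lambda>x. ennreal (exp (- pi * (infdist x ((*\<^sub>R) (1 / 2) ` K))\<^sup>2))"
  have "(\<integral>\<^sup>+x. ?f x \<partial>frame_measure d e) * (\<integral>\<^sup>+x. ?g x \<partial>frame_measure d e) \<le> (\<integral>\<^sup>+x. ?h x \<partial>frame_measure d e)\<^sup>2"
  proof (rule prekopa_leindler_frame)
    fix x y :: 'a
    let ?D = "infdist ((1 / 2) *\<^sub>R (x + y)) ((*\<^sub>R) (1 / 2) ` K)"
    have "?D = (1 / 2) * infdist (x + y) K" by (rule infdist_scaleR) simp
    also have "\<dots> \<le> (1 / 2) * (infdist y K + norm x)"
      using infdist_triangle[of "x + y" K y] by (simp add: dist_norm)
    finally have "?D\<^sup>2 \<le> ((1 / 2) * (infdist y K + norm x))\<^sup>2" by (intro power_mono infdist_nonneg)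
    moreover have "0 \<le> (infdist y K - norm x)\<^sup>2" by simp
    ultimately have D: "2 * ?D\<^sup>2 \<le> (norm x)\<^sup>2 + (infdist y K)\<^sup>2"
      by (simp add: power2_eq_square algebra_simps)
    have "exp (- pi * (norm x)\<^sup>2) * exp (- pi * (infdist y K)\<^sup>2) \<le> exp (- pi * ?D\<^sup>2) * exp (- pi * ?D\<^sup>2)"
      using mult_left_mono[OF D, of pi] by (simp add: exp_add[symmetric] algebra_simps)
    then show "?f x * ?g y \<le> (?h ((1 / 2) *\<^sub>R (x + y)))\<^sup>2"
      by (simp add: power2_eq_square ennreal_mult[symmetric])
  qed simp_all
  then show ?thesis using nn_integral_frame_gaussian[OF e] by (simp add: wills_def)
qed

lemma wills_singleton_0:
  assumes "orthonormal_frame d e"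
  shows "wills d e {0} = 1"
  using nn_integral_frame_gaussian[OF assms] by (simp add: wills_def)

text \<open>A point at distance \<open>u\<close> from \<open>K'\<close> is within
  \<open>u + \<epsilon>\<close> of \<open>K\<close>. Shrinking the latter distance by
  \<open>c\<close> absorbs the cross term of its square. This amounts to passing from
  \<open>K\<close> to \<open>c K\<close>, and the change of variables costs
  \<open>c ^ d\<close>.\<close>

lemma wills_perturb:
  assumes K': "compact K'" "K' \<noteq> {}" and near: "\<And>y. y \<in> K' \<Longrightarrow> infdist y K \<le> \<epsilon>"
    and c: "0 < c" "c < 1"
  shows "wills d e K' \<le> ennreal (exp (pi * \<epsilon>\<^sup>2 / (1 - c\<^sup>2)) / c ^ d) * wills d e ((*\<^sub>R) c ` K)"
proof -
  have c2: "0 < 1 - c\<^sup>2" "c\<^sup>2 \<le> 1" using c by (simp_all add: power_less_one_iff power_le_one)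
  have ptw: "exp (- pi * (infdist x K')\<^sup>2) \<le> exp (pi * \<epsilon>\<^sup>2 / (1 - c\<^sup>2)) * exp (- pi * c\<^sup>2 * (infdist x K)\<^sup>2)" for x
  proof -
    obtain a where a: "a \<in> K'" "infdist x K' = dist x a" using infdist_attained[OF K'] .
    define u where "u = infdist x K'"
    have "infdist x K \<le> u + \<epsilon>"
      using infdist_triangle[of x K a] near[OF a(1)] a(2) by (simp add: u_def)
    then have "c\<^sup>2 * (infdist x K)\<^sup>2 \<le> c\<^sup>2 * (u + \<epsilon>)\<^sup>2"
      by (intro mult_left_mono power_mono infdist_nonneg) auto
    also have "\<dots> \<le> u\<^sup>2 + \<epsilon>\<^sup>2 / (1 - c\<^sup>2)"
    proof -
      \<comment> \<open>Young's inequality, with weights chosen such that the coefficient of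
        \<open>u\<^sup>2\<close> becomes 1 after division by \<open>1 - c\<^sup>2\<close>.\<close>
      have "0 \<le> ((1 - c\<^sup>2) * u - c\<^sup>2 * \<epsilon>)\<^sup>2" by simp
      then have "(1 - c\<^sup>2) * (c\<^sup>2 * (u + \<epsilon>)\<^sup>2) \<le> (1 - c\<^sup>2) * u\<^sup>2 + c\<^sup>2 * \<epsilon>\<^sup>2"
        by (simp add: power2_eq_square algebra_simps)
      also have "\<dots> \<le> (1 - c\<^sup>2) * u\<^sup>2 + \<epsilon>\<^sup>2" using mult_right_mono[OF c2(2), of "\<epsilon>\<^sup>2"] by simp
      also have "\<dots> = (1 - c\<^sup>2) * (u\<^sup>2 + \<epsilon>\<^sup>2 / (1 - c\<^sup>2))" using c2 by (simp add: distrib_left)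
      finally show ?thesis using c2 by simp
    qed
    finally have "pi * (c\<^sup>2 * (infdist x K)\<^sup>2) \<le> pi * (u\<^sup>2 + \<epsilon>\<^sup>2 / (1 - c\<^sup>2))" by (intro mult_left_mono) auto
    then show ?thesis by (simp add: exp_add[symmetric] u_def algebra_simps)
  qed
  have "wills d e K' \<le> (\<integral>\<^sup>+x. ennreal (exp (pi * \<epsilon>\<^sup>2 / (1 - c\<^sup>2))) * ennreal (exp (- pi * c\<^sup>2 * (infdist x K)\<^sup>2)) \<partial>frame_measure d e)"
    unfolding wills_def using ptw by (intro nn_integral_mono) (auto simp: ennreal_mult[symmetric] intro!: ennreal_leI)
  also have "\<dots> = ennreal (exp (pi * \<epsilon>\<^sup>2 / (1 - c\<^sup>2))) * (\<integral>\<^sup>+x. ennreal (exp (- pi * c\<^sup>2 * (infdist x K)\<^sup>2)) \<partial>frame_measure d e)"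
    by (rule nn_integral_cmult) simp
  also have "(\<integral>\<^sup>+x. ennreal (exp (- pi * c\<^sup>2 * (infdist x K)\<^sup>2)) \<partial>frame_measure d e) = ennreal (1 / c ^ d) * wills d e ((*\<^sub>R) c ` K)"
    unfolding wills_scale[OF c(1)] mult.assoc[symmetric] using c by (simp add: ennreal_mult[symmetric])
  also have "ennreal (exp (pi * \<epsilon>\<^sup>2 / (1 - c\<^sup>2))) * (ennreal (1 / c ^ d) * wills d e ((*\<^sub>R) c ` K)) =
      ennreal (exp (pi * \<epsilon>\<^sup>2 / (1 - c\<^sup>2)) / c ^ d) * wills d e ((*\<^sub>R) c ` K)"
    unfolding mult.assoc[symmetric] using c by (simp add: ennreal_mult[symmetric])
  finally show ?thesis .
qed

context
  fixes d :: nat and e :: "nat \<Rightarrow> 'a::{real_inner, second_countable_topology}" and K :: "'a set"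
  assumes e: "orthonormal_frame d e" and K: "compact K" "convex K" "K \<noteq> {}" "K \<subseteq> span (e ` {..<d})"
begin

private abbreviation V :: "nat \<Rightarrow> real" where "V k \<equiv> fin_intrinsic_volume k K"

text \<open>The dilates \<open>s K\<close> shrink to the origin, whose Wills functional is 1. In the
  perturbation estimate \<open>s\<close> tends to 0 first and \<open>c\<close> to 1 afterwards,
  since 1 - c^2 stands in a denominator.\<close>

lemma fin_intrinsic_volume_0_le_1: "V 0 \<le> 1"
proof -
  obtain R where R: "\<And>x. x \<in> K \<Longrightarrow> norm x \<le> R" using compact_imp_bounded[OF K(1)] by (auto simp: bounded_iff)
  define p where "p s = (\<Sum>k\<le>d. V k * s ^ k)" for s
  have pV: "(p \<longlongrightarrow> V 0) (at_right 0)"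
  proof -
    have "(p \<longlongrightarrow> p 0) (at_right 0)" unfolding p_def by (intro tendsto_intros)
    moreover have "p 0 = V 0" unfolding p_def by (subst sum.remove[of _ 0]) (auto intro!: sum.neutral)
    ultimately show ?thesis by simp
  qed
  have bound: "p s \<le> exp (pi * (s * R)\<^sup>2 / (1 - c\<^sup>2)) / c ^ d" if s: "0 < s" and c: "0 < c" "c < 1" for s c
  proof -
    have "wills d e ((*\<^sub>R) s ` K) \<le> ennreal (exp (pi * (s * R)\<^sup>2 / (1 - c\<^sup>2)) / c ^ d) * wills d e ((*\<^sub>R) c ` {0})"
    proof (rule wills_perturb)
      show "infdist y {0} \<le> s * R" if "y \<in> (*\<^sub>R) s ` K" for y
        using that R s by auto
    qed (use K c in \<open>auto intro!: compact_continuous_image continuous_intros\<close>)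
    then have "ennreal (p s) \<le> ennreal (exp (pi * (s * R)\<^sup>2 / (1 - c\<^sup>2)) / c ^ d)"
      unfolding p_def wills_eq_intrinsic_volumes[OF e K s, symmetric] by (simp add: wills_singleton_0[OF e])
    then show ?thesis using c by (simp add: ennreal_le_iff)
  qed
  have c_bound: "V 0 \<le> 1 / c ^ d" if c: "0 < c" "c < 1" for c :: real
  proof (rule tendsto_le[OF _ _ pV])
    have "((\<lambda>s. exp (pi * (s * R)\<^sup>2 / (1 - c\<^sup>2)) / c ^ d) \<longlongrightarrow> exp (pi * (0 * R)\<^sup>2 / (1 - c\<^sup>2)) / c ^ d) (at_right 0)"
      using c by (intro tendsto_intros) (auto simp: power2_eq_1_iff)
    then show "((\<lambda>s. exp (pi * (s * R)\<^sup>2 / (1 - c\<^sup>2)) / c ^ d) \<longlongrightarrow> 1 / c ^ d) (at_right 0)" by simp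
    show "\<forall>\<^sub>F s in at_right 0. p s \<le> exp (pi * (s * R)\<^sup>2 / (1 - c\<^sup>2)) / c ^ d"
      using bound c by (auto simp: eventually_at_right_field intro!: exI[of _ 1])
  qed simp
  show ?thesis
  proof (rule tendsto_lowerbound)
    show "((\<lambda>c::real. 1 / c ^ d) \<longlongrightarrow> 1) (at_left 1)"
      by (rule tendsto_eq_intros | simp)+
    show "\<forall>\<^sub>F c in at_left 1. V 0 \<le> 1 / c ^ d"
      using c_bound by (auto simp: eventually_at_left_field intro!: exI[of _ 0])
  qed simp
qed

text \<open>
  With \<open>p s = W (s K)\<close> log-concavity gives \<open>p r \<le> p (r / 2\<^sup>n) ^ 2\<^sup>n\<close>, and \<open>p s \<le> 1 + s V\<^sub>1 + O(s\<^sup>2)\<close>.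
\<close>

lemma steiner_polynomial_le_exp:
  assumes r: "0 < r"
  shows "(\<Sum>k\<le>d. V k * r ^ k) \<le> exp (r * V 1)"
proof -
  note V0 = fin_intrinsic_volume_nonneg[OF e K]
  define p where "p s = (\<Sum>k\<le>d. V k * s ^ k)" for s
  have p0: "0 \<le> p s" if "0 < s" for s unfolding p_def using V0 that by (intro sum_nonneg) auto
  have half: "p s \<le> (p (s / 2))\<^sup>2" if s: "0 < s" for s
  proof -
    have im: "(*\<^sub>R) (1 / 2) ` ((*\<^sub>R) s ` K) = (*\<^sub>R) (s / 2) ` K" by (simp add: image_image)
    have "ennreal (p s) \<le> (ennreal (p (s / 2)))\<^sup>2"
      unfolding p_def using wills_le_square_half[OF e, of "(*\<^sub>R) s ` K"]
        wills_eq_intrinsic_volumes[OF e K s] wills_eq_intrinsic_volumes[OF e K, of "s / 2"] s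
      unfolding im by simp
    then show ?thesis using p0[of "s / 2"] s by (simp add: ennreal_power)
  qed
  have iter: "p r \<le> (p (r / 2 ^ n)) ^ (2 ^ n)" for n
  proof (induction n)
    case (Suc n)
    have "p (r / 2 ^ n) ^ (2 ^ n) \<le> ((p (r / 2 ^ Suc n))\<^sup>2) ^ (2 ^ n)"
      using half[of "r / 2 ^ n"] p0[of "r / 2 ^ n"] r by (intro power_mono) (auto simp: mult.commute)
    then show ?case using Suc by (simp add: power_mult[symmetric])
  qed simp
  \<comment> \<open>Bounds the second-order remainder for all \<open>s\<close> up to
    \<open>r\<close>. The sum reaches index \<open>d + 2\<close>, where the volumes are already 0,
    so that the polynomial splits evenly.\<close>
  define C where "C = (\<Sum>k\<le>d. V (k + 2) * r ^ k)"
  have small: "p s \<le> exp (s * V 1 + s\<^sup>2 * C)" if s: "0 < s" "s \<le> r" for s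
  proof -
    have "p s = (\<Sum>k\<le>Suc (Suc d). V k * s ^ k)"
      unfolding p_def using fin_intrinsic_volume_eq_0[OF e K] by simp
    also have "\<dots> = V 0 + s * V 1 + (\<Sum>k\<le>d. V (k + 2) * s ^ (k + 2))"
      by (simp add: sum.atMost_Suc_shift mult.commute del: sum.atMost_Suc)
    also have "(\<Sum>k\<le>d. V (k + 2) * s ^ (k + 2)) = s\<^sup>2 * (\<Sum>k\<le>d. V (k + 2) * s ^ k)"
      unfolding sum_distrib_left by (simp add: power2_eq_square mult_ac)
    also have "(\<Sum>k\<le>d. V (k + 2) * s ^ k) \<le> C"
      unfolding C_def using V0 s by (intro sum_mono mult_left_mono power_mono) auto
    finally have "p s \<le> 1 + (s * V 1 + s\<^sup>2 * C)" using fin_intrinsic_volume_0_le_1 s by (simp add: mult_left_mono)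
    then show ?thesis using exp_ge_add_one_self[of "s * V 1 + s\<^sup>2 * C"] by linarith
  qed
  \<comment> \<open>The power 2^n restores the first-order term to \<open>r * V 1\<close>; the
    remainder had been divided by 4^n, so a factor 2^(-n) survives.\<close>
  have bound: "p r \<le> exp (r * V 1 + r\<^sup>2 * C * (1 / 2) ^ n)" for n
  proof -
    have "p r \<le> (p (r / 2 ^ n)) ^ (2 ^ n)" by (rule iter)
    also have "\<dots> \<le> (exp (r / 2 ^ n * V 1 + (r / 2 ^ n)\<^sup>2 * C)) ^ (2 ^ n)"
      using r by (intro power_mono small p0) (auto simp: divide_le_eq mult_le_cancel_left1)
    also have "\<dots> = exp (r * V 1 + r\<^sup>2 * C * (1 / 2) ^ n)"
      by (simp add: exp_of_nat_mult[symmetric] field_simps power2_eq_square)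
    finally show ?thesis .
  qed
  have "p r \<le> exp (r * V 1 + r\<^sup>2 * C * 0)"
  proof (rule tendsto_lowerbound)
    have lim: "(\<lambda>n. (1 / 2 :: real) ^ n) \<longlonglongrightarrow> 0" by (rule LIMSEQ_power_zero) simp
    show "(\<lambda>n. exp (r * V 1 + r\<^sup>2 * C * (1 / 2) ^ n)) \<longlonglongrightarrow> exp (r * V 1 + r\<^sup>2 * C * 0)"
      by (intro tendsto_exp tendsto_add tendsto_mult tendsto_const lim)
  qed (use bound in auto)
  then show ?thesis by (simp add: p_def)
qed

text \<open>In a sum of nonnegative terms each one is at most the total. The bound on a single term
  is what passes to suprema over subbodies.\<close>

lemma intrinsic_volume_term_le_wills:
  assumes r: "0 < r" and B: "wills d e ((*\<^sub>R) r ` K) \<le> ennreal B" "0 \<le> B"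
  shows "V k * r ^ k \<le> B"
proof (cases "k \<le> d")
  case True
  have "V k * r ^ k \<le> (\<Sum>k\<le>d. V k * r ^ k)"
    using True r fin_intrinsic_volume_nonneg[OF e K] by (intro member_le_sum) auto
  also have "\<dots> \<le> B" using B unfolding wills_eq_intrinsic_volumes[OF e K r] by (simp add: ennreal_le_iff)
  finally show ?thesis .
next
  case False
  then show ?thesis using fin_intrinsic_volume_eq_0[OF e K] B by simp
qed

end

lemma fin_intrinsic_volume_le_exp:
  fixes K :: "'a::{real_inner, second_countable_topology} set"
  assumes "fin_dim_convex_body K" "0 < r"
  shows "fin_intrinsic_volume k K * r ^ k \<le> exp (r * fin_intrinsic_volume 1 K)"
proof -
  obtain d and e :: "nat \<Rightarrow> 'a" where e: "orthonormal_frame d e" "K \<subseteq> span (e ` {..<d})"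
    using fin_dim_convex_body_frame[OF assms(1)] .
  have K: "compact K" "convex K" "K \<noteq> {}" using assms(1) by (auto simp: fin_dim_convex_body_def)
  show ?thesis
    using steiner_polynomial_le_exp[OF e(1) K e(2) assms(2)]
    by (intro intrinsic_volume_term_le_wills[OF e(1) K e(2) assms(2)])
      (auto simp: wills_eq_intrinsic_volumes[OF e(1) K e(2) assms(2)] intro!: ennreal_leI)
qed

subsection \<open>Growth of the Steiner function\<close>

lemma fin_dim_convex_body_nonneg:
  fixes K :: "'a::{real_inner, second_countable_topology} set"
  assumes "fin_dim_convex_body K"
  shows "0 \<le> fin_intrinsic_volume k K"
proof -
  obtain d and e :: "nat \<Rightarrow> 'a" where e: "orthonormal_frame d e" "K \<subseteq> span (e ` {..<d})"
    using fin_dim_convex_body_frame[OF assms(1)] .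
  then show ?thesis using fin_intrinsic_volume_nonneg[OF e(1)] assms by (auto simp: fin_dim_convex_body_def)
qed

lemma intrinsic_volume_nonneg:
  fixes K :: "'a::{real_inner, second_countable_topology} set"
  assumes "K \<noteq> {}"
  shows "0 \<le> intrinsic_volume k K"
proof -
  obtain x where "x \<in> K" using assms by auto
  have "fin_dim_convex_body {x}"
    unfolding fin_dim_convex_body_def by (auto intro!: exI[of _ "{x}"] span_base)
  then have "ereal (fin_intrinsic_volume k {x}) \<le> intrinsic_volume k K" "0 \<le> fin_intrinsic_volume k {x}"
    unfolding intrinsic_volume_def using \<open>x \<in> K\<close> fin_dim_convex_body_nonneg by (auto intro!: SUP_upper)
  then show ?thesis by (meson ereal_less_eq(5) order.trans)
qed

lemma fin_le_intrinsic_volume: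
  assumes "fin_dim_convex_body K'" "K' \<subseteq> K"
  shows "ereal (fin_intrinsic_volume k K') \<le> intrinsic_volume k K"
  unfolding intrinsic_volume_def using assms by (auto intro!: SUP_upper)

lemma intrinsic_volume_bounded:
  fixes K :: "'a::{real_inner, second_countable_topology} set"
  assumes "K \<noteq> {}" "\<And>K'. fin_dim_convex_body K' \<Longrightarrow> K' \<subseteq> K \<Longrightarrow> fin_intrinsic_volume k K' \<le> B"
  shows "intrinsic_volume k K = ereal (real_of_ereal (intrinsic_volume k K))"
    and "0 \<le> real_of_ereal (intrinsic_volume k K)" and "real_of_ereal (intrinsic_volume k K) \<le> B"
proof -
  have "intrinsic_volume k K \<le> ereal B"
    unfolding intrinsic_volume_def using assms(2) by (auto intro!: SUP_least)
  with intrinsic_volume_nonneg[OF assms(1), of k]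
  show "intrinsic_volume k K = ereal (real_of_ereal (intrinsic_volume k K))"
    "0 \<le> real_of_ereal (intrinsic_volume k K)" "real_of_ereal (intrinsic_volume k K) \<le> B"
    by (cases "intrinsic_volume k K"; simp)+
qed

text \<open>As in Cauchy's estimates, a bound on all terms at radius \<open>s\<close> gives a
  geometric series of ratio \<open>norm z / s\<close>. The constant \<open>B\<close> has to serve
  all \<open>k\<close> and all subbodies at once.\<close>

lemma norm_steiner_function_le:
  fixes K :: "'a::{real_inner, second_countable_topology} set"
  assumes K: "K \<noteq> {}" and s: "norm z < s"
    and B: "\<And>k K'. fin_dim_convex_body K' \<Longrightarrow> K' \<subseteq> K \<Longrightarrow> fin_intrinsic_volume k K' * s ^ k \<le> B"
  shows "summable (\<lambda>k. norm (of_real (real_of_ereal (intrinsic_volume k K)) * z ^ k))"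
    and "norm (steiner_function K z) \<le> B * (s / (s - norm z))"
proof -
  let ?v = "\<lambda>k. real_of_ereal (intrinsic_volume k K)"
  have s0: "0 < s" using s norm_ge_zero[of z] by linarith
  have v: "0 \<le> ?v k" "?v k \<le> B / s ^ k" for k
    using intrinsic_volume_bounded[OF K, of k "B / s ^ k"] B s0 by (auto simp: pos_le_divide_eq)
  have q: "norm (norm z / s) < 1" using s s0 by simp
  have geo: "summable (\<lambda>k. B * (norm z / s) ^ k)" "(\<Sum>k. B * (norm z / s) ^ k) = B * (s / (s - norm z))"
    using summable_mult[OF summable_geometric[OF q], of B] suminf_mult[OF summable_geometric[OF q], of B]
      suminf_geometric[OF q] s0 by (simp_all add: field_simps)
  have le: "norm (of_real (?v k) * z ^ k) \<le> B * (norm z / s) ^ k" for k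
    unfolding norm_mult norm_power norm_of_real abs_of_nonneg[OF v(1)]
    using mult_right_mono[OF v(2), of "norm z ^ k" k] by (simp add: power_divide)
  show sm: "summable (\<lambda>k. norm (of_real (?v k) * z ^ k))"
    by (rule summable_comparison_test'[OF geo(1), of 0]) (use le in simp)
  have "norm (steiner_function K z) \<le> (\<Sum>k. norm (of_real (?v k) * z ^ k))"
    unfolding steiner_function_def by (rule summable_norm[OF sm])
  also have "\<dots> \<le> B * (s / (s - norm z))"
    unfolding geo(2)[symmetric] by (rule suminf_le[OF le sm geo(1)])
  finally show "norm (steiner_function K z) \<le> B * (s / (s - norm z))" .
qed

lemma entire_order_leI:
  assumes "\<And>\<mu>. \<rho> < \<mu> \<Longrightarrow> \<exists>C. \<forall>\<^sub>F r in at_top. \<forall>z. norm z = r \<longrightarrow> norm (f z) \<le> C * exp (r powr \<mu>)"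
  shows "entire_order f \<le> ereal \<rho>"
proof (rule ereal_le_epsilon2)
  fix \<delta> :: real assume "0 < \<delta>"
    then obtain C N where "\<And>r z. N \<le> r \<Longrightarrow> norm z = r \<Longrightarrow> norm (f z) \<le> C * exp (r powr (\<rho> + \<delta>))"
      using assms[of "\<rho> + \<delta>"] by (auto simp: eventually_at_top_linorder)
    then have "\<forall>\<^sub>F z in at_infinity. norm (norm (f z)) \<le> C * norm (exp (norm z powr (\<rho> + \<delta>)))"
      unfolding eventually_at_infinity by (intro exI[of _ N]) auto
    then have "(\<lambda>z. norm (f z)) \<in> O[at_infinity](\<lambda>z. exp (norm z powr (\<rho> + \<delta>)))" by (rule bigoI)
    then show "entire_order f \<le> ereal \<rho> + ereal \<delta>"
      unfolding entire_order_def by (auto intro!: Inf_lower)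
qed

text \<open>The term bound is taken at radius \<open>(1 + \<eta>) * norm z\<close>. The prefactor
  depends on \<open>\<eta>\<close> but not on \<open>z\<close>, so \<open>\<eta>\<close> can be
  chosen small and the constant \<open>V1\<close> in the exponent is not lost.\<close>

theorem steiner_function_growth:
  fixes K :: "'a::{real_inner, second_countable_topology} set"
  assumes K: "GB_set K"
  defines "V1 \<equiv> real_of_ereal (intrinsic_volume 1 K)"
  shows "intrinsic_volume 1 K = ereal V1" and "0 \<le> V1"
    and "0 < \<eta> \<Longrightarrow> z \<noteq> 0 \<Longrightarrow> norm (steiner_function K z) \<le> exp ((1 + \<eta>) * V1 * norm z) * ((1 + \<eta>) / \<eta>)"
proof -
  have ne: "K \<noteq> {}" using K by (simp add: GB_set_def)
  show V1: "intrinsic_volume 1 K = ereal V1" "0 \<le> V1"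
    unfolding V1_def using K intrinsic_volume_nonneg[OF ne, of 1]
    by (cases "intrinsic_volume 1 K"; simp add: GB_set_def)+
  assume \<eta>: "0 < \<eta>" and z: "z \<noteq> 0"
  define s where "s = (1 + \<eta>) * norm z"
  have s: "norm z < s" "0 < s" using \<eta> z by (auto simp: s_def distrib_right add_pos_pos)
  have "norm (steiner_function K z) \<le> exp (s * V1) * (s / (s - norm z))"
  proof (rule norm_steiner_function_le(2)[OF ne s(1)])
    fix k and K' :: "'a set" assume K': "fin_dim_convex_body K'" "K' \<subseteq> K"
    have "fin_intrinsic_volume 1 K' \<le> V1"
      using fin_le_intrinsic_volume[OF K', of 1] unfolding V1 by simp
    then have "exp (s * fin_intrinsic_volume 1 K') \<le> exp (s * V1)" using s by simp
    then show "fin_intrinsic_volume k K' * s ^ k \<le> exp (s * V1)"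
      using fin_intrinsic_volume_le_exp[OF K'(1) s(2), of k] by linarith
  qed
  also have "s / (s - norm z) = (1 + \<eta>) / \<eta>" using z \<eta> by (simp add: s_def field_simps)
  finally show "norm (steiner_function K z) \<le> exp ((1 + \<eta>) * V1 * norm z) * ((1 + \<eta>) / \<eta>)"
    by (simp add: s_def mult_ac)
qed

lemma entire_order_steiner_le_1:
  fixes K :: "'a::{real_inner, second_countable_topology} set"
  assumes K: "GB_set K"
  shows "entire_order (steiner_function K) \<le> 1"
proof -
  define V1 where "V1 = real_of_ereal (intrinsic_volume 1 K)"
  note growth = steiner_function_growth[OF K, folded V1_def]
  have "entire_order (steiner_function K) \<le> ereal 1"
  proof (rule entire_order_leI)
    fix \<mu> :: real assume \<mu>: "1 < \<mu>"
    have "filterlim (\<lambda>r::real. r powr (\<mu> - 1)) at_top at_top" using \<mu> by real_asymp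
    then have "\<forall>\<^sub>F r in at_top. 2 * V1 \<le> r powr (\<mu> - 1)" by (simp add: filterlim_at_top)
    moreover have "\<forall>\<^sub>F r::real in at_top. 0 < r" by (rule eventually_gt_at_top)
    ultimately have "\<forall>\<^sub>F r in at_top. \<forall>z. norm z = r \<longrightarrow> norm (steiner_function K z) \<le> 2 * exp (r powr \<mu>)"
    proof eventually_elim
      case (elim r)
      \<comment> \<open>For the order the crude choice \<open>\<eta> = 1\<close> suffices: the
        exponent is linear in \<open>r\<close>, and \<open>\<mu>\<close> exceeds 1.\<close>
      have "2 * V1 * r \<le> r powr \<mu>"
        using mult_right_mono[OF elim(1), of r] elim(2) by (simp add: powr_diff)
      moreover have "norm (steiner_function K z) \<le> exp (2 * V1 * r) * 2" if "norm z = r" for z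
        using growth(3)[of 1 z] that elim(2) by auto
      ultimately show ?case by (smt (verit) exp_le_cancel_iff)
    qed
    then show "\<exists>C. \<forall>\<^sub>F r in at_top. \<forall>z. norm z = r \<longrightarrow> norm (steiner_function K z) \<le> C * exp (r powr \<mu>)" by blast
  qed
  then show ?thesis by (simp add: one_ereal_def)
qed

lemma entire_type_steiner_le:
  fixes K :: "'a::{real_inner, second_countable_topology} set"
  assumes K: "GB_set K" and order: "entire_order (steiner_function K) = 1"
  shows "entire_type (steiner_function K) \<le> intrinsic_volume 1 K"
proof -
  define V1 where "V1 = real_of_ereal (intrinsic_volume 1 K)"
  note growth = steiner_function_growth[OF K, folded V1_def]
  have "entire_type (steiner_function K) \<le> ereal V1"
  proof (rule ereal_le_epsilon2)
    fix \<delta> :: real assume \<delta>: "0 < \<delta>"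
    define A where "A = V1 + \<delta>"
    \<comment> \<open>Lets \<open>\<eta> * V1\<close> take at most half of \<open>\<delta>\<close>;
      the other half beats the constant prefactor for large \<open>r\<close>. The summand 1 covers
      \<open>V1 = 0\<close>.\<close>
    define \<eta> where "\<eta> = \<delta> / (2 * (V1 + 1))"
    have \<eta>: "0 < \<eta>" using \<delta> growth(2) by (simp add: \<eta>_def)
    have "\<eta> * V1 \<le> \<delta> / 2" using \<delta> growth(2) by (simp add: \<eta>_def field_simps)
    then have a: "(1 + \<eta>) * V1 < A" using \<delta> by (simp add: A_def distrib_right)
    define C where "C = (1 + \<eta>) / \<eta>"
    have "\<forall>\<^sub>F r in at_top. C * exp ((1 + \<eta>) * V1 * r) < exp (A * r)"
    proof -
      have "filterlim (\<lambda>r. exp ((A - (1 + \<eta>) * V1) * r)) at_top at_top"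
        using a by real_asymp
      then have "\<forall>\<^sub>F r in at_top. C < exp ((A - (1 + \<eta>) * V1) * r)"
        by (simp add: filterlim_at_top_dense)
      then show ?thesis
      proof eventually_elim
        case (elim r)
        then have "C * exp ((1 + \<eta>) * V1 * r) < exp ((A - (1 + \<eta>) * V1) * r) * exp ((1 + \<eta>) * V1 * r)" by simp
        also have "\<dots> = exp (A * r)" by (simp add: exp_add[symmetric] algebra_simps)
        finally show ?case .
      qed
    qed
    moreover have "\<forall>\<^sub>F r::real in at_top. 0 < r" by (rule eventually_gt_at_top)
    ultimately have "\<forall>\<^sub>F r in at_top. max_modulus (steiner_function K) r <
        exp (A * r powr real_of_ereal (entire_order (steiner_function K)))"
    proof eventually_elim
      case (elim r)
      have "max_modulus (steiner_function K) r \<le> C * exp ((1 + \<eta>) * V1 * r)"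
        unfolding max_modulus_def
      proof (rule cSUP_least)
        show "sphere (0 :: complex) r \<noteq> {}" using elim(2) by simp
        fix z :: complex assume "z \<in> sphere 0 r"
        then show "norm (steiner_function K z) \<le> C * exp ((1 + \<eta>) * V1 * r)"
          using growth(3)[OF \<eta>, of z] elim(2) by (auto simp: C_def mult.commute)
      qed
      then show ?case using elim order by simp
    qed
    then have "entire_type (steiner_function K) \<le> ereal A"
      unfolding entire_type_def using \<delta> growth(2) by (intro Inf_lower) (auto simp: A_def)
    then show "entire_type (steiner_function K) \<le> ereal V1 + ereal \<delta>" by (simp add: A_def)
  qed
  then show ?thesis by (simp only: growth(1))
qed

subsection \<open>Boxes in the sequence space\<close>

definition ell2_unit :: "nat \<Rightarrow> ell2" where
  "ell2_unit i = Abs_ell2 (\<lambda>j. if j = i then 1 else 0)"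

lemma ell2_nth_unit: "ell2_nth (ell2_unit i) j = (if j = i then 1 else 0)"
proof -
  have "summable (\<lambda>j. (if j = i then 1 else 0 :: real)\<^sup>2)" by (rule summable_finite[of "{i}"]) auto
  then show ?thesis by (simp add: ell2_unit_def Abs_ell2_inverse)
qed

lemma inner_ell2_unit: "inner x (ell2_unit i) = ell2_nth x i"
proof -
  have "inner x (ell2_unit i) = (\<Sum>j. ell2_nth x j * (if j = i then 1 else 0))"
    by (simp add: inner_ell2.rep_eq ell2_nth_unit)
  also have "\<dots> = (\<Sum>j\<in>{i}. ell2_nth x j * (if j = i then 1 else 0))"
    by (rule suminf_finite) auto
  finally show ?thesis by simp
qed

lemma orthonormal_ell2_unit: "orthonormal_frame n ell2_unit"
  by (simp add: orthonormal_frame_def inner_ell2_unit ell2_nth_unit)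

lemma ell2_nth_frame_map: "ell2_nth (frame_map n ell2_unit x) j = (if j < n then x j else 0)"
proof -
  have "ell2_nth (frame_map n ell2_unit x) j = (\<Sum>i<n. x i * inner (ell2_unit i) (ell2_unit j))"
    unfolding frame_map_def inner_ell2_unit[symmetric] inner_sum_left by simp
  also have "\<dots> = (\<Sum>i<n. if i = j then x i else 0)"
    by (intro sum.cong) (auto simp: inner_ell2_unit ell2_nth_unit)
  finally show ?thesis by simp
qed

lemma ell2_eqI: "(\<And>i. ell2_nth x i = ell2_nth y i) \<Longrightarrow> x = y"
  by (metis ell2_nth_inject ext)

definition ell2_box :: "(nat \<Rightarrow> real) \<Rightarrow> ell2 set" where
  "ell2_box a = {x. \<forall>i. 0 \<le> ell2_nth x i \<and> ell2_nth x i \<le> a i}"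

text \<open>Setting sides to 0 keeps a truncated box inside the same family of boxes and, for
  nonnegative sides, inside the full box.\<close>

definition truncate_seq :: "nat \<Rightarrow> (nat \<Rightarrow> real) \<Rightarrow> nat \<Rightarrow> real" where
  "truncate_seq n a i = (if i < n then a i else 0)"

lemma convex_ell2_box: "convex (ell2_box a)"
proof (rule convexI)
  fix x y and u v :: real
  assume x: "x \<in> ell2_box a" and y: "y \<in> ell2_box a" and uv: "0 \<le> u" "0 \<le> v" "u + v = 1"
  have "ell2_nth (u *\<^sub>R x + v *\<^sub>R y) i \<le> a i" for i
    using convex_bound_le[of "ell2_nth x i" "a i" "ell2_nth y i" u v] x y uv
    by (simp add: ell2_box_def plus_ell2.rep_eq scaleR_ell2.rep_eq)
  then show "u *\<^sub>R x + v *\<^sub>R y \<in> ell2_box a"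
    using x y uv by (simp add: ell2_box_def plus_ell2.rep_eq scaleR_ell2.rep_eq)
qed

lemma zero_in_ell2_box: "(\<And>i. 0 \<le> a i) \<Longrightarrow> 0 \<in> ell2_box a"
  by (simp add: ell2_box_def zero_ell2.rep_eq)

lemma ell2_box_mono: "(\<And>i. a i \<le> b i) \<Longrightarrow> ell2_box a \<subseteq> ell2_box b"
  by (auto simp: ell2_box_def intro: order.trans)

lemma scaleR_ell2_box: "0 < r \<Longrightarrow> (*\<^sub>R) r ` ell2_box a = ell2_box (\<lambda>i. r * a i)"
proof (intro set_eqI iffI)
  fix y assume r: "0 < r" and y: "y \<in> ell2_box (\<lambda>i. r * a i)"
  then have "(1 / r) *\<^sub>R y \<in> ell2_box a" by (auto simp: ell2_box_def scaleR_ell2.rep_eq field_simps)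
  then show "y \<in> (*\<^sub>R) r ` ell2_box a" using r by (intro image_eqI[of _ _ "(1 / r) *\<^sub>R y"]) auto
qed (auto simp: ell2_box_def scaleR_ell2.rep_eq)

lemma closed_ell2_box: "closed (ell2_box a)"
proof -
  have "ell2_box a = (\<Inter>i. {x. 0 \<le> inner x (ell2_unit i)} \<inter> {x. inner x (ell2_unit i) \<le> a i})"
    by (auto simp: ell2_box_def inner_ell2_unit)
  also have "closed \<dots>"
    by (intro closed_INT ballI closed_Int closed_Collect_le continuous_intros)
  finally show ?thesis .
qed

lemma ell2_box_truncate_subset_span: "ell2_box (truncate_seq n a) \<subseteq> span (ell2_unit ` {..<n})"
proof
  fix x assume x: "x \<in> ell2_box (truncate_seq n a)"
  have "x = frame_map n ell2_unit (ell2_nth x)"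
  proof (rule ell2_eqI)
    fix i
    have "0 \<le> ell2_nth x i \<and> ell2_nth x i \<le> truncate_seq n a i" using x by (simp add: ell2_box_def)
    then show "ell2_nth x i = ell2_nth (frame_map n ell2_unit (ell2_nth x)) i"
      by (simp add: ell2_nth_frame_map truncate_seq_def split: if_splits)
  qed
  then show "x \<in> span (ell2_unit ` {..<n})" by (metis frame_map_in_span)
qed

lemma norm_ell2_box_le:
  assumes "x \<in> ell2_box a" "summable (\<lambda>i. (a i)\<^sup>2)"
  shows "(norm x)\<^sup>2 \<le> (\<Sum>i. (a i)\<^sup>2)"
  unfolding norm_ell2_square
  using assms by (intro suminf_le summable_ell2_nth power_mono) (auto simp: ell2_box_def)

lemma summable_truncate_seq: "summable (\<lambda>i. (truncate_seq n a i)\<^sup>2)"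
  by (rule summable_finite[of "{..<n}"]) (auto simp: truncate_seq_def)

lemma compact_ell2_box_truncate: "compact (ell2_box (truncate_seq n a))"
proof -
  have "ell2_box (truncate_seq n a) \<subseteq> frame_ball n ell2_unit (sqrt (\<Sum>i. (truncate_seq n a i)\<^sup>2))"
    using ell2_box_truncate_subset_span norm_ell2_box_le[OF _ summable_truncate_seq] real_le_rsqrt
    by (fastforce simp: mem_frame_ball)
  then have "ell2_box (truncate_seq n a) = frame_ball n ell2_unit (sqrt (\<Sum>i. (truncate_seq n a i)\<^sup>2)) \<inter> ell2_box (truncate_seq n a)"
    by blast
  also have "compact \<dots>"
    by (intro compact_Int_closed compact_frame_ball orthonormal_ell2_unit closed_ell2_box)
  finally show ?thesis .
qed

lemma dist_truncation_ell2_box: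
  assumes x: "x \<in> ell2_box a" and a: "summable (\<lambda>i. (a i)\<^sup>2)" "\<And>i. 0 \<le> a i"
  obtains y where "y \<in> ell2_box (truncate_seq n a)" "dist x y \<le> sqrt (\<Sum>i. (a (i + n))\<^sup>2)"
proof -
  define y where "y = frame_map n ell2_unit (ell2_nth x)"
  have y: "ell2_nth y i = (if i < n then ell2_nth x i else 0)" for i
    by (simp add: y_def ell2_nth_frame_map)
  have "y \<in> ell2_box (truncate_seq n a)" using x a(2) by (simp add: ell2_box_def y truncate_seq_def)
  moreover have "(norm (x - y))\<^sup>2 \<le> (\<Sum>i. (a (i + n))\<^sup>2)"
  proof -
    have "(norm (x - y))\<^sup>2 = (\<Sum>i. (ell2_nth (x - y) (i + n))\<^sup>2) + (\<Sum>i<n. (ell2_nth (x - y) i)\<^sup>2)"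
      unfolding norm_ell2_square by (rule suminf_split_initial_segment[OF summable_ell2_nth])
    also have "\<dots> = (\<Sum>i. (ell2_nth x (i + n))\<^sup>2)" by (simp add: minus_ell2.rep_eq y)
    also have "\<dots> \<le> (\<Sum>i. (a (i + n))\<^sup>2)"
      using x summable_ignore_initial_segment[OF summable_ell2_nth[of x], of n]
        summable_ignore_initial_segment[OF a(1), of n]
      by (intro suminf_le power_mono) (auto simp: ell2_box_def)
    finally show ?thesis .
  qed
  ultimately show ?thesis using that by (simp add: dist_norm real_le_rsqrt)
qed

text \<open>The box lies within a small tail of a truncated box, which is compact; finite nets of
  the latter serve for the former.\<close>

lemma compact_ell2_box:
  assumes a: "summable (\<lambda>i. (a i)\<^sup>2)" "\<And>i. 0 \<le> a i"
  shows "compact (ell2_box a)"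
  unfolding compact_eq_totally_bounded
proof (intro conjI allI impI)
  show "complete (ell2_box a)" using closed_ell2_box by (simp add: complete_eq_closed)
  fix \<epsilon> :: real assume \<epsilon>: "0 < \<epsilon>"
  obtain n where n: "\<bar>\<Sum>i. (a (i + n))\<^sup>2\<bar> < (\<epsilon> / 2)\<^sup>2"
    using suminf_exist_split[OF _ a(1), of "(\<epsilon> / 2)\<^sup>2"] \<epsilon> by auto
  have "sqrt (\<Sum>i. (a (i + n))\<^sup>2) < sqrt ((\<epsilon> / 2)\<^sup>2)" using n by (intro real_sqrt_less_mono) linarith
  then have tail: "sqrt (\<Sum>i. (a (i + n))\<^sup>2) < \<epsilon> / 2" using \<epsilon> by simp
  obtain P where P: "finite P" "ell2_box (truncate_seq n a) \<subseteq> (\<Union>p\<in>P. ball p (\<epsilon> / 2))"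
    using compact_ell2_box_truncate[of n a] \<epsilon> unfolding compact_eq_totally_bounded by (meson half_gt_zero)
  have "ell2_box a \<subseteq> (\<Union>p\<in>P. ball p \<epsilon>)"
  proof
    fix x assume "x \<in> ell2_box a"
    then obtain y where y: "y \<in> ell2_box (truncate_seq n a)" "dist x y \<le> sqrt (\<Sum>i. (a (i + n))\<^sup>2)"
      using dist_truncation_ell2_box a by blast
    then obtain p where p: "p \<in> P" "dist p y < \<epsilon> / 2" using P(2) by auto
    then have "dist p x < \<epsilon>" using dist_triangle[of p x y] y(2) tail by (simp add: dist_commute)
    then show "x \<in> (\<Union>p\<in>P. ball p \<epsilon>)" using p by auto
  qed
  then show "\<exists>P. finite P \<and> ell2_box a \<subseteq> (\<Union>p\<in>P. ball p \<epsilon>)" using P(1) by blast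
qed

text \<open>For nonnegative \<open>a\<close>, the distance from \<open>t\<close> to the interval
  from 0 to \<open>a\<close>.\<close>

definition interval_dist :: "real \<Rightarrow> real \<Rightarrow> real" where
  "interval_dist a t = max 0 (max (- t) (t - a))"

text \<open>Outside the interval the integrand is a Gaussian cut in half and pulled apart, of total
  mass 1; on the interval it is 1 and contributes the length.\<close>

lemma nn_integral_interval_dist:
  assumes "0 \<le> a"
  shows "(\<integral>\<^sup>+t. ennreal (exp (- pi * (interval_dist a t)\<^sup>2)) \<partial>lborel) = ennreal (1 + a)"
proof -
  let ?g = "\<lambda>t. ennreal (exp (- pi * t\<^sup>2))"
  let ?N = "\<integral>\<^sup>+t. ?g t * indicator {..<0} t \<partial>lborel" and ?P = "\<integral>\<^sup>+t. ?g t * indicator {0..} t \<partial>lborel"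
  let ?S = "\<integral>\<^sup>+t. ?g (- a + 1 * t) * indicator {0..} (- a + 1 * t) \<partial>lborel"
  have [measurable]: "interval_dist a \<in> borel_measurable borel" unfolding interval_dist_def by measurable
  have "(\<integral>\<^sup>+t. ennreal (exp (- pi * (interval_dist a t)\<^sup>2)) \<partial>lborel) =
      (\<integral>\<^sup>+t. ?g t * indicator {..<0} t + indicator {0..<a} t + ?g (- a + 1 * t) * indicator {0..} (- a + 1 * t) \<partial>lborel)"
    using assms by (intro nn_integral_cong) (auto simp: interval_dist_def indicator_def max_def)
  also have "\<dots> = ?N + ennreal a +
      ?S"
    using assms by (simp add: nn_integral_add)
  also have "?S = ?P"
    using nn_integral_real_affine[of "\<lambda>t. ?g t * indicator {0..} t" 1 "- a"] by simp
  also have "?N + ennreal a + ?P =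
      (?N + ?P) + ennreal a"
    by (simp add: add_ac)
  also have "?N + ?P =
      (\<integral>\<^sup>+t. ?g t * indicator {..<0} t + ?g t * indicator {0..} t \<partial>lborel)"
    by (rule nn_integral_add[symmetric]) measurable
  also have "\<dots> = (\<integral>\<^sup>+t. ?g t \<partial>lborel)"
    by (intro nn_integral_cong) (auto simp: indicator_def)
  also have "\<dots> = 1" by (rule nn_integral_gaussian)
  finally show ?thesis using assms by simp
qed

text \<open>Clamping each coordinate gives a point of the box, and no other point of the box is
  closer in any coordinate. So the squared distance is a sum over the coordinates.\<close>

lemma infdist_ell2_box_truncate:
  assumes a: "\<And>i. 0 \<le> a i"
  shows "(infdist (frame_map n ell2_unit x) (ell2_box (truncate_seq n a)))\<^sup>2 = (\<Sum>i<n. (interval_dist (a i) (x i))\<^sup>2)"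
proof -
  let ?K = "ell2_box (truncate_seq n a)"
  have ca: "0 \<le> truncate_seq n a i" for i using a by (simp add: truncate_seq_def)
  have ne: "?K \<noteq> {}" using zero_in_ell2_box[of "truncate_seq n a", OF ca] by auto
  have dist: "(dist (frame_map n ell2_unit x) (frame_map n ell2_unit y))\<^sup>2 = (\<Sum>i<n. (x i - y i)\<^sup>2)" for y
  proof -
    have "frame_map n ell2_unit x - frame_map n ell2_unit y = frame_map n ell2_unit (\<lambda>i. x i - y i)"
      by (simp add: frame_map_def sum_subtractf scaleR_diff_left)
    then show ?thesis using norm_frame_map[OF orthonormal_ell2_unit] by (simp add: dist_norm)
  qed
  define y where "y i = max 0 (min (x i) (a i))" for i
  have yK: "frame_map n ell2_unit y \<in> ?K"
    using a by (simp add: ell2_box_def ell2_nth_frame_map truncate_seq_def y_def)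
  obtain z where z: "z \<in> ?K" "infdist (frame_map n ell2_unit x) ?K = dist (frame_map n ell2_unit x) z"
    using infdist_attained[OF compact_ell2_box_truncate ne] .
  have zmap: "z = frame_map n ell2_unit (ell2_nth z)"
  proof -
    have "z \<in> span (ell2_unit ` {..<n})" using z(1) ell2_box_truncate_subset_span[of n a] by blast
    from span_frame_expansion[OF orthonormal_ell2_unit this] show ?thesis unfolding inner_ell2_unit .
  qed
  have "(infdist (frame_map n ell2_unit x) ?K)\<^sup>2 \<le> (dist (frame_map n ell2_unit x) (frame_map n ell2_unit y))\<^sup>2"
    using infdist_le[OF yK] by (intro power_mono infdist_nonneg)
  also have "\<dots> = (\<Sum>i<n. (interval_dist (a i) (x i))\<^sup>2)"
    unfolding dist
  proof (intro sum.cong refl)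
    fix i
    have "\<bar>x i - y i\<bar> = interval_dist (a i) (x i)" using a[of i] by (auto simp: y_def interval_dist_def)
    then show "(x i - y i)\<^sup>2 = (interval_dist (a i) (x i))\<^sup>2" by (metis power2_abs)
  qed
  finally have 1: "(infdist (frame_map n ell2_unit x) ?K)\<^sup>2 \<le> (\<Sum>i<n. (interval_dist (a i) (x i))\<^sup>2)" .
  have "(\<Sum>i<n. (interval_dist (a i) (x i))\<^sup>2) \<le> (\<Sum>i<n. (x i - ell2_nth z i)\<^sup>2)"
  proof (rule sum_mono)
    fix i assume "i \<in> {..<n}"
    then have "0 \<le> ell2_nth z i" "ell2_nth z i \<le> a i" using z(1) by (auto simp: ell2_box_def truncate_seq_def split: if_splits)
    then have "interval_dist (a i) (x i) \<le> \<bar>x i - ell2_nth z i\<bar>" by (auto simp: interval_dist_def)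
    then have "(interval_dist (a i) (x i))\<^sup>2 \<le> \<bar>x i - ell2_nth z i\<bar>\<^sup>2"
      by (intro power_mono) (auto simp: interval_dist_def)
    then show "(interval_dist (a i) (x i))\<^sup>2 \<le> (x i - ell2_nth z i)\<^sup>2" by simp
  qed
  also have "\<dots> = (infdist (frame_map n ell2_unit x) ?K)\<^sup>2"
    unfolding z(2) dist[symmetric] zmap[symmetric] ..
  finally show ?thesis using 1 by linarith
qed

text \<open>The Gaussian turns the sum of squared coordinate distances into a product, and each
  factor integrates to \<open>1 + a i\<close>.\<close>

lemma wills_ell2_box_truncate:
  assumes a: "\<And>i. 0 \<le> a i"
  shows "wills n ell2_unit (ell2_box (truncate_seq n a)) = ennreal (\<Prod>i<n. 1 + a i)"
proof -
  interpret product_sigma_finite "\<lambda>_::nat. lborel :: real measure" by standard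
  have [measurable]: "interval_dist c \<in> borel_measurable borel" for c unfolding interval_dist_def by measurable
  have "wills n ell2_unit (ell2_box (truncate_seq n a)) =
      (\<integral>\<^sup>+x. ennreal (exp (- pi * (\<Sum>i<n. (interval_dist (a i) (x i))\<^sup>2))) \<partial>Pi\<^sub>M {..<n} (\<lambda>_. lborel))"
    unfolding wills_def by (simp add: nn_integral_frame infdist_ell2_box_truncate[OF a])
  also have "\<dots> = (\<integral>\<^sup>+x. (\<Prod>i<n. ennreal (exp (- pi * (interval_dist (a i) (x i))\<^sup>2))) \<partial>Pi\<^sub>M {..<n} (\<lambda>_. lborel))"
    by (simp add: prod_ennreal exp_sum[symmetric] sum_distrib_left)
  also have "\<dots> = (\<Prod>i<n. \<integral>\<^sup>+t. ennreal (exp (- pi * (interval_dist (a i) t)\<^sup>2)) \<partial>lborel)"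
    by (rule product_nn_integral_prod) auto
  also have "\<dots> = (\<Prod>i<n. ennreal (1 + a i))" by (intro prod.cong refl nn_integral_interval_dist a)
  also have "\<dots> = ennreal (\<Prod>i<n. 1 + a i)" using a by (intro prod_ennreal) (simp add: add_nonneg_nonneg)
  finally show ?thesis .
qed

lemma truncate_seq_scale: "(\<lambda>i. r * truncate_seq n a i) = truncate_seq n (\<lambda>i. r * a i)"
  by (auto simp: truncate_seq_def)

lemma fin_dim_ell2_box_truncate:
  assumes "\<And>i. 0 \<le> a i"
  shows "fin_dim_convex_body (ell2_box (truncate_seq n a))"
proof -
  have "0 \<in> ell2_box (truncate_seq n a)" using assms by (intro zero_in_ell2_box) (simp add: truncate_seq_def)
  then show ?thesis
    unfolding fin_dim_convex_body_def
    using compact_ell2_box_truncate convex_ell2_box ell2_box_truncate_subset_span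
    by (intro conjI exI[of _ "ell2_unit ` {..<n}"]) auto
qed

text \<open>The volumes of a box are the elementary symmetric polynomials of its sides; the
  generating product is the form in which the growth estimates use them.\<close>

lemma intrinsic_volumes_ell2_box_truncate:
  assumes a: "\<And>i. 0 \<le> a i" and r: "0 < r"
  shows "(\<Sum>k\<le>n. fin_intrinsic_volume k (ell2_box (truncate_seq n a)) * r ^ k) = (\<Prod>i<n. 1 + a i * r)"
proof -
  have ne: "ell2_box (truncate_seq n a) \<noteq> {}" using fin_dim_ell2_box_truncate[of a n, OF a] by (simp add: fin_dim_convex_body_def)
  note B = compact_ell2_box_truncate[of n a] convex_ell2_box[of "truncate_seq n a"] ne ell2_box_truncate_subset_span[of n a]
  have "ennreal (\<Sum>k\<le>n. fin_intrinsic_volume k (ell2_box (truncate_seq n a)) * r ^ k) =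
      wills n ell2_unit (ell2_box (truncate_seq n (\<lambda>i. r * a i)))"
    using wills_eq_intrinsic_volumes[OF orthonormal_ell2_unit B r] r
    by (simp add: scaleR_ell2_box truncate_seq_scale)
  also have "\<dots> = ennreal (\<Prod>i<n. 1 + r * a i)" using a r by (intro wills_ell2_box_truncate) simp
  finally have "ennreal (\<Sum>k\<le>n. fin_intrinsic_volume k (ell2_box (truncate_seq n a)) * r ^ k) = ennreal (\<Prod>i<n. 1 + a i * r)"
    by (simp add: mult.commute)
  moreover have "0 \<le> (\<Prod>i<n. 1 + a i * r)" using a r by (intro prod_nonneg) (simp add: add_nonneg_nonneg)
  ultimately show ?thesis
    using fin_intrinsic_volume_nonneg[OF orthonormal_ell2_unit B] r by (simp add: sum_nonneg)
qed

text \<open>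
  A finite-dimensional body in the box lies within \<open>\<epsilon>\<^sub>n\<close> of the truncated box, inside a space of
  dimension at most \<open>n + d\<close>. Monotonicity makes \<open>n \<epsilon>\<^sub>n\<^sup>2\<close> vanish, which beats the factor
  \<open>c\<^bsup>-(n + d)\<^esup>\<close> lost in the perturbation estimate.
\<close>

lemma wills_subset_ell2_box:
  fixes e :: "nat \<Rightarrow> ell2"
  assumes a: "\<And>i. 0 \<le> a i" "antimono a" "summable a"
    and P: "\<And>n. (\<Prod>i<n. 1 + a i) \<le> P"
    and e: "orthonormal_frame d e" and K: "compact K" "K \<noteq> {}" "K \<subseteq> span (e ` {..<d})" "K \<subseteq> ell2_box a"
  shows "wills d e K \<le> ennreal P"
proof -
  have P1: "1 \<le> P" using P[of 0] by simp
  have a_le: "a i \<le> a 0" for i using a(2) by (simp add: antimonoD)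
  have sq_le: "(a (i + n))\<^sup>2 \<le> a n * a (i + n)" for i n
    using a(1)[of "i + n"] antimonoD[OF a(2), of n "i + n"] by (simp add: power2_eq_square mult_right_mono)
  have sa: "summable (\<lambda>i. a (i + n))" for n using a(3) by (rule summable_ignore_initial_segment)
  have sa2n: "summable (\<lambda>i. (a (i + n))\<^sup>2)" for n
    by (rule summable_comparison_test'[OF summable_mult[OF sa[of n], of "a n"], of 0]) (use sq_le in simp)
  then have sa2: "summable (\<lambda>i. (a i)\<^sup>2)" using sa2n[of 0] by simp
  define S where "S = (\<Sum>i. a i)"
  define T where "T n = (\<Sum>i. (a (i + n))\<^sup>2)" for n
  have T0: "0 \<le> T n" for n unfolding T_def by (intro suminf_nonneg sa2n) simp
  have nT: "(\<lambda>n. real n * T n) \<longlonglongrightarrow> 0"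
  proof (rule tendsto_sandwich)
    show "\<forall>\<^sub>F n in sequentially. 0 \<le> real n * T n" using T0 by simp
    \<comment> \<open>Monotonicity enters twice: \<open>T n\<close> is at most \<open>a n\<close>
      times the tail of the sum, and \<open>real n * a n\<close> is at most the whole sum.\<close>
    have "real n * T n \<le> S * (\<Sum>i. a (i + n))" for n
    proof -
      have "T n \<le> (\<Sum>i. a n * a (i + n))"
        unfolding T_def by (intro suminf_le sq_le sa2n summable_mult sa)
      also have "\<dots> = a n * (\<Sum>i. a (i + n))" by (rule suminf_mult[OF sa])
      finally have "real n * T n \<le> (real n * a n) * (\<Sum>i. a (i + n))"
        by (simp add: mult.assoc mult_left_mono)
      moreover have "real n * a n \<le> S"
      proof -
        have "real n * a n = (\<Sum>i<n. a n)" by simp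
        also have "\<dots> \<le> (\<Sum>i<n. a i)" using a(2) by (intro sum_mono) (auto simp: antimonoD)
        also have "\<dots> \<le> S" unfolding S_def using a by (intro sum_le_suminf) auto
        finally show ?thesis .
      qed
      moreover have "0 \<le> (\<Sum>i. a (i + n))" using a(1) by (intro suminf_nonneg sa)
      ultimately show ?thesis by (meson mult_right_mono order.trans)
    qed
    then show "\<forall>\<^sub>F n in sequentially. real n * T n \<le> S * (\<Sum>i. a (i + n))" by simp
    have "(\<lambda>n. \<Sum>i. a (i + n)) \<longlonglongrightarrow> 0" by (rule suminf_exist_split2[OF a(3)])
    then show "(\<lambda>n. S * (\<Sum>i. a (i + n))) \<longlonglongrightarrow> 0" using tendsto_mult_right_zero by blast
  qed simp
  have main: "wills d e K \<le> ennreal (exp (pi * T n / (1 - c\<^sup>2)) / c ^ (n + d) * P)" if c: "0 < c" "c < 1" for n c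
  proof -
    \<comment> \<open>The perturbation estimate needs \<open>K\<close> and the truncated box in one
      space, so the first \<open>n\<close> unit vectors are extended to a frame whose span contains
      both.\<close>
    obtain m f where f: "n \<le> m" "m \<le> n + card (e ` {..<d})" "orthonormal_frame m f"
      "span (f ` {..<m}) = span (e ` {..<d} \<union> ell2_unit ` {..<n})"
      using extend_frame[OF finite_imageI[OF finite_lessThan] orthonormal_ell2_unit] by metis
    have m: "m \<le> n + d" using f(2) card_image_le[of "{..<d}" e] by simp
    let ?B = "ell2_box (truncate_seq n a)" and ?cB = "ell2_box (truncate_seq n (\<lambda>i. c * a i))"
    have Bf: "span (ell2_unit ` {..<n}) \<subseteq> span (f ` {..<m})" "span (e ` {..<d}) \<subseteq> span (f ` {..<m})"
      unfolding f(4) by (auto intro!: span_mono)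
    have "0 \<in> ?cB" by (rule zero_in_ell2_box) (use a(1) c in \<open>simp add: truncate_seq_def\<close>)
    then have ne: "?cB \<noteq> {}" by auto
    have "wills d e K = wills m f K"
      using e K Bf f by (intro wills_independent) auto
    also have "\<dots> \<le> ennreal (exp (pi * (sqrt (T n))\<^sup>2 / (1 - c\<^sup>2)) / c ^ m) * wills m f ((*\<^sub>R) c ` ?B)"
    proof (rule wills_perturb[OF K(1,2) _ c])
      fix y assume "y \<in> K"
      then obtain z where "z \<in> ?B" "dist y z \<le> sqrt (T n)"
        using dist_truncation_ell2_box[OF _ sa2 a(1), of y n] K(4) unfolding T_def by blast
      then show "infdist y ?B \<le> sqrt (T n)" by (rule infdist_le2)
    qed
    also have "(*\<^sub>R) c ` ?B = ?cB" using c by (simp add: scaleR_ell2_box truncate_seq_scale)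
    also have "wills m f ?cB = wills n ell2_unit ?cB"
      using ell2_box_truncate_subset_span Bf(1) orthonormal_ell2_unit f(3) compact_ell2_box_truncate ne
      by (intro wills_independent) blast+
    also have "\<dots> = ennreal (\<Prod>i<n. 1 + c * a i)" using a c by (intro wills_ell2_box_truncate) simp
    also have "ennreal (exp (pi * (sqrt (T n))\<^sup>2 / (1 - c\<^sup>2)) / c ^ m) * ennreal (\<Prod>i<n. 1 + c * a i) \<le>
        ennreal (exp (pi * T n / (1 - c\<^sup>2)) / c ^ (n + d)) * ennreal P"
    proof (intro mult_mono ennreal_leI)
      have "(\<Prod>i<n. 1 + c * a i) \<le> (\<Prod>i<n. 1 + a i)"
        using a(1) c by (intro prod_mono) (auto simp: add_nonneg_nonneg mult_left_le_one_le)
      then show "(\<Prod>i<n. 1 + c * a i) \<le> P" using P[of n] by linarith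
      have "c ^ (n + d) \<le> c ^ m" using m c by (intro power_decreasing) auto
      then show "exp (pi * (sqrt (T n))\<^sup>2 / (1 - c\<^sup>2)) / c ^ m \<le> exp (pi * T n / (1 - c\<^sup>2)) / c ^ (n + d)"
        using c T0[of n] by (simp add: divide_left_mono)
    qed auto
    finally show ?thesis using c P1 by (subst ennreal_mult) auto
  qed
  have fin: "wills d e K < \<infinity>" using main[of "1/2" 0] le_less_trans by fastforce
  then obtain w where w: "wills d e K = ennreal w" "0 \<le> w" by (cases "wills d e K") auto
  have wle: "w \<le> exp (pi * T n / (1 - c\<^sup>2)) / c ^ (n + d) * P" if "0 < c" "c < 1" for n c
    using main[OF that, of n] that P1 unfolding w(1) by (simp add: ennreal_le_iff)
  have w_eta: "w \<le> exp \<eta> * P" if \<eta>: "0 < \<eta>" for \<eta> :: real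
  proof (rule tendsto_lowerbound)
    \<comment> \<open>Here \<open>c\<close> tends to 1 at rate 1/n: \<open>c ^ n\<close> then tends
      to exp (- eta), while 1 - c^2 is at least eta / n, so the exponent is at most pi n T n / eta
      and vanishes in the limit. The factor exp eta that remains is removed by letting eta tend to
      0.\<close>
    let ?c = "\<lambda>n. 1 - \<eta> / real n"
    have "(\<lambda>n. exp (pi * (real n * T n) / \<eta>) / ((1 + (- \<eta>) / real n) ^ n * (1 - \<eta> / real n) ^ d) * P) \<longlonglongrightarrow>
        exp (pi * 0 / \<eta>) / (exp (- \<eta>) * (1 - 0) ^ d) * P"
    proof (intro tendsto_mult tendsto_divide tendsto_exp tendsto_const nT tendsto_exp_limit_sequentially tendsto_power tendsto_diff)
      show "(\<lambda>n. \<eta> / real n) \<longlonglongrightarrow> 0" by real_asymp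
    qed (use \<eta> in auto)
    then show "(\<lambda>n. exp (pi * (real n * T n) / \<eta>) / (?c n) ^ (n + d) * P) \<longlonglongrightarrow> exp \<eta> * P"
      by (simp add: exp_minus power_add field_simps)
    have "\<forall>\<^sub>F n in sequentially. \<eta> < real n" by real_asymp
    then show "\<forall>\<^sub>F n in sequentially. w \<le> exp (pi * (real n * T n) / \<eta>) / (?c n) ^ (n + d) * P"
    proof eventually_elim
      case (elim n)
      have n: "0 < real n" using elim \<eta> by linarith
      have c: "0 < ?c n" "?c n < 1" using elim \<eta> n by (auto simp: field_simps)
      have "(?c n)\<^sup>2 \<le> ?c n" using c by (simp add: power2_eq_square mult_left_le)
      then have le: "\<eta> / real n \<le> 1 - (?c n)\<^sup>2" by linarith
      have \<eta>n: "0 < \<eta> / real n" using \<eta> n by (rule divide_pos_pos)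
      have "pi * T n / (1 - (?c n)\<^sup>2) \<le> pi * T n / (\<eta> / real n)"
        by (rule divide_left_mono[OF le mult_nonneg_nonneg[OF pi_ge_zero T0] mult_pos_pos[OF less_le_trans[OF \<eta>n le] \<eta>n]])
      also have "\<dots> = pi * (real n * T n) / \<eta>" by (simp add: mult_ac)
      finally have "exp (pi * T n / (1 - (?c n)\<^sup>2)) / (?c n) ^ (n + d) * P \<le> exp (pi * (real n * T n) / \<eta>) / (?c n) ^ (n + d) * P"
        using c P1 by (intro mult_right_mono divide_right_mono) auto
      then show ?case using wle[OF c, of n] by linarith
    qed
  qed simp
  have "w \<le> P"
  proof (rule tendsto_lowerbound)
    have "((\<lambda>\<eta>. exp \<eta> * P) \<longlongrightarrow> exp 0 * P) (at_right 0)" by (intro tendsto_intros)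
    then show "((\<lambda>\<eta>. exp \<eta> * P) \<longlongrightarrow> P) (at_right 0)" by simp
    show "\<forall>\<^sub>F \<eta> in at_right 0. w \<le> exp \<eta> * P"
      using w_eta by (auto simp: eventually_at_right_field intro!: exI[of _ 1])
  qed simp
  then show ?thesis unfolding w(1) by (rule ennreal_leI)
qed

lemma intrinsic_volume_term_ell2_box_le:
  assumes a: "\<And>i. 0 \<le> a i" "antimono a" "summable a" and r: "0 < r"
    and P: "\<And>n. (\<Prod>i<n. 1 + a i * r) \<le> P"
    and K: "fin_dim_convex_body K" "K \<subseteq> ell2_box a"
  shows "fin_intrinsic_volume k K * r ^ k \<le> P"
proof -
  obtain d and e :: "nat \<Rightarrow> ell2" where e: "orthonormal_frame d e" "K \<subseteq> span (e ` {..<d})"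
    using fin_dim_convex_body_frame[OF K(1)] .
  have K': "compact K" "convex K" "K \<noteq> {}" using K(1) by (auto simp: fin_dim_convex_body_def)
  show ?thesis
  proof (rule intrinsic_volume_term_le_wills[OF e(1) K' e(2) r])
    show "wills d e ((*\<^sub>R) r ` K) \<le> ennreal P"
    proof (rule wills_subset_ell2_box[of "\<lambda>i. r * a i"])
      show "compact ((*\<^sub>R) r ` K)" using K' by (intro compact_continuous_image continuous_intros)
      show "(*\<^sub>R) r ` K \<subseteq> span (e ` {..<d})" using e by (auto intro: span_scale)
      show "(*\<^sub>R) r ` K \<subseteq> ell2_box (\<lambda>i. r * a i)"
        using K(2) unfolding scaleR_ell2_box[OF r, symmetric] by (rule image_mono)
      show "antimono (\<lambda>i. r * a i)" using a(2) r by (auto simp: antimono_def mult_left_mono)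
    qed (use a r e K' P in \<open>auto intro: summable_mult simp: mult.commute\<close>)
    show "0 \<le> P" using P[of 0] by simp
  qed
qed

lemma prod_le_exp_suminf:
  fixes a :: "nat \<Rightarrow> real"
  assumes "\<And>i. 0 \<le> b i" "\<And>i. 1 + a i \<le> exp (b i)" "\<And>i. 0 \<le> a i" "summable b"
  shows "(\<Prod>i<n. 1 + a i) \<le> exp (\<Sum>i. b i)"
proof -
  have "(\<Prod>i<n. 1 + a i) \<le> (\<Prod>i<n. exp (b i))" using assms by (intro prod_mono) (auto simp: add_nonneg_nonneg)
  also have "\<dots> = exp (\<Sum>i<n. b i)" by (simp add: exp_sum)
  also have "\<dots> \<le> exp (\<Sum>i. b i)" using assms by (simp add: sum_le_suminf)
  finally show ?thesis .
qed

context
  fixes a :: "nat \<Rightarrow> real"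
  assumes a: "\<And>i. 0 \<le> a i" "antimono a" "summable a"
begin

lemma ell2_box_nonempty: "ell2_box a \<noteq> {}"
  using zero_in_ell2_box[of a, OF a(1)] by auto

lemma ell2_box_product_le: "0 < r \<Longrightarrow> (\<Prod>i<n. 1 + a i * r) \<le> exp ((\<Sum>i. a i) * r)"
  using prod_le_exp_suminf[of "\<lambda>i. a i * r" "\<lambda>i. a i * r" n] a suminf_mult2[OF a(3), of r]
  by (simp add: summable_mult2)

lemma GB_set_ell2_box: "GB_set (ell2_box a)"
proof -
  have sq: "summable (\<lambda>i. (a i)\<^sup>2)"
  proof (rule summable_comparison_test'[OF summable_mult[OF a(3), of "a 0"], of 0])
    show "norm ((a n)\<^sup>2) \<le> a 0 * a n" for n
      using a(1)[of n] antimonoD[OF a(2), of 0 n] by (simp add: power2_eq_square mult_right_mono)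
  qed
  have "intrinsic_volume 1 (ell2_box a) = ereal (real_of_ereal (intrinsic_volume 1 (ell2_box a)))"
  proof (rule intrinsic_volume_bounded(1)[OF ell2_box_nonempty])
    fix K' assume K': "fin_dim_convex_body K'" "K' \<subseteq> ell2_box a"
    show "fin_intrinsic_volume 1 K' \<le> exp (\<Sum>i. a i)"
      using intrinsic_volume_term_ell2_box_le[OF a zero_less_one _ K', of "exp (\<Sum>i. a i)" 1]
        ell2_box_product_le[of 1] by simp
  qed
  then have "intrinsic_volume 1 (ell2_box a) < \<infinity>" by (cases "intrinsic_volume 1 (ell2_box a)") (simp_all del: One_nat_def)
  then show ?thesis
    unfolding GB_set_def using ell2_box_nonempty compact_ell2_box[of a, OF sq a(1)] convex_ell2_box by simp
qed

text \<open>Radius \<open>2 * norm z\<close> makes the geometric ratio 1/2, hence the factor 2.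
  Doubling the argument does no harm to the order.\<close>

lemma norm_steiner_ell2_box_le:
  assumes z: "z \<noteq> 0" and P: "\<And>n. (\<Prod>i<n. 1 + a i * (2 * norm z)) \<le> P"
  shows "norm (steiner_function (ell2_box a) z) \<le> 2 * P"
proof -
  have "norm (steiner_function (ell2_box a) z) \<le> P * (2 * norm z / (2 * norm z - norm z))"
    using z by (intro norm_steiner_function_le(2)[OF ell2_box_nonempty]
      intrinsic_volume_term_ell2_box_le[OF a _ P]) auto
  then show ?thesis using z by simp
qed

text \<open>Truncated boxes are subbodies, so their volumes lie below the suprema. With nonnegative
  coefficients and a positive argument the modulus is the series itself, and its partial sums bound
  it from below.\<close>

lemma steiner_ell2_box_ge:
  assumes r: "0 < r"
  shows "(\<Prod>i<n. 1 + a i * r) \<le> norm (steiner_function (ell2_box a) (of_real r))"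
proof -
  let ?v = "\<lambda>k. real_of_ereal (intrinsic_volume k (ell2_box a))"
  have bnd: "fin_intrinsic_volume k K' * s ^ k \<le> exp ((\<Sum>i. a i) * s)"
    if "fin_dim_convex_body K'" "K' \<subseteq> ell2_box a" "0 < s" for k K' s
    using that by (intro intrinsic_volume_term_ell2_box_le[OF a _ ell2_box_product_le])
  have iv: "intrinsic_volume k (ell2_box a) = ereal (?v k)" "0 \<le> ?v k" for k
    using intrinsic_volume_bounded[OF ell2_box_nonempty, of k "exp ((\<Sum>i. a i) * 1)"] bnd[of _ 1 k] by simp_all
  have "norm (complex_of_real r) < 2 * r" using r by simp
  then have "summable (\<lambda>k. norm (of_real (?v k) * (of_real r) ^ k :: complex))"
  proof (rule norm_steiner_function_le(1)[OF ell2_box_nonempty])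
    show "fin_intrinsic_volume k K' * (2 * r) ^ k \<le> exp ((\<Sum>i. a i) * (2 * r))"
      if "fin_dim_convex_body K'" "K' \<subseteq> ell2_box a" for k K'
      using bnd[OF that, of "2 * r" k] r by simp
  qed
  then have sm: "summable (\<lambda>k. ?v k * r ^ k)"
    unfolding norm_mult norm_power norm_of_real abs_of_nonneg[OF iv(2)] using r by simp
  have "steiner_function (ell2_box a) (of_real r) = (\<Sum>k. of_real (?v k * r ^ k))"
    unfolding steiner_function_def by simp
  also have "\<dots> = of_real (\<Sum>k. ?v k * r ^ k)" by (rule suminf_of_real[OF sm, symmetric])
  finally have eq: "steiner_function (ell2_box a) (of_real r) = of_real (\<Sum>k. ?v k * r ^ k)" .
  have "0 \<le> (\<Sum>k. ?v k * r ^ k)"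
    using iv(2) r by (intro suminf_nonneg[OF sm] mult_nonneg_nonneg) auto
  then have f: "norm (steiner_function (ell2_box a) (of_real r)) = (\<Sum>k. ?v k * r ^ k)"
    unfolding eq norm_of_real by (rule abs_of_nonneg)
  have "(\<Prod>i<n. 1 + a i * r) = (\<Sum>k\<le>n. fin_intrinsic_volume k (ell2_box (truncate_seq n a)) * r ^ k)"
    by (rule intrinsic_volumes_ell2_box_truncate[OF a(1) r, symmetric])
  also have "\<dots> \<le> (\<Sum>k\<le>n. ?v k * r ^ k)"
  proof (intro sum_mono mult_right_mono)
    fix k
    have "ell2_box (truncate_seq n a) \<subseteq> ell2_box a" using a(1) by (intro ell2_box_mono) (simp add: truncate_seq_def)
    then have "ereal (fin_intrinsic_volume k (ell2_box (truncate_seq n a))) \<le> ereal (?v k)"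
      unfolding iv(1)[symmetric] by (intro fin_le_intrinsic_volume fin_dim_ell2_box_truncate a(1))
    then show "fin_intrinsic_volume k (ell2_box (truncate_seq n a)) \<le> ?v k" by simp
  qed (use r in simp)
  also have "\<dots> \<le> (\<Sum>k. ?v k * r ^ k)" using sm iv(2) r by (intro sum_le_suminf) auto
  finally show ?thesis unfolding f .
qed

end

subsection \<open>Boxes of prescribed order\<close>

text \<open>For \<open>x\<close> up to 1 the linear term is below the power, and beyond 1 the
  logarithm is below a multiple of it. The constant 2 / p covers both cases: it is at least 1, and
  (2 x)^p is at most 2 x^p.\<close>

lemma one_plus_le_exp_powr:
  fixes x p :: real
  assumes "0 \<le> x" "0 < p" "p \<le> 1"
  shows "1 + x \<le> exp (2 / p * x powr p)"
proof (cases "x \<le> 1")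
  case True
  have "x \<le> 2 / p * x powr p"
  proof (cases "x = 0")
    case False
    then have "x powr 1 \<le> x powr p" using assms True by (intro powr_mono') auto
    also have "\<dots> = 1 * x powr p" by simp
    also have "\<dots> \<le> 2 / p * x powr p" using assms by (intro mult_right_mono) (auto simp: le_divide_eq)
    finally show ?thesis using assms by simp
  qed simp
  then show ?thesis using exp_ge_add_one_self[of "2 / p * x powr p"] by linarith
next
  case False
  have "ln (1 + x) \<le> (1 + x) powr p / p" using False assms by (intro ln_powr_bound) auto
  also have "\<dots> \<le> (2 * x) powr p / p" using False assms by (intro divide_right_mono powr_mono2) auto
  also have "\<dots> = 2 powr p * x powr p / p" using False by (simp add: powr_mult)
  also have "\<dots> \<le> 2 powr 1 * x powr p / p"
    using assms by (intro divide_right_mono mult_right_mono powr_mono) auto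
  finally have "ln (1 + x) \<le> 2 / p * x powr p" by simp
  then have "exp (ln (1 + x)) \<le> exp (2 / p * x powr p)" by simp
  then show ?thesis using False by simp
qed

text \<open>The order is an infimum, so every admissible exponent has to be bounded from below. A
  bound for all large \<open>z\<close> is tested on the positive axis, where lower bounds are
  available.\<close>

lemma entire_order_geI:
  assumes "\<And>\<mu> C. \<forall>\<^sub>F r in at_top. norm (f (of_real r)) \<le> C * exp (r powr \<mu>) \<Longrightarrow> \<rho> \<le> \<mu>"
  shows "ereal \<rho> \<le> entire_order f"
  unfolding entire_order_def
proof (rule Inf_greatest)
  fix x assume "x \<in> {ereal \<mu> | \<mu>. (\<lambda>z. norm (f z)) \<in> O[at_infinity](\<lambda>z. exp (norm z powr \<mu>))}"
  then obtain \<mu> where x: "x = ereal \<mu>" "(\<lambda>z. norm (f z)) \<in> O[at_infinity](\<lambda>z. exp (norm z powr \<mu>))" by blast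
  then obtain C where "\<forall>\<^sub>F z in at_infinity. norm (norm (f z)) \<le> C * norm (exp (norm z powr \<mu>))"
    by (elim landau_o.bigE)
  then obtain b where b: "\<And>z. b \<le> norm z \<Longrightarrow> norm (f z) \<le> C * exp (norm z powr \<mu>)"
    by (auto simp: eventually_at_infinity)
  have "\<forall>\<^sub>F r in at_top. norm (f (of_real r)) \<le> C * exp (r powr \<mu>)"
    using eventually_ge_at_top[of "max b 0"]
  proof eventually_elim
    case (elim r)
    then show ?case using b[of "of_real r"] by simp
  qed
  then show "ereal \<rho> \<le> x" using assms x(1) by simp
qed

context
  fixes a :: "nat \<Rightarrow> real"
  assumes a: "\<And>i. 0 \<le> a i" "antimono a" "summable a"
begin

text \<open>The numbers -1 / a i are the zeros of the model product, and summability of all powers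
  above \<open>\<rho>\<close> says that their exponent of convergence is at most
  \<open>\<rho>\<close>. As for canonical products, this bounds the order, since every factor is at
  most the exponential of a power.\<close>

lemma entire_order_ell2_box_le:
  assumes \<rho>: "0 \<le> \<rho>" "\<rho> < 1" and sum: "\<And>p. \<rho> < p \<Longrightarrow> p \<le> 1 \<Longrightarrow> summable (\<lambda>i. a i powr p)"
  shows "entire_order (steiner_function (ell2_box a)) \<le> ereal \<rho>"
proof (rule entire_order_leI)
  fix \<mu> :: real assume \<mu>: "\<rho> < \<mu>"
  \<comment> \<open>Strictly between \<open>\<rho>\<close> and \<open>\<mu>\<close> and at most 1;
    the gap to \<open>\<mu>\<close> absorbs the constant \<open>A\<close>.\<close>
  define p where "p = (\<rho> + min \<mu> 1) / 2"
  have p: "\<rho> < p" "p \<le> 1" "p < \<mu>" "0 < p" using \<rho> \<mu> by (auto simp: p_def)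
  define A where "A = 2 / p * 2 powr p * (\<Sum>i. a i powr p)"
  have bound: "norm (steiner_function (ell2_box a) z) \<le> 2 * exp (A * norm z powr p)" if z: "z \<noteq> 0" for z
  proof (rule norm_steiner_ell2_box_le[OF a z])
    fix n
    define b where "b i = 2 / p * (2 powr p * norm z powr p) * a i powr p" for i
    have sb: "summable b" unfolding b_def by (intro summable_mult sum p)
    have "(\<Prod>i<n. 1 + a i * (2 * norm z)) \<le> exp (\<Sum>i. b i)"
    proof (rule prod_le_exp_suminf)
      show "1 + a i * (2 * norm z) \<le> exp (b i)" for i
        using one_plus_le_exp_powr[of "a i * (2 * norm z)" p] a(1)[of i] p
        by (simp add: b_def powr_mult mult_ac)
      show "summable b" by (rule sb)
    qed (use a(1) p in \<open>auto simp: b_def\<close>)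
    also have "(\<Sum>i. b i) = A * norm z powr p"
      unfolding b_def A_def by (subst suminf_mult[OF sum[OF p(1,2)]]) (simp add: mult_ac)
    finally show "(\<Prod>i<n. 1 + a i * (2 * norm z)) \<le> exp (A * norm z powr p)" .
  qed
  have "filterlim (\<lambda>r::real. r powr (\<mu> - p)) at_top at_top" using p by real_asymp
  then have "\<forall>\<^sub>F r in at_top. A \<le> r powr (\<mu> - p)" by (simp add: filterlim_at_top)
  moreover have "\<forall>\<^sub>F r::real in at_top. 0 < r" by (rule eventually_gt_at_top)
  ultimately have "\<forall>\<^sub>F r in at_top. \<forall>z. norm z = r \<longrightarrow>
      norm (steiner_function (ell2_box a) z) \<le> 2 * exp (r powr \<mu>)"
  proof eventually_elim
    case (elim r)
    have "A * r powr p \<le> r powr (\<mu> - p) * r powr p" using elim by (intro mult_right_mono) auto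
    also have "\<dots> = r powr \<mu>" by (simp add: powr_add[symmetric])
    finally have le: "A * r powr p \<le> r powr \<mu>" .
    show ?case
    proof (intro allI impI)
      fix z :: complex assume z: "norm z = r"
      then have "norm (steiner_function (ell2_box a) z) \<le> 2 * exp (A * r powr p)" using bound[of z] elim(2) by auto
      also have "\<dots> \<le> 2 * exp (r powr \<mu>)" using le by simp
      finally show "norm (steiner_function (ell2_box a) z) \<le> 2 * exp (r powr \<mu>)" .
    qed
  qed
  then show "\<exists>C. \<forall>\<^sub>F r in at_top. \<forall>z. norm z = r \<longrightarrow>
      norm (steiner_function (ell2_box a) z) \<le> C * exp (r powr \<mu>)" by blast
qed

text \<open>At radius \<open>s n\<close> the first \<open>n\<close> factors are at least 2, so the
  function is at least 2^n there; \<open>growth\<close> says that this outruns the exponential of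
  every power below \<open>\<rho>\<close>.\<close>

lemma entire_order_ell2_box_ge:
  assumes s: "filterlim s at_top at_top" and as: "\<And>n i. i < n \<Longrightarrow> 1 \<le> a i * s n"
    and growth: "\<And>\<mu>. 0 < \<mu> \<Longrightarrow> \<mu> < \<rho> \<Longrightarrow> filterlim (\<lambda>n. real n * ln 2 - s n powr \<mu>) at_top at_top"
    and \<rho>: "0 < \<rho>"
  shows "ereal \<rho> \<le> entire_order (steiner_function (ell2_box a))"
proof (rule entire_order_geI, rule ccontr)
  fix \<mu> C :: real
  assume le: "\<forall>\<^sub>F r in at_top. norm (steiner_function (ell2_box a) (of_real r)) \<le> C * exp (r powr \<mu>)"
    and "\<not> \<rho> \<le> \<mu>"
  \<comment> \<open>The assumed exponent may be zero or negative. Raising it to at least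
    \<open>\<rho> / 2\<close> brings it into the range of \<open>growth\<close> and only weakens the
    upper bound.\<close>
  define \<nu> where "\<nu> = max \<mu> (\<rho> / 2)"
  have \<nu>: "\<mu> \<le> \<nu>" "0 < \<nu>" "\<nu> < \<rho>" using \<open>\<not> \<rho> \<le> \<mu>\<close> \<rho> by (auto simp: \<nu>_def)
  define D where "D = max C 1"
  have "\<forall>\<^sub>F n in at_top. norm (steiner_function (ell2_box a) (of_real (s n))) \<le> C * exp (s n powr \<mu>)"
    by (rule eventually_compose_filterlim[OF le s])
  moreover have "\<forall>\<^sub>F n in at_top. 1 \<le> s n" using s by (simp add: filterlim_at_top)
  moreover have "\<forall>\<^sub>F n in at_top. ln D + 1 \<le> real n * ln 2 - s n powr \<nu>"
    using growth[OF \<nu>(2,3)] by (simp add: filterlim_at_top)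
  ultimately have "\<forall>\<^sub>F n :: nat in at_top. False"
  proof eventually_elim
    case (elim n)
    have "(2::real) ^ n = (\<Prod>i<n. 2)" by simp
    also have "\<dots> \<le> (\<Prod>i<n. 1 + a i * s n)" using as by (intro prod_mono) force
    also have "\<dots> \<le> norm (steiner_function (ell2_box a) (of_real (s n)))"
      using elim(2) by (intro steiner_ell2_box_ge[OF a]) auto
    also have "\<dots> \<le> C * exp (s n powr \<mu>)" by (rule elim(1))
    also have "\<dots> \<le> D * exp (s n powr \<nu>)"
      using elim(2) \<nu> by (intro mult_mono) (auto simp: D_def intro: powr_mono)
    finally have "ln ((2::real) ^ n) \<le> ln (D * exp (s n powr \<nu>))" by (subst ln_le_cancel_iff) (auto simp: D_def)
    also have "\<dots> = ln D + s n powr \<nu>" by (subst ln_mult) (auto simp: D_def)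
    finally show False using elim(3) by (simp add: ln_realpow)
  qed
  then show False by simp
qed

end

text \<open>A point would give a constant function, of order minus infinity in this convention. A
  unit segment gives at least \<open>1 + r\<close> on the positive axis, which excludes negative
  exponents, and every power of its sides is summable.\<close>

lemma GB_set_of_order_0: "\<exists>K :: ell2 set. GB_set K \<and> entire_order (steiner_function K) = ereal 0"
proof -
  define a :: "nat \<Rightarrow> real" where "a i = (if i = 0 then 1 else 0)" for i
  have sp: "summable (\<lambda>i. a i powr p)" for p by (rule summable_finite[of "{0}"]) (auto simp: a_def)
  have a: "\<And>i. 0 \<le> a i" "antimono a" "summable a"
    by (auto simp: a_def antimono_def) (rule summable_finite[of "{0}"]; simp add: a_def)
  have "entire_order (steiner_function (ell2_box a)) \<le> ereal 0"
    by (rule entire_order_ell2_box_le[OF a _ _ sp]) auto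
  moreover have "ereal 0 \<le> entire_order (steiner_function (ell2_box a))"
  proof (rule entire_order_geI, rule ccontr)
    fix \<mu> C :: real
    assume le: "\<forall>\<^sub>F r in at_top. norm (steiner_function (ell2_box a) (of_real r)) \<le> C * exp (r powr \<mu>)"
      and "\<not> 0 \<le> \<mu>"
    have "\<forall>\<^sub>F r :: real in at_top. \<bar>C\<bar> * exp 1 < r" by (rule eventually_gt_at_top)
    moreover have "\<forall>\<^sub>F r :: real in at_top. 1 < r" by (rule eventually_gt_at_top)
    ultimately have "\<forall>\<^sub>F r :: real in at_top. False" using le
    proof eventually_elim
      case (elim r)
      have "1 + r \<le> norm (steiner_function (ell2_box a) (of_real r))"
        using steiner_ell2_box_ge[OF a, of r 1] elim(2) by (simp add: a_def)
      also have "\<dots> \<le> \<bar>C\<bar> * exp (r powr \<mu>)"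
        using elim(3) by (rule order.trans) (simp add: mult_right_mono)
      also have "\<dots> \<le> \<bar>C\<bar> * exp 1"
        using powr_mono[of \<mu> 0 r] \<open>\<not> 0 \<le> \<mu>\<close> elim(2) by (intro mult_left_mono) auto
      finally show False using elim(1) by linarith
    qed
    then show False by simp
  qed
  ultimately show ?thesis using GB_set_ell2_box[OF a] by (intro exI[of _ "ell2_box a"]) (simp add: antisym)
qed

text \<open>For sides (i + 1)^(-1/rho) the p-th powers are summable as soon as p exceeds
  \<open>\<rho>\<close>, and at radius n^(1/rho) exactly the first \<open>n\<close> factors are at
  least 2.\<close>

lemma GB_set_of_order_between:
  assumes \<rho>: "0 < \<rho>" "\<rho> < 1"
  shows "\<exists>K :: ell2 set. GB_set K \<and> entire_order (steiner_function K) = ereal \<rho>"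
proof -
  define a :: "nat \<Rightarrow> real" where "a i = real (i + 1) powr (- 1 / \<rho>)" for i
  have sp: "summable (\<lambda>i. a i powr p)" if "\<rho> < p" for p
  proof -
    have "- p / \<rho> < - 1" using that \<rho> by (simp add: field_simps)
    then have "summable (\<lambda>i. real i powr (- p / \<rho>))" by (simp add: summable_real_powr_iff)
    then have "summable (\<lambda>i. real (Suc i) powr (- p / \<rho>))"
      using summable_Suc_iff[of "\<lambda>i. real i powr (- p / \<rho>)"] by blast
    then show ?thesis by (simp add: a_def powr_powr)
  qed
  have "antimono a"
    unfolding antimono_def a_def using \<rho> by (auto intro!: powr_mono2')
  moreover have a0: "0 \<le> a i" for i by (simp add: a_def)
  ultimately have a: "\<And>i. 0 \<le> a i" "antimono a" "summable a"
    using sp[of 1] \<rho> by (auto simp: a0)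
  have "entire_order (steiner_function (ell2_box a)) \<le> ereal \<rho>"
    using \<rho> sp by (intro entire_order_ell2_box_le[OF a]) auto
  moreover have "ereal \<rho> \<le> entire_order (steiner_function (ell2_box a))"
  proof (rule entire_order_ell2_box_ge[OF a, of "\<lambda>n. real n powr (1 / \<rho>)"])
    show "filterlim (\<lambda>n. real n powr (1 / \<rho>)) at_top at_top" using \<rho> by real_asymp
    show "1 \<le> a i * real n powr (1 / \<rho>)" if "i < n" for n i
    proof -
      have "real (i + 1) powr (1 / \<rho>) \<le> real n powr (1 / \<rho>)" using that \<rho> by (intro powr_mono2) auto
      moreover have "a i * real (i + 1) powr (1 / \<rho>) = 1" by (simp add: a_def powr_add[symmetric])
      moreover have "0 \<le> a i" by (rule a(1))
      ultimately show ?thesis using mult_left_mono by metis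
    qed
    fix \<mu> :: real assume \<mu>: "0 < \<mu>" "\<mu> < \<rho>"
    define \<theta> where "\<theta> = \<mu> / \<rho>"
    have "0 < \<theta>" "\<theta> < 1" using \<mu> \<rho> by (auto simp: \<theta>_def)
    then have "filterlim (\<lambda>n. real n * ln 2 - real n powr \<theta>) at_top at_top" by real_asymp
    then show "filterlim (\<lambda>n. real n * ln 2 - (real n powr (1 / \<rho>)) powr \<mu>) at_top at_top"
      by (simp add: powr_powr \<theta>_def)
  qed (use \<rho> in simp)
  ultimately show ?thesis using GB_set_ell2_box[OF a] by (intro exI[of _ "ell2_box a"]) (simp add: antisym)
qed

text \<open>At order 1 the power law would give harmonic sides, which are not summable. The squared
  logarithm restores summability, while the sides still decay more slowly than every power with
  exponent below -1. The upper bound on the order is the general one for GB-sets.\<close>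

lemma GB_set_of_order_1: "\<exists>K :: ell2 set. GB_set K \<and> entire_order (steiner_function K) = ereal 1"
proof -
  \<comment> \<open>The shift by 3 keeps the logarithm positive also at the preceding integer, which
    enters the telescoping comparison.\<close>
  define b where "b i = real (i + 3) * (ln (real (i + 3)))\<^sup>2" for i
  define a where "a i = 1 / b i" for i
  have ln1: "0 < ln (real (i + 2))" for i by simp
  have bpos: "0 < b i" for i by (simp add: b_def)
  have bmono: "b i \<le> b j" if "i \<le> j" for i j
    unfolding b_def using that by (intro mult_mono power_mono ln_mono) auto
  \<comment> \<open>Discrete form of the antiderivative - 1 / ln x of 1 / (x (ln x)^2).\<close>
  have tele: "summable (\<lambda>i. 1 / ln (real (i + 2)) - 1 / ln (real (Suc i + 2)))"
  proof (rule telescope_summable')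
    show "(\<lambda>i. 1 / ln (real (i + 2))) \<longlonglongrightarrow> 0" by real_asymp
  qed
  have "a i \<le> 1 / ln (real (i + 2)) - 1 / ln (real (Suc i + 2))" for i
  proof -
    let ?x = "real (i + 2)" and ?y = "real (i + 3)"
    have l: "0 < ln ?x" "ln ?x \<le> ln ?y" by auto
    have "ln (?x / ?y) \<le> ?x / ?y - 1" by (rule ln_le_minus_one) simp
    then have "1 / ?y \<le> ln ?y - ln ?x" by (simp add: ln_div field_simps)
    then have "1 / ?y / (ln ?y)\<^sup>2 \<le> (ln ?y - ln ?x) / (ln ?y)\<^sup>2" by (intro divide_right_mono) auto
    also have "\<dots> \<le> (ln ?y - ln ?x) / (ln ?x * ln ?y)"
      unfolding power2_eq_square using l by (intro divide_left_mono mult_right_mono) auto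
    also have "\<dots> = 1 / ln ?x - 1 / ln ?y" using l by (simp add: diff_divide_distrib)
    finally show ?thesis by (simp add: a_def b_def add.commute)
  qed
  then have "summable a"
    using bpos by (intro summable_comparison_test'[OF tele, of 0]) (simp add: a_def less_imp_le)
  moreover have "antimono a" unfolding antimono_def a_def using bmono bpos by (auto intro!: divide_left_mono)
  ultimately have a: "\<And>i. 0 \<le> a i" "antimono a" "summable a" using bpos by (auto simp: a_def less_imp_le)
  have "ereal 1 \<le> entire_order (steiner_function (ell2_box a))"
  proof (rule entire_order_ell2_box_ge[OF a, of b])
    show "filterlim b at_top at_top" unfolding b_def by real_asymp
    show "1 \<le> a i * b n" if "i < n" for n i
      using bmono[of i n] bpos[of i] that by (simp add: a_def)
    fix \<mu> :: real assume "0 < \<mu>" "\<mu> < 1"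
    then show "filterlim (\<lambda>n. real n * ln 2 - b n powr \<mu>) at_top at_top"
      unfolding b_def by real_asymp
  qed simp
  moreover have "entire_order (steiner_function (ell2_box a)) \<le> ereal 1"
    using entire_order_steiner_le_1[OF GB_set_ell2_box[OF a]] by (simp add: one_ereal_def)
  ultimately show ?thesis using GB_set_ell2_box[OF a] by (intro exI[of _ "ell2_box a"]) (simp add: antisym)
qed

theorem theorem3p1:
  shows "(\<forall>K :: 'h :: {real_inner, complete_space, second_countable_topology} set.
            GB_set K \<longrightarrow>
              entire_order (steiner_function K) \<le> 1 \<and>
              (entire_order (steiner_function K) = 1 \<longrightarrow>
                 entire_type (steiner_function K) \<le> intrinsic_volume 1 K)) \<and>
         (\<forall>\<rho>::real. 0 \<le> \<rho> \<and> \<rho> \<le> 1 \<longrightarrow>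
            (\<exists>K :: ell2 set. GB_set K \<and> entire_order (steiner_function K) = ereal \<rho>))"
proof (intro conjI allI impI)
  fix K :: "'h set" assume K: "GB_set K"
  show "entire_order (steiner_function K) \<le> 1" by (rule entire_order_steiner_le_1[OF K])
  assume "entire_order (steiner_function K) = 1"
  with K show "entire_type (steiner_function K) \<le> intrinsic_volume 1 K" by (rule entire_type_steiner_le)
next
  fix \<rho> :: real assume "0 \<le> \<rho> \<and> \<rho> \<le> 1"
  then consider "\<rho> = 0" | "0 < \<rho>" "\<rho> < 1" | "\<rho> = 1" by linarith
  then show "\<exists>K :: ell2 set. GB_set K \<and> entire_order (steiner_function K) = ereal \<rho>"
    by cases (use GB_set_of_order_0 GB_set_of_order_between GB_set_of_order_1 in auto)
qed

end
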